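(* Let $\Sigma$ be a signature consisting only of sorts and relation symbols, without function symbols. Then the cartesian syntactic category $\mathcal C_\Sigma^{\rm car}$ of the theory without axioms of signature $\Sigma$ is described as follows. (i) Its objects are indexed by the combinatorial data $(\mathcal A,m_\bullet,\mathcal R)$ consisting of - a finite subset $\mathcal A$ of the set of sorts of $\Sigma$; - a map $A\mapsto m_A$ assigning to each sort $A\in\mathcal A$ a multiplicity $m_A\ge1$; - a finite subset $\mathcal R$ of the set of pairs $(R,\alpha)$ consisting of a relation symbol $R\rightarrowtail A_1\cdots A_{n_R}$ of $\Sigma$ with $A_i\in\mathcal A$ for $1\le i\le n_R$, and a map $\alpha:\{1,\dots,n_R\}\to\mathbb N$ with $1\le\alpha(i)\le m_{A_i}$ for $1\le i\le n_R$. Choosing variable names $x_i^A$, $1\le i\le m_A$, $A\in\mathcal A$, the corresponding object is the Horn formula in the finite family of variables $\vec x_{\mathcal A,m_\bullet}=(x_i^A)_{A\in\mathcal A,\,1\le i\le m_A}$ $$\varphi_{\mathcal R}(\vec x_{\mathcal A,m_\bullet})=\bigwedge_{(R,\alpha)\in\mathcal R}R\big(x_{\alpha(1)}^{A_1},\dots,x_{\alpha(n_R)}^{A_{n_R}}\big).$$ (ii) Morphisms from an object $\varphi_{\mathcal R}(\vec x_{\mathcal A,m_\bullet})$ to an object $\varphi_{\mathcal R'}(\vec y_{\mathcal A',m'_\bullet})$, where $\vec y_{\mathcal A',m'_\bullet}=(y_i^A)_{A\in\mathcal A',\,1\le i\le m'_A}$, can exist only if $\mathcal A'\subseteq\mathcal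 A$. If this holds, they are indexed by the finite families of maps $$f_A:\{1,\dots,m'_A\}\to\{1,\dots,m_A\},\quad A\in\mathcal A',$$ such that, for every element $(R\rightarrowtail A_1\cdots A_{n_R},\ \beta:\{1,\dots,n_R\}\to\mathbb N)\in\mathcal R'$, the map $\alpha:i\mapsto f_{A_i}(\beta(i))$ satisfies $(R,\alpha)\in\mathcal R$. The morphism indexed by such a family is defined by the formulas $y_i^A=x^A_{f_A(i)}$, $A\in\mathcal A'$, $1\le i\le m'_A$. (iii) The composite of two morphisms $$\varphi_{\mathcal R}(\vec x_{\mathcal A,m_\bullet})\to\varphi_{\mathcal R'}(\vec y_{\mathcal A',m'_\bullet})\to\varphi_{\mathcal R''}(\vec z_{\mathcal A'',m''_\bullet})$$ indexed by families $(f_A)_{A\in\mathcal A'}$ and $(g_A:\{1,\dots,m''_A\}\to\{1,\dots,m'_A\})_{A\in\mathcal A''}$ is the morphism indexed by the family of composites $(f_A\circ g_A:\{1,\dots,m''_A\}\to\{1,\dots,m_A\})_{A\in\mathcal A''}$.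
   Context: A Horn formula is a finite conjunction of atomic formulas. For a geometric theory $\mathbb T$, a $\mathbb T$-cartesian formula is a formula $(\exists\vec y)\varphi(\vec x,\vec y)$ with $\varphi$ a Horn formula such that $\varphi(\vec x,\vec y)\wedge\varphi(\vec x,\vec y\,')\vdash\vec y=\vec y\,'$ is provable in $\mathbb T$. For a cartesian theory $\mathbb T$ (in particular a theory without axioms), the cartesian syntactic category $\mathcal C^{\rm car}_{\mathbb T}$ has as objects the $\mathbb T$-cartesian formulas $\varphi(\vec x)$ in finite families of variables (considered up to renaming variables), and as morphisms $\varphi(\vec x)\to\psi(\vec y)$ the ($\mathbb T$-provable equivalence classes of) $\mathbb T$-cartesian formulas $\theta(\vec x,\vec y)$ which are provably functional, i.e. such that $\theta\vdash\varphi(\vec x)\wedge\psi(\vec y)$, $\varphi(\vec x)\vdash(\exists\vec y)\theta(\vec x,\vec y)$ and $\theta(\vec x,\vec y)\wedge\theta(\vec x,\vec y\,')\vdash\vec y=\vec y\,'$ are provable in $\mathbb T$; the composite of $\theta(\vec x,\vec y)$ and $\theta'(\vec y,\vec z)$ is $(\exists\vec y)(\theta\wedge\theta')$. The description is to be understood up to canonical isomorphism of objects, i.e. up to equivalence of categories. *)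

theory Defs
  imports "HOL-Library.FSet" "HOL-Library.Multiset" "HOL-Library.FuncSet"
begin

section \<open>Categories and equivalences\<close>

text \<open>Composition is written in diagrammatic order: \<open>Comp C X Y Z f g\<close> is the composite of
  \<open>f : X \<rightarrow> Y\<close> and \<open>g : Y \<rightarrow> Z\<close>.\<close>

record ('o, 'm) cat =
  Ob :: "'o set"
  Hom :: "'o \<Rightarrow> 'o \<Rightarrow> 'm set"
  Ident :: "'o \<Rightarrow> 'm"
  Comp :: "'o \<Rightarrow> 'o \<Rightarrow> 'o \<Rightarrow> 'm \<Rightarrow> 'm \<Rightarrow> 'm"

locale category =
  fixes C :: "('o, 'm) cat"
  assumes ident_in_hom: "X \<in> Ob C \<Longrightarrow> Ident C X \<in> Hom C X X"
    and comp_in_hom: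
      "\<lbrakk>X \<in> Ob C; Y \<in> Ob C; Z \<in> Ob C; f \<in> Hom C X Y; g \<in> Hom C Y Z\<rbrakk>
        \<Longrightarrow> Comp C X Y Z f g \<in> Hom C X Z"
    and comp_ident_left:
      "\<lbrakk>X \<in> Ob C; Y \<in> Ob C; f \<in> Hom C X Y\<rbrakk> \<Longrightarrow> Comp C X X Y (Ident C X) f = f"
    and comp_ident_right:
      "\<lbrakk>X \<in> Ob C; Y \<in> Ob C; f \<in> Hom C X Y\<rbrakk> \<Longrightarrow> Comp C X Y Y f (Ident C Y) = f"
    and comp_assoc:
      "\<lbrakk>W \<in> Ob C; X \<in> Ob C; Y \<in> Ob C; Z \<in> Ob C;
        f \<in> Hom C W X; g \<in> Hom C X Y; h \<in> Hom C Y Z\<rbrakk>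
        \<Longrightarrow> Comp C W Y Z (Comp C W X Y f g) h = Comp C W X Z f (Comp C X Y Z g h)"

definition isomorphic_in :: "('o, 'm) cat \<Rightarrow> 'o \<Rightarrow> 'o \<Rightarrow> bool" where
  "isomorphic_in C X Y \<longleftrightarrow>
    (\<exists>f \<in> Hom C X Y. \<exists>g \<in> Hom C Y X.
       Comp C X Y X f g = Ident C X \<and> Comp C Y X Y g f = Ident C Y)"

locale equivalence_of_categories =
  C: category C + D: category D
  for C :: "('o, 'm) cat" and D :: "('p, 'n) cat" +
  fixes Fo :: "'o \<Rightarrow> 'p" and Fm :: "'o \<Rightarrow> 'o \<Rightarrow> 'm \<Rightarrow> 'n"
  assumes ob_map: "X \<in> Ob C \<Longrightarrow> Fo X \<in> Ob D"
    and fully_faithful: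
      "\<lbrakk>X \<in> Ob C; Y \<in> Ob C\<rbrakk> \<Longrightarrow> bij_betw (Fm X Y) (Hom C X Y) (Hom D (Fo X) (Fo Y))"
    and preserves_ident: "X \<in> Ob C \<Longrightarrow> Fm X X (Ident C X) = Ident D (Fo X)"
    and preserves_comp:
      "\<lbrakk>X \<in> Ob C; Y \<in> Ob C; Z \<in> Ob C; f \<in> Hom C X Y; g \<in> Hom C Y Z\<rbrakk>
        \<Longrightarrow> Fm X Z (Comp C X Y Z f g) = Comp D (Fo X) (Fo Y) (Fo Z) (Fm X Y f) (Fm Y Z g)"
    and essentially_surjective: "P \<in> Ob D \<Longrightarrow> \<exists>X \<in> Ob C. isomorphic_in D P (Fo X)"


section \<open>Signatures, variables and geometric formulas\<close>

record ('s, 'r) signature =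
  sorts :: "'s set"
  rels :: "'r set"
  arity :: "'r \<Rightarrow> 's list"

definition wf_signature :: "('s, 'r) signature \<Rightarrow> bool" where
  "wf_signature \<Sigma> \<longleftrightarrow> (\<forall>R \<in> rels \<Sigma>. set (arity \<Sigma> R) \<subseteq> sorts \<Sigma>)"

text \<open>The variable \<open>(A, i)\<close> is $x_i^A$, with $i \geq 1$.  Up to renaming, a finite family of
  variables is determined by the number of its members of each sort, so a context is a finite
  multiset \<open>\<Gamma>\<close> of sorts; its variables are the \<open>(A, i)\<close> with \<open>1 \<le> i \<le> count \<Gamma> A\<close>.
  The disjoint union of the families \<open>\<Gamma>\<close> and \<open>\<Delta>\<close> is \<open>\<Gamma> + \<Delta>\<close>: the variable \<open>(A, i)\<close> of
  \<open>\<Gamma>\<close> keeps its name, the variable \<open>(A, i)\<close> of \<open>\<Delta>\<close> becomes \<open>(A, count \<Gamma> A + i)\<close>.\<close>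

type_synonym 's var = "'s \<times> nat"

type_synonym 's ctx = "'s multiset"

definition context_over :: "('s, 'r) signature \<Rightarrow> 's ctx \<Rightarrow> bool" where
  "context_over \<Sigma> \<Gamma> \<longleftrightarrow> set_mset \<Gamma> \<subseteq> sorts \<Sigma>"

definition vars :: "'s ctx \<Rightarrow> 's var set" where
  "vars \<Gamma> = {(A, i). 1 \<le> i \<and> i \<le> count \<Gamma> A}"

text \<open>Without function symbols the only terms are variables.  \<open>Exists \<Delta> \<phi>\<close> quantifies over the
  whole family \<open>\<Delta>\<close>, de Bruijn style: if it is a formula in the context \<open>\<Gamma>\<close>, then \<open>\<phi>\<close>
  is one in the context \<open>\<Delta> + \<Gamma>\<close>, the quantified variables coming first.  Disjunctions are
  indexed by arbitrary sets of elements of \<open>'i\<close>.\<close>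

datatype ('s, 'r, 'i) form =
    Equal "'s var" "'s var"
  | Rel 'r "'s var list"
  | Conj "('s, 'r, 'i) form fset"
  | Disj "'i set" "'i \<Rightarrow> ('s, 'r, 'i) form"
  | Exists "'s ctx" "('s, 'r, 'i) form"

inductive formula :: "('s, 'r) signature \<Rightarrow> 's ctx \<Rightarrow> ('s, 'r, 'i) form \<Rightarrow> bool"
  for \<Sigma> :: "('s, 'r) signature" where
  equal: "\<lbrakk>context_over \<Sigma> \<Gamma>; (A, i) \<in> vars \<Gamma>; (A, j) \<in> vars \<Gamma>\<rbrakk>
    \<Longrightarrow> formula \<Sigma> \<Gamma> (Equal (A, i) (A, j))"
| rel: "\<lbrakk>context_over \<Sigma> \<Gamma>; R \<in> rels \<Sigma>; set xs \<subseteq> vars \<Gamma>; map fst xs = arity \<Sigma> R\<rbrakk>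
    \<Longrightarrow> formula \<Sigma> \<Gamma> (Rel R xs)"
| conj: "\<lbrakk>context_over \<Sigma> \<Gamma>; \<And>\<phi>. \<phi> |\<in>| F \<Longrightarrow> formula \<Sigma> \<Gamma> \<phi>\<rbrakk> \<Longrightarrow> formula \<Sigma> \<Gamma> (Conj F)"
| disj: "\<lbrakk>context_over \<Sigma> \<Gamma>; \<And>i. i \<in> I \<Longrightarrow> formula \<Sigma> \<Gamma> (\<phi> i)\<rbrakk>
    \<Longrightarrow> formula \<Sigma> \<Gamma> (Disj I \<phi>)"
| ex: "\<lbrakk>context_over \<Sigma> \<Gamma>; context_over \<Sigma> \<Delta>; formula \<Sigma> (\<Delta> + \<Gamma>) \<phi>\<rbrakk>
    \<Longrightarrow> formula \<Sigma> \<Gamma> (Exists \<Delta> \<phi>)"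


section \<open>Substitution\<close>

text \<open>A substitution of variables for variables preserves sorts, so it is a family of maps
  on indices, one for each sort.\<close>

type_synonym 's subst = "'s \<Rightarrow> nat \<Rightarrow> nat"

definition substitution :: "'s ctx \<Rightarrow> 's ctx \<Rightarrow> 's subst \<Rightarrow> bool" where
  "substitution \<Gamma> \<Delta> f \<longleftrightarrow> (\<forall>(A, i) \<in> vars \<Gamma>. (A, f A i) \<in> vars \<Delta>)"

definition same :: "'s subst" where
  "same A i = i"

definition shift :: "'s ctx \<Rightarrow> 's subst" where
  "shift \<Gamma> A i = count \<Gamma> A + i"

text \<open>\<open>copair \<Gamma> f g\<close> substitutes by \<open>f\<close> in the first block \<open>\<Gamma>\<close> of a context \<open>\<Gamma> + \<Delta>\<close>
  and by \<open>g\<close> in the second block \<open>\<Delta>\<close>.\<close>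

definition copair :: "'s ctx \<Rightarrow> 's subst \<Rightarrow> 's subst \<Rightarrow> 's subst" where
  "copair \<Gamma> f g A i = (if i \<le> count \<Gamma> A then f A i else g A (i - count \<Gamma> A))"

definition subst_var :: "'s subst \<Rightarrow> 's var \<Rightarrow> 's var" where
  "subst_var f x = (fst x, f (fst x) (snd x))"

primrec subst :: "('s, 'r, 'i) form \<Rightarrow> 's subst \<Rightarrow> ('s, 'r, 'i) form" where
  "subst (Equal x y) f = Equal (subst_var f x) (subst_var f y)"
| "subst (Rel R xs) f = Rel R (map (subst_var f) xs)"
| "subst (Conj F) f = Conj ((\<lambda>\<phi>. subst \<phi> f) |`| F)"
| "subst (Disj I \<phi>) f = Disj I (\<lambda>i. subst (\<phi> i) f)"
| "subst (Exists \<Delta> \<phi>) f = Exists \<Delta> (subst \<phi> (copair \<Delta> same (\<lambda>A i. shift \<Delta> A (f A i))))"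

text \<open>For a formula \<open>\<theta>(x, y)\<close> whose context has the first block \<open>\<Gamma>\<close>, \<open>at2 \<Gamma> \<theta> u v\<close> is
  \<open>\<theta>(u, v)\<close>.\<close>

definition at2 :: "'s ctx \<Rightarrow> ('s, 'r, 'i) form \<Rightarrow> 's subst \<Rightarrow> 's subst \<Rightarrow> ('s, 'r, 'i) form" where
  "at2 \<Gamma> \<theta> u v = subst \<theta> (copair \<Gamma> u v)"

abbreviation And :: "('s, 'r, 'i) form \<Rightarrow> ('s, 'r, 'i) form \<Rightarrow> ('s, 'r, 'i) form" where
  "And \<phi> \<psi> \<equiv> Conj {|\<phi>, \<psi>|}"

text \<open>Only used for finite sets of formulas.\<close>

definition conj_of :: "('s, 'r, 'i) form set \<Rightarrow> ('s, 'r, 'i) form" where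
  "conj_of S = Conj (Abs_fset S)"

text \<open>The equality \<open>u = v\<close> of two families of variables indexed by \<open>\<Delta>\<close>.\<close>

definition equal_families :: "'s ctx \<Rightarrow> 's subst \<Rightarrow> 's subst \<Rightarrow> ('s, 'r, 'i) form" where
  "equal_families \<Delta> u v = conj_of ((\<lambda>x. Equal (subst_var u x) (subst_var v x)) ` vars \<Delta>)"


section \<open>Provability in a geometric theory\<close>

text \<open>A theory is a set of sequents; \<open>(\<Gamma>, \<phi>, \<psi>)\<close> is $\varphi \vdash_\Gamma \psi$.  The rules are
  those of the usual sequent calculus of (infinitary) geometric logic; sorts may be empty.\<close>

type_synonym ('s, 'r, 'i) thy = "('s ctx \<times> ('s, 'r, 'i) form \<times> ('s, 'r, 'i) form) set"

inductive provable ::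
  "('s, 'r) signature \<Rightarrow> ('s, 'r, 'i) thy \<Rightarrow> 's ctx
    \<Rightarrow> ('s, 'r, 'i) form \<Rightarrow> ('s, 'r, 'i) form \<Rightarrow> bool"
  for \<Sigma> :: "('s, 'r) signature" and T :: "('s, 'r, 'i) thy" where
  axiom: "\<lbrakk>(\<Gamma>, \<phi>, \<psi>) \<in> T; formula \<Sigma> \<Gamma> \<phi>; formula \<Sigma> \<Gamma> \<psi>\<rbrakk> \<Longrightarrow> provable \<Sigma> T \<Gamma> \<phi> \<psi>"
| identity: "formula \<Sigma> \<Gamma> \<phi> \<Longrightarrow> provable \<Sigma> T \<Gamma> \<phi> \<phi>"
| cut: "\<lbrakk>provable \<Sigma> T \<Gamma> \<phi> \<psi>; provable \<Sigma> T \<Gamma> \<psi> \<chi>\<rbrakk> \<Longrightarrow> provable \<Sigma> T \<Gamma> \<phi> \<chi>"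
| substitute: "\<lbrakk>provable \<Sigma> T \<Gamma> \<phi> \<psi>; context_over \<Sigma> \<Delta>; substitution \<Gamma> \<Delta> f\<rbrakk>
    \<Longrightarrow> provable \<Sigma> T \<Delta> (subst \<phi> f) (subst \<psi> f)"
| equal_refl: "\<lbrakk>context_over \<Sigma> \<Gamma>; (A, i) \<in> vars \<Gamma>\<rbrakk>
    \<Longrightarrow> provable \<Sigma> T \<Gamma> (Conj {||}) (Equal (A, i) (A, i))"
| equal_subst: "\<lbrakk>(A, i) \<in> vars \<Gamma>; (A, j) \<in> vars \<Gamma>; formula \<Sigma> \<Gamma> \<phi>\<rbrakk>
    \<Longrightarrow> provable \<Sigma> T \<Gamma> (And (Equal (A, i) (A, j)) \<phi>)
          (subst \<phi> (\<lambda>B k. if B = A \<and> k = i then j else k))"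
| conj_left: "\<lbrakk>formula \<Sigma> \<Gamma> (Conj F); \<phi> |\<in>| F\<rbrakk> \<Longrightarrow> provable \<Sigma> T \<Gamma> (Conj F) \<phi>"
| conj_right: "\<lbrakk>formula \<Sigma> \<Gamma> \<phi>; \<And>\<psi>. \<psi> |\<in>| F \<Longrightarrow> provable \<Sigma> T \<Gamma> \<phi> \<psi>\<rbrakk>
    \<Longrightarrow> provable \<Sigma> T \<Gamma> \<phi> (Conj F)"
| disj_right: "\<lbrakk>formula \<Sigma> \<Gamma> (Disj I \<phi>); i \<in> I\<rbrakk> \<Longrightarrow> provable \<Sigma> T \<Gamma> (\<phi> i) (Disj I \<phi>)"
| disj_left: "\<lbrakk>formula \<Sigma> \<Gamma> \<psi>; \<And>i. i \<in> I \<Longrightarrow> provable \<Sigma> T \<Gamma> (\<phi> i) \<psi>\<rbrakk>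
    \<Longrightarrow> provable \<Sigma> T \<Gamma> (Disj I \<phi>) \<psi>"
| distributivity: "\<lbrakk>formula \<Sigma> \<Gamma> \<phi>; formula \<Sigma> \<Gamma> (Disj I \<psi>)\<rbrakk>
    \<Longrightarrow> provable \<Sigma> T \<Gamma> (And \<phi> (Disj I \<psi>)) (Disj I (\<lambda>i. And \<phi> (\<psi> i)))"
| ex_left: "\<lbrakk>context_over \<Sigma> \<Delta>; formula \<Sigma> \<Gamma> \<psi>; provable \<Sigma> T (\<Delta> + \<Gamma>) \<phi> (subst \<psi> (shift \<Delta>))\<rbrakk>
    \<Longrightarrow> provable \<Sigma> T \<Gamma> (Exists \<Delta> \<phi>) \<psi>"
| ex_right: "\<lbrakk>formula \<Sigma> (\<Delta> + \<Gamma>) \<phi>; formula \<Sigma> \<Gamma> \<psi>; provable \<Sigma> T \<Gamma> (Exists \<Delta> \<phi>) \<psi>\<rbrakk>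
    \<Longrightarrow> provable \<Sigma> T (\<Delta> + \<Gamma>) \<phi> (subst \<psi> (shift \<Delta>))"
| frobenius: "\<lbrakk>formula \<Sigma> \<Gamma> \<phi>; formula \<Sigma> \<Gamma> (Exists \<Delta> \<psi>)\<rbrakk>
    \<Longrightarrow> provable \<Sigma> T \<Gamma> (And \<phi> (Exists \<Delta> \<psi>)) (Exists \<Delta> (And (subst \<phi> (shift \<Delta>)) \<psi>))"

definition equivalent ::
  "('s, 'r) signature \<Rightarrow> ('s, 'r, 'i) thy \<Rightarrow> 's ctx
    \<Rightarrow> ('s, 'r, 'i) form \<Rightarrow> ('s, 'r, 'i) form \<Rightarrow> bool" where
  "equivalent \<Sigma> T \<Gamma> \<phi> \<psi> \<longleftrightarrow> provable \<Sigma> T \<Gamma> \<phi> \<psi> \<and> provable \<Sigma> T \<Gamma> \<psi> \<phi>"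


section \<open>The cartesian syntactic category\<close>

definition atomic :: "('s, 'r, 'i) form \<Rightarrow> bool" where
  "atomic \<phi> \<longleftrightarrow> (\<exists>x y. \<phi> = Equal x y) \<or> (\<exists>R xs. \<phi> = Rel R xs)"

definition horn :: "('s, 'r) signature \<Rightarrow> 's ctx \<Rightarrow> ('s, 'r, 'i) form \<Rightarrow> bool" where
  "horn \<Sigma> \<Gamma> \<phi> \<longleftrightarrow> formula \<Sigma> \<Gamma> \<phi> \<and> (\<exists>F. \<phi> = Conj F \<and> (\<forall>\<psi>. \<psi> |\<in>| F \<longrightarrow> atomic \<psi>))"

text \<open>The first alternative is the case of an empty family of quantified variables.  In the
  second one, the uniqueness sequent lives in the context \<open>\<Delta> + \<Delta> + \<Gamma>\<close> of the variables
  \<open>y, y', x\<close>.\<close>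

definition cartesian ::
  "('s, 'r) signature \<Rightarrow> ('s, 'r, 'i) thy \<Rightarrow> 's ctx \<Rightarrow> ('s, 'r, 'i) form \<Rightarrow> bool" where
  "cartesian \<Sigma> T \<Gamma> \<chi> \<longleftrightarrow>
    horn \<Sigma> \<Gamma> \<chi> \<or>
    (\<exists>\<Delta> \<phi>. \<chi> = Exists \<Delta> \<phi> \<and> formula \<Sigma> \<Gamma> \<chi> \<and> horn \<Sigma> (\<Delta> + \<Gamma>) \<phi> \<and>
       provable \<Sigma> T (\<Delta> + \<Delta> + \<Gamma>)
         (And (at2 \<Delta> \<phi> same (shift (\<Delta> + \<Delta>)))
              (at2 \<Delta> \<phi> (shift \<Delta>) (shift (\<Delta> + \<Delta>))))
         (equal_families \<Delta> same (shift \<Delta>)))"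

text \<open>An object \<open>(\<Gamma>, \<phi>)\<close> is a cartesian formula in its context.\<close>

type_synonym ('s, 'r, 'i) obj = "'s ctx \<times> ('s, 'r, 'i) form"

text \<open>A formula \<open>\<theta>(x, y)\<close> from \<open>(\<Gamma>, \<phi>)\<close> to \<open>(\<Delta>, \<psi>)\<close> has context \<open>\<Gamma> + \<Delta>\<close>.
  The quantified formula \<open>(\<exists>y) \<theta>(x, y)\<close> needs \<open>y\<close> as first block, and the last sequent has
  variables \<open>x, y, y'\<close>.\<close>

definition functional ::
  "('s, 'r) signature \<Rightarrow> ('s, 'r, 'i) thy
    \<Rightarrow> ('s, 'r, 'i) obj \<Rightarrow> ('s, 'r, 'i) obj \<Rightarrow> ('s, 'r, 'i) form \<Rightarrow> bool" where
  "functional \<Sigma> T X Y \<theta> \<longleftrightarrow> (case X of (\<Gamma>, \<phi>) \<Rightarrow> case Y of (\<Delta>, \<psi>) \<Rightarrow>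
     provable \<Sigma> T (\<Gamma> + \<Delta>) \<theta> (And \<phi> (subst \<psi> (shift \<Gamma>))) \<and>
     provable \<Sigma> T \<Gamma> \<phi> (Exists \<Delta> (at2 \<Gamma> \<theta> (shift \<Delta>) same)) \<and>
     provable \<Sigma> T (\<Gamma> + \<Delta> + \<Delta>)
       (And (at2 \<Gamma> \<theta> same (shift \<Gamma>)) (at2 \<Gamma> \<theta> same (shift (\<Gamma> + \<Delta>))))
       (equal_families \<Delta> (shift \<Gamma>) (shift (\<Gamma> + \<Delta>))))"

text \<open>The class of \<open>\<theta>\<close> consists of the cartesian formulas provably equivalent to it; \<open>\<theta>\<close>
  itself need not literally have the shape of a cartesian formula.\<close>

definition formula_class ::
  "('s, 'r) signature \<Rightarrow> ('s, 'r, 'i) thy \<Rightarrow> 's ctx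
    \<Rightarrow> ('s, 'r, 'i) form \<Rightarrow> ('s, 'r, 'i) form set" where
  "formula_class \<Sigma> T \<Gamma> \<theta> = {\<chi>. cartesian \<Sigma> T \<Gamma> \<chi> \<and> equivalent \<Sigma> T \<Gamma> \<theta> \<chi>}"

text \<open>\<open>(\<exists>y) (\<theta>(x, y) \<and> \<theta>'(y, z))\<close> for \<open>x, y, z\<close> in \<open>\<Gamma>, \<Delta>, \<Xi>\<close>; under the quantifier
  the context is \<open>\<Delta> + \<Gamma> + \<Xi>\<close>, with variables \<open>y, x, z\<close>.\<close>

definition compose_formula ::
  "'s ctx \<Rightarrow> 's ctx \<Rightarrow> ('s, 'r, 'i) form \<Rightarrow> ('s, 'r, 'i) form \<Rightarrow> ('s, 'r, 'i) form" where
  "compose_formula \<Gamma> \<Delta> \<theta> \<theta>' =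
    Exists \<Delta> (And (at2 \<Gamma> \<theta> (shift \<Delta>) same) (at2 \<Delta> \<theta>' same (shift (\<Delta> + \<Gamma>))))"

definition syntactic_category ::
  "('s, 'r) signature \<Rightarrow> ('s, 'r, 'i) thy
    \<Rightarrow> (('s, 'r, 'i) obj, ('s, 'r, 'i) form set) cat" where
  "syntactic_category \<Sigma> T =
    \<lparr>Ob = {(\<Gamma>, \<phi>). cartesian \<Sigma> T \<Gamma> \<phi>},
     Hom = (\<lambda>X Y. {formula_class \<Sigma> T (fst X + fst Y) \<theta> | \<theta>.
                     cartesian \<Sigma> T (fst X + fst Y) \<theta> \<and> functional \<Sigma> T X Y \<theta>}),
     Ident = (\<lambda>(\<Gamma>, \<phi>). formula_class \<Sigma> T (\<Gamma> + \<Gamma>)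
                         (And \<phi> (equal_families \<Gamma> same (shift \<Gamma>)))),
     Comp = (\<lambda>X Y Z M N. \<Union>\<theta> \<in> M. \<Union>\<theta>' \<in> N.
               formula_class \<Sigma> T (fst X + fst Z) (compose_formula (fst X) (fst Y) \<theta> \<theta>'))\<rparr>"


section \<open>The combinatorial description\<close>

text \<open>A map $\alpha : \{1, \dots, n_R\} \to \mathbb{N}$ is the list of its values; the maps
  \<open>mult D\<close> and the families $(f_A)$ are extensional, so that equality is equality of maps.\<close>

record ('s, 'r) comb_data =
  support :: "'s set"
  mult :: "'s \<Rightarrow> nat"
  relset :: "('r \<times> nat list) set"

definition comb_data_over :: "('s, 'r) signature \<Rightarrow> ('s, 'r) comb_data set" where
  "comb_data_over \<Sigma> = {D.
     finite (support D) \<and> support D \<subseteq> sorts \<Sigma> \<and>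
     mult D \<in> support D \<rightarrow>\<^sub>E {1..} \<and>
     finite (relset D) \<and>
     (\<forall>(R, \<alpha>) \<in> relset D.
        R \<in> rels \<Sigma> \<and> set (arity \<Sigma> R) \<subseteq> support D \<and> length \<alpha> = length (arity \<Sigma> R) \<and>
        (\<forall>k < length \<alpha>. 1 \<le> \<alpha> ! k \<and> \<alpha> ! k \<le> mult D (arity \<Sigma> R ! k)))}"

definition comb_context :: "('s, 'r) comb_data \<Rightarrow> 's ctx" where
  "comb_context D = (\<Sum>A \<in> support D. replicate_mset (mult D A) A)"

definition relation_atoms ::
  "('s, 'r) signature \<Rightarrow> ('s, 'r) comb_data \<Rightarrow> ('s, 'r, 'i) form set" where
  "relation_atoms \<Sigma> D = (\<lambda>(R, \<alpha>). Rel R (zip (arity \<Sigma> R) \<alpha>)) ` relset D"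

definition comb_object ::
  "('s, 'r) signature \<Rightarrow> ('s, 'r) comb_data \<Rightarrow> ('s, 'r, 'i) obj" where
  "comb_object \<Sigma> D = (comb_context D, conj_of (relation_atoms \<Sigma> D))"

text \<open>\<open>map2 f (arity \<Sigma> R) \<beta>\<close> is the map $i \mapsto f_{A_i}(\beta(i))$.\<close>

definition comb_families ::
  "('s, 'r) signature \<Rightarrow> ('s, 'r) comb_data \<Rightarrow> ('s, 'r) comb_data \<Rightarrow> ('s \<Rightarrow> nat \<Rightarrow> nat) set" where
  "comb_families \<Sigma> D D' =
    {f \<in> (\<Pi>\<^sub>E A \<in> support D'. {1..mult D' A} \<rightarrow>\<^sub>E {1..mult D A}).
       \<forall>(R, \<beta>) \<in> relset D'. (R, map2 f (arity \<Sigma> R) \<beta>) \<in> relset D}"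

text \<open>The formulas $y_i^A = x^A_{f_A(i)}$ are taken together with the formula of the domain, which a
  morphism has to imply; they then imply the formula of the codomain.  In the context
  \<open>comb_context D + comb_context D'\<close> of \<open>x, y\<close>, the index of $y_i^A$ is \<open>mult D A + i\<close>.\<close>

definition comb_morphism ::
  "('s, 'r) signature \<Rightarrow> ('s, 'r, 'i) thy \<Rightarrow> ('s, 'r) comb_data \<Rightarrow> ('s, 'r) comb_data
    \<Rightarrow> ('s \<Rightarrow> nat \<Rightarrow> nat) \<Rightarrow> ('s, 'r, 'i) form set" where
  "comb_morphism \<Sigma> T D D' f =
    formula_class \<Sigma> T (comb_context D + comb_context D')
      (conj_of (relation_atoms \<Sigma> D \<union>
         {Equal (A, mult D A + i) (A, f A i) | A i. A \<in> support D' \<and> i \<in> {1..mult D' A}}))"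

definition comb_compose ::
  "('s, 'r) comb_data \<Rightarrow> ('s \<Rightarrow> nat \<Rightarrow> nat) \<Rightarrow> ('s \<Rightarrow> nat \<Rightarrow> nat) \<Rightarrow> 's \<Rightarrow> nat \<Rightarrow> nat" where
  "comb_compose D'' f g = (\<lambda>A \<in> support D''. compose {1..mult D'' A} (f A) (g A))"

definition comb_category ::
  "('s, 'r) signature \<Rightarrow> (('s, 'r) comb_data, 's \<Rightarrow> nat \<Rightarrow> nat) cat" where
  "comb_category \<Sigma> =
    \<lparr>Ob = comb_data_over \<Sigma>,
     Hom = (\<lambda>D D'. if support D' \<subseteq> support D then comb_families \<Sigma> D D' else {}),
     Ident = (\<lambda>D. \<lambda>A \<in> support D. \<lambda>i \<in> {1..mult D A}. i),
     Comp = (\<lambda>D D' D'' f g. comb_compose D'' f g)\<rparr>"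

end

theory Submission
  imports Defs
begin

text \<open>
  Without function symbols and without axioms, a Horn formula \<open>\<phi>(x)\<close> is nothing but a finite
  presentation of a relational structure \<open>D\<close>: its elements are the variables, identified by the
  equations of \<open>\<phi>\<close>, and its relations are the relational atoms of \<open>\<phi>\<close>.  The solutions of \<open>\<phi>\<close> in a
  structure \<open>M\<close> are then the homomorphisms \<open>D \<rightarrow> M\<close>, and after numbering the elements of each sort
  \<open>D\<close> is exactly a combinatorial datum.  So the objects \<open>comb_object \<Sigma> D\<close> exhaust the Horn formulas
  up to isomorphism.

  A cartesian formula \<open>\<exists>y. \<phi>(x, y)\<close> brings nothing new.  The uniqueness of \<open>y\<close> can be tested in the
  structure in which all relations hold; there \<open>\<phi>\<close> retains only its equations, so \<open>y\<close> is unique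
  only if \<open>\<phi>\<close> already equates each member of \<open>y\<close> with some member of \<open>x\<close>
  (\<open>unique_witness_covered\<close>).  Hence cartesian formulas, too, are presented by a structure whose
  elements are named by the free variables (\<open>cartesian_presents\<close>).

  A provably functional formula between formulas presented by \<open>D\<close> and \<open>E\<close> is a natural
  transformation \<open>Hom(D, -) \<rightarrow> Hom(E, -)\<close>.  As in the Yoneda lemma it is determined by the image of
  the generic solution in \<open>D\<close>, which is a homomorphism \<open>E \<rightarrow> D\<close> (\<open>functional_presents\<close>); between
  combinatorial objects this is a family of maps \<open>f_A\<close> as in the theorem.  Composition of formulas
  becomes composition of homomorphisms (\<open>presents_compose\<close>).

  All this is semantic reasoning.  It is transported to provability by soundness and by a
  completeness theorem for formulas without disjunctions (\<open>provable_iff_entails\<close>).  Such a formula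
  provably implies a prenex one \<open>\<exists>y. \<phi>(x, y)\<close> with \<open>\<phi>\<close> a Horn formula, and what holds in the
  structure presented by \<open>\<phi>\<close> is provable from \<open>\<phi>\<close> (\<open>canonical_truth\<close>).
\<close>

section \<open>Contexts and substitutions\<close>

abbreviation comp_subst :: "'s subst \<Rightarrow> 's subst \<Rightarrow> 's subst" (infixr "\<odot>" 55) where
  "g \<odot> f \<equiv> \<lambda>A i. g A (f A i)"

text \<open>The values of a substitution outside its context are arbitrary, so that substitutions have to be
compared by this relation instead of equality.\<close>

definition agree :: "'s ctx \<Rightarrow> 's subst \<Rightarrow> 's subst \<Rightarrow> bool" where
  "agree \<Gamma> f g \<longleftrightarrow> (\<forall>A i. (A, i) \<in> vars \<Gamma> \<longrightarrow> f A i = g A i)"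

lemma agreeI: "(\<And>A i. (A, i) \<in> vars \<Gamma> \<Longrightarrow> f A i = g A i) \<Longrightarrow> agree \<Gamma> f g"
  by (simp add: agree_def)

lemma agreeD: "agree \<Gamma> f g \<Longrightarrow> (A, i) \<in> vars \<Gamma> \<Longrightarrow> f A i = g A i"
  by (simp add: agree_def)

lemma agree_refl [simp]: "agree \<Gamma> f f"
  by (simp add: agree_def)

lemma agree_sym: "agree \<Gamma> f g \<Longrightarrow> agree \<Gamma> g f"
  by (simp add: agree_def)

lemma substitution_iff:
  "substitution \<Gamma> \<Delta> f \<longleftrightarrow> (\<forall>A i. (A, i) \<in> vars \<Gamma> \<longrightarrow> (A, f A i) \<in> vars \<Delta>)"
  by (auto simp: substitution_def)

lemma substitutionD: "substitution \<Gamma> \<Delta> f \<Longrightarrow> (A, i) \<in> vars \<Gamma> \<Longrightarrow> (A, f A i) \<in> vars \<Delta>"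
  by (simp add: substitution_iff)

lemma vars_iff: "(A, i) \<in> vars \<Gamma> \<longleftrightarrow> 1 \<le> i \<and> i \<le> count \<Gamma> A"
  by (simp add: vars_def)

lemma vars_sort: "(A, i) \<in> vars \<Gamma> \<Longrightarrow> A \<in># \<Gamma>"
  by (auto simp: vars_iff intro: count_inI)

lemma finite_vars: "finite (vars \<Gamma>)"
proof -
  have "vars \<Gamma> \<subseteq> Sigma (set_mset \<Gamma>) (\<lambda>A. {1..count \<Gamma> A})"
    by (auto simp: vars_iff intro: vars_sort)
  then show ?thesis by (rule finite_subset) auto
qed

lemma vars_left: "(A, i) \<in> vars \<Gamma> \<Longrightarrow> (A, i) \<in> vars (\<Gamma> + \<Delta>)"
  by (simp add: vars_iff)

lemma vars_right: "(A, i) \<in> vars \<Delta> \<Longrightarrow> (A, count \<Gamma> A + i) \<in> vars (\<Gamma> + \<Delta>)"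
  by (simp add: vars_iff)

lemma vars_add_cases:
  assumes "(A, i) \<in> vars (\<Gamma> + \<Delta>)"
  obtains (left) "(A, i) \<in> vars \<Gamma>"
    | (right) j where "i = count \<Gamma> A + j" "(A, j) \<in> vars \<Delta>"
proof (cases "i \<le> count \<Gamma> A")
  case True
  then show ?thesis using assms left by (simp add: vars_iff)
next
  case False
  with assms have "(A, i - count \<Gamma> A) \<in> vars \<Delta>" by (auto simp: vars_iff)
  with False show ?thesis by (intro right) auto
qed

lemma copair_left: "(A, i) \<in> vars \<Gamma> \<Longrightarrow> copair \<Gamma> f g A i = f A i"
  by (simp add: vars_iff copair_def)

lemma copair_right: "(A, i) \<in> vars \<Delta> \<Longrightarrow> copair \<Gamma> f g A (count \<Gamma> A + i) = g A i"
  by (simp add: vars_iff copair_def)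

lemma agree_copair_iff:
  "agree (\<Gamma> + \<Delta>) (copair \<Gamma> f g) k \<longleftrightarrow> agree \<Gamma> f k \<and> agree \<Delta> g (k \<odot> shift \<Gamma>)"
proof
  assume a: "agree (\<Gamma> + \<Delta>) (copair \<Gamma> f g) k"
  show "agree \<Gamma> f k \<and> agree \<Delta> g (k \<odot> shift \<Gamma>)"
    using agreeD[OF a vars_left] agreeD[OF a vars_right]
    by (auto simp: agree_def copair_left copair_right shift_def)
next
  assume "agree \<Gamma> f k \<and> agree \<Delta> g (k \<odot> shift \<Gamma>)"
  then show "agree (\<Gamma> + \<Delta>) (copair \<Gamma> f g) k"
    by (auto simp: agree_def copair_left copair_right shift_def elim!: vars_add_cases)
qed

lemma agree_copair_iff':
  "agree (\<Gamma> + \<Delta>) k (copair \<Gamma> f g) \<longleftrightarrow> agree \<Gamma> k f \<and> agree \<Delta> (k \<odot> shift \<Gamma>) g"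
  using agree_copair_iff[of \<Gamma> \<Delta> f g k] unfolding agree_def by auto

lemma agree_copair_copair:
  "agree (\<Gamma> + \<Delta>) (copair \<Gamma> \<rho> \<sigma>) (copair \<Gamma> f g) \<longleftrightarrow> agree \<Gamma> \<rho> f \<and> agree \<Delta> \<sigma> g"
  unfolding agree_copair_iff
  by (auto simp: agree_def copair_left copair_right shift_def)

lemma comp_copair: "h \<odot> copair \<Gamma> f g = copair \<Gamma> (h \<odot> f) (h \<odot> g)"
  by (intro ext) (simp add: copair_def)

lemma substitution_shift [simp]: "substitution \<Gamma> (\<Delta> + \<Gamma>) (shift \<Delta>)"
  by (simp add: substitution_iff shift_def vars_right)

lemma substitution_same [simp]: "substitution \<Gamma> \<Gamma> same"
  by (simp add: substitution_iff same_def)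

lemma substitution_same_left [simp]: "substitution \<Gamma> (\<Gamma> + \<Delta>) same"
  by (simp add: substitution_iff same_def vars_left)

lemma substitution_copair:
  "substitution \<Gamma> \<Xi> f \<Longrightarrow> substitution \<Delta> \<Xi> g \<Longrightarrow> substitution (\<Gamma> + \<Delta>) \<Xi> (copair \<Gamma> f g)"
  by (auto simp: substitution_iff copair_left copair_right elim!: vars_add_cases)

lemma substitution_comp:
  "substitution \<Gamma> \<Delta> f \<Longrightarrow> substitution \<Delta> \<Xi> g \<Longrightarrow> substitution \<Gamma> \<Xi> (g \<odot> f)"
  by (simp add: substitution_iff)

lemma substitution_lift:
  "substitution \<Gamma> \<Xi> f \<Longrightarrow> substitution (\<Delta> + \<Gamma>) (\<Delta> + \<Xi>) (copair \<Delta> same (shift \<Delta> \<odot> f))"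
  by (intro substitution_copair substitution_same_left
      substitution_comp[OF _ substitution_shift])

lemma context_over_add [simp]:
  "context_over \<Sigma> (\<Gamma> + \<Delta>) \<longleftrightarrow> context_over \<Sigma> \<Gamma> \<and> context_over \<Sigma> \<Delta>"
  by (auto simp: context_over_def)

lemma formula_context: "formula \<Sigma> \<Gamma> \<phi> \<Longrightarrow> context_over \<Sigma> \<Gamma>"
  by (induction rule: formula.induct) auto

lemma agree_lift:
  assumes "agree \<Gamma> f g"
  shows "agree (\<Delta> + \<Gamma>) (copair \<Delta> same (shift \<Delta> \<odot> f)) (copair \<Delta> same (shift \<Delta> \<odot> g))"
  using assms by (auto simp: agree_def copair_left copair_right elim!: vars_add_cases)

lemma subst_var_eq [simp]: "subst_var f (A, i) = (A, f A i)"
  by (simp add: subst_var_def)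

section \<open>Regular formulas\<close>

text \<open>Formulas of geometric logic without disjunctions.  The syntactic category lives in this fragment.
Disjunctions are excluded also because \<open>Disj I \<phi>\<close> has components \<open>\<phi> i\<close> with \<open>i \<notin> I\<close> which are not
constrained at all, and on which the syntactic identities of substitution below fail.\<close>

inductive regular :: "('s, 'r) signature \<Rightarrow> 's ctx \<Rightarrow> ('s, 'r, 'i) form \<Rightarrow> bool"
  for \<Sigma> :: "('s, 'r) signature" where
  equal: "\<lbrakk>context_over \<Sigma> \<Gamma>; (A, i) \<in> vars \<Gamma>; (A, j) \<in> vars \<Gamma>\<rbrakk>
    \<Longrightarrow> regular \<Sigma> \<Gamma> (Equal (A, i) (A, j))"
| rel: "\<lbrakk>context_over \<Sigma> \<Gamma>; R \<in> rels \<Sigma>; set xs \<subseteq> vars \<Gamma>; map fst xs = arity \<Sigma> R\<rbrakk>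
    \<Longrightarrow> regular \<Sigma> \<Gamma> (Rel R xs)"
| conj: "\<lbrakk>context_over \<Sigma> \<Gamma>; \<And>\<phi>. \<phi> |\<in>| F \<Longrightarrow> regular \<Sigma> \<Gamma> \<phi>\<rbrakk> \<Longrightarrow> regular \<Sigma> \<Gamma> (Conj F)"
| ex: "\<lbrakk>context_over \<Sigma> \<Gamma>; context_over \<Sigma> \<Delta>; regular \<Sigma> (\<Delta> + \<Gamma>) \<phi>\<rbrakk>
    \<Longrightarrow> regular \<Sigma> \<Gamma> (Exists \<Delta> \<phi>)"

lemma regular_formula: "regular \<Sigma> \<Gamma> \<phi> \<Longrightarrow> formula \<Sigma> \<Gamma> \<phi>"
  by (induction rule: regular.induct) (auto intro: formula.intros)

lemma regular_context: "regular \<Sigma> \<Gamma> \<phi> \<Longrightarrow> context_over \<Sigma> \<Gamma>"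
  by (rule formula_context[OF regular_formula])

inductive_cases formula_ConjE: "formula \<Sigma> \<Gamma> (Conj F)"
inductive_cases formula_ExistsE: "formula \<Sigma> \<Gamma> (Exists \<Delta> \<phi>)"
inductive_cases formula_DisjE: "formula \<Sigma> \<Gamma> (Disj I \<phi>)"
inductive_cases regular_ConjE: "regular \<Sigma> \<Gamma> (Conj F)"
inductive_cases regular_ExistsE: "regular \<Sigma> \<Gamma> (Exists \<Delta> \<phi>)"

lemma regular_Conj_iff:
  "regular \<Sigma> \<Gamma> (Conj F) \<longleftrightarrow> context_over \<Sigma> \<Gamma> \<and> (\<forall>\<phi>. \<phi> |\<in>| F \<longrightarrow> regular \<Sigma> \<Gamma> \<phi>)"
  by (auto intro: regular.conj elim: regular_ConjE)

lemma regular_Exists_iff: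
  "regular \<Sigma> \<Gamma> (Exists \<Delta> \<phi>) \<longleftrightarrow> regular \<Sigma> (\<Delta> + \<Gamma>) \<phi>"
  using regular_context[of \<Sigma> "\<Delta> + \<Gamma>" \<phi>] by (auto intro: regular.ex elim: regular_ExistsE)

lemma formula_Equal_iff:
  "formula \<Sigma> \<Gamma> (Equal (A, i) (B, j)) \<longleftrightarrow>
    context_over \<Sigma> \<Gamma> \<and> A = B \<and> (A, i) \<in> vars \<Gamma> \<and> (B, j) \<in> vars \<Gamma>"
  by (auto intro: formula.equal elim: formula.cases)

lemma formula_Rel_iff:
  "formula \<Sigma> \<Gamma> (Rel R xs) \<longleftrightarrow>
    context_over \<Sigma> \<Gamma> \<and> R \<in> rels \<Sigma> \<and> set xs \<subseteq> vars \<Gamma> \<and> map fst xs = arity \<Sigma> R"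
  by (auto intro: formula.rel elim: formula.cases)

lemma formula_Conj_iff:
  "formula \<Sigma> \<Gamma> (Conj F) \<longleftrightarrow> context_over \<Sigma> \<Gamma> \<and> (\<forall>\<phi>. \<phi> |\<in>| F \<longrightarrow> formula \<Sigma> \<Gamma> \<phi>)"
  by (auto intro: formula.conj elim: formula_ConjE)

lemma formula_Exists_iff:
  "formula \<Sigma> \<Gamma> (Exists \<Delta> \<phi>) \<longleftrightarrow> formula \<Sigma> (\<Delta> + \<Gamma>) \<phi>"
  using formula_context[of \<Sigma> "\<Delta> + \<Gamma>" \<phi>] by (auto intro: formula.ex elim: formula_ExistsE)

lemma formula_Disj_iff:
  "formula \<Sigma> \<Gamma> (Disj I \<phi>) \<longleftrightarrow> context_over \<Sigma> \<Gamma> \<and> (\<forall>i\<in>I. formula \<Sigma> \<Gamma> (\<phi> i))"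
  by (auto intro: formula.disj elim: formula_DisjE)

lemma subst_And [simp]: "subst (And \<phi> \<psi>) f = And (subst \<phi> f) (subst \<psi> f)"
  by simp

lemma formula_subst:
  "formula \<Sigma> \<Gamma> \<phi> \<Longrightarrow> substitution \<Gamma> \<Delta> f \<Longrightarrow> context_over \<Sigma> \<Delta> \<Longrightarrow> formula \<Sigma> \<Delta> (subst \<phi> f)"
proof (induction arbitrary: \<Delta> f rule: formula.induct)
  case (rel \<Gamma> R xs)
  then show ?case
    by (force simp: substitution_iff comp_def subst_var_def intro!: formula.rel)
next
  case (ex \<Gamma> \<Xi> \<phi>)
  then show ?case by (auto simp: formula_Exists_iff intro!: ex.IH substitution_lift)
qed (auto intro!: formula.intros simp: substitution_iff)

lemma regular_subst:
  "regular \<Sigma> \<Gamma> \<phi> \<Longrightarrow> substitution \<Gamma> \<Delta> f \<Longrightarrow> context_over \<Sigma> \<Delta> \<Longrightarrow> regular \<Sigma> \<Delta> (subst \<phi> f)"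
proof (induction arbitrary: \<Delta> f rule: regular.induct)
  case (rel \<Gamma> R xs)
  then show ?case
    by (force simp: substitution_iff comp_def subst_var_def intro!: regular.rel)
next
  case (ex \<Gamma> \<Xi> \<phi>)
  then show ?case by (auto simp: regular_Exists_iff intro!: ex.IH substitution_lift)
qed (auto intro!: regular.intros simp: substitution_iff)

lemma subst_cong:
  "regular \<Sigma> \<Gamma> \<phi> \<Longrightarrow> agree \<Gamma> f g \<Longrightarrow> subst \<phi> f = subst \<phi> g"
proof (induction arbitrary: f g rule: regular.induct)
  case (rel \<Gamma> R xs)
  then show ?case by (auto simp: agree_def subst_var_def)
next
  case (conj \<Gamma> F)
  then have "(\<lambda>\<phi>. subst \<phi> f) |`| F = (\<lambda>\<phi>. subst \<phi> g) |`| F" by (intro fimage_cong) auto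
  then show ?case by simp
next
  case (ex \<Gamma> \<Delta> \<phi>)
  then show ?case by (simp add: agree_lift)
qed (auto simp: agree_def)

lemma subst_ident: "regular \<Sigma> \<Gamma> \<phi> \<Longrightarrow> agree \<Gamma> f same \<Longrightarrow> subst \<phi> f = \<phi>"
proof (induction arbitrary: f rule: regular.induct)
  case (rel \<Gamma> R xs)
  then show ?case by (auto simp: agree_def subst_var_def same_def intro!: map_idI)
next
  case (conj \<Gamma> F)
  then have "(\<lambda>\<phi>. subst \<phi> f) |`| F = (\<lambda>\<phi>. \<phi>) |`| F" by (intro fimage_cong) auto
  then show ?case by simp
next
  case (ex \<Gamma> \<Delta> \<phi>)
  have "agree (\<Delta> + \<Gamma>) (copair \<Delta> same (shift \<Delta> \<odot> f)) same"
    using ex.prems by (auto simp: agree_copair_iff) (auto simp: agree_def same_def)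
  then show ?case using ex.IH by simp
qed (auto simp: agree_def same_def)

lemma subst_subst:
  "regular \<Sigma> \<Gamma> \<phi> \<Longrightarrow> substitution \<Gamma> \<Delta> f \<Longrightarrow> subst (subst \<phi> f) g = subst \<phi> (g \<odot> f)"
proof (induction arbitrary: \<Delta> f g rule: regular.induct)
  case (rel \<Gamma> R xs)
  then show ?case by (auto simp: subst_var_def)
next
  case (conj \<Gamma> F)
  then have "(\<lambda>\<phi>. subst (subst \<phi> f) g) |`| F = (\<lambda>\<phi>. subst \<phi> (g \<odot> f)) |`| F"
    by (intro fimage_cong) auto
  then show ?case by (simp add: fset.map_comp comp_def)
next
  case (ex \<Gamma> \<Xi> \<phi>)
  let ?lift = "\<lambda>f. copair \<Xi> same (shift \<Xi> \<odot> f)"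
  have "subst (subst \<phi> (?lift f)) (?lift g) = subst \<phi> (?lift g \<odot> ?lift f)"
    by (rule ex.IH[OF substitution_lift[OF ex.prems]])
  also have "agree (\<Xi> + \<Gamma>) (?lift (g \<odot> f)) (?lift g \<odot> ?lift f)"
    by (auto simp: agree_def shift_def same_def copair_left copair_right
        copair_right[OF substitutionD[OF ex.prems]] elim!: vars_add_cases)
  then have "subst \<phi> (?lift g \<odot> ?lift f) = subst \<phi> (?lift (g \<odot> f))"
    by (rule subst_cong[OF ex.hyps(3), symmetric])
  finally show ?case by simp
qed auto

text \<open>A formula to which the family \<open>\<Delta>\<close> of dummy variables has been added does not change when these
are instantiated; this is how the shifts in the rules for \<open>Exists\<close> disappear again.\<close>

lemma subst_shift_copair:
  assumes "regular \<Sigma> \<Gamma> \<phi>" "agree \<Gamma> g same"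
  shows "subst (subst \<phi> (shift \<Delta>)) (copair \<Delta> v g) = \<phi>"
proof -
  have "agree \<Gamma> (copair \<Delta> v g \<odot> shift \<Delta>) same"
    using assms(2) by (auto simp: agree_def shift_def copair_right)
  then show ?thesis
    using subst_subst[OF assms(1) substitution_shift] subst_ident[OF assms(1)] by metis
qed

lemma subst_shift_shift:
  assumes "regular \<Sigma> \<Gamma> \<phi>"
  shows "subst (subst \<phi> (shift \<Delta>)) (shift \<Xi>) = subst \<phi> (shift (\<Xi> + \<Delta>))"
  by (rule trans[OF subst_subst[OF assms substitution_shift] subst_cong[OF assms]])
    (simp add: agree_def shift_def)

section \<open>Models and soundness\<close>

text \<open>All structures that have to be tested are countable, so natural numbers suffice as elements.
As in contexts, elements of different sorts may share a number, and the sorts of the members of a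
tuple are given by the arity of the relation.  An interpretation of the variables then has the same
type as a substitution, and \<open>copair\<close> and \<open>\<odot>\<close> serve for both.\<close>

record ('s, 'r) model =
  elements :: "'s \<Rightarrow> nat set"
  holds :: "('r \<times> nat list) set"

definition env :: "('s, 'r) model \<Rightarrow> 's ctx \<Rightarrow> 's subst \<Rightarrow> bool" where
  "env M \<Gamma> \<rho> \<longleftrightarrow> (\<forall>A i. (A, i) \<in> vars \<Gamma> \<longrightarrow> \<rho> A i \<in> elements M A)"

definition value_of :: "'s subst \<Rightarrow> 's var \<Rightarrow> nat" where
  "value_of \<rho> x = \<rho> (fst x) (snd x)"

text \<open>The clause for \<open>Conj\<close> is phrased through an image because of the recursion through finite sets;
\<open>sat_Conj\<close> is its meaning.\<close>

primrec sat :: "('s, 'r, 'i) form \<Rightarrow> ('s, 'r) model \<Rightarrow> 's subst \<Rightarrow> bool" where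
  "sat (Equal x y) M \<rho> \<longleftrightarrow> value_of \<rho> x = value_of \<rho> y"
| "sat (Rel R xs) M \<rho> \<longleftrightarrow> (R, map (value_of \<rho>) xs) \<in> holds M"
| "sat (Conj F) M \<rho> \<longleftrightarrow> False |\<notin>| (\<lambda>\<phi>. sat \<phi> M \<rho>) |`| F"
| "sat (Disj I \<phi>) M \<rho> \<longleftrightarrow> (\<exists>i\<in>I. sat (\<phi> i) M \<rho>)"
| "sat (Exists \<Delta> \<phi>) M \<rho> \<longleftrightarrow> (\<exists>\<sigma>. env M \<Delta> \<sigma> \<and> sat \<phi> M (copair \<Delta> \<sigma> \<rho>))"

declare sat.simps(3) [simp del]

lemma value_of_eq [simp]: "value_of \<rho> (A, i) = \<rho> A i"
  by (simp add: value_of_def)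

lemma sat_Conj [simp]: "sat (Conj F) M \<rho> \<longleftrightarrow> (\<forall>\<phi>. \<phi> |\<in>| F \<longrightarrow> sat \<phi> M \<rho>)"
  by (auto simp: sat.simps(3))

lemma sat_And: "sat (And \<phi> \<psi>) M \<rho> \<longleftrightarrow> sat \<phi> M \<rho> \<and> sat \<psi> M \<rho>"
  by auto

lemma env_substitution: "env M \<Delta> \<rho> \<Longrightarrow> substitution \<Gamma> \<Delta> f \<Longrightarrow> env M \<Gamma> (\<rho> \<odot> f)"
  by (simp add: env_def substitution_iff)

lemma env_cong: "agree \<Gamma> \<rho> \<rho>' \<Longrightarrow> env M \<Gamma> \<rho> \<longleftrightarrow> env M \<Gamma> \<rho>'"
  by (simp add: env_def agree_def)

lemma env_add_iff: "env M (\<Delta> + \<Gamma>) \<tau> \<longleftrightarrow> env M \<Delta> \<tau> \<and> env M \<Gamma> (\<tau> \<odot> shift \<Delta>)"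
  by (auto simp: env_def shift_def vars_left vars_right elim!: vars_add_cases)

lemma agree_copair_left: "agree \<Delta> (copair \<Delta> \<sigma> \<rho>) \<sigma>"
  by (simp add: agree_def copair_left)

lemma agree_copair_right: "agree \<Gamma> (copair \<Delta> \<sigma> \<rho> \<odot> shift \<Delta>) \<rho>"
  by (simp add: agree_def copair_right shift_def)

lemma env_copair_iff [simp]: "env M (\<Delta> + \<Gamma>) (copair \<Delta> \<sigma> \<rho>) \<longleftrightarrow> env M \<Delta> \<sigma> \<and> env M \<Gamma> \<rho>"
  by (simp add: env_add_iff env_cong[OF agree_copair_left] env_cong[OF agree_copair_right])

lemma sat_cong: "formula \<Sigma> \<Gamma> \<phi> \<Longrightarrow> agree \<Gamma> \<rho> \<rho>' \<Longrightarrow> sat \<phi> M \<rho> \<longleftrightarrow> sat \<phi> M \<rho>'"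
proof (induction arbitrary: \<rho> \<rho>' rule: formula.induct)
  case (rel \<Gamma> R xs)
  then have "map (value_of \<rho>) xs = map (value_of \<rho>') xs"
    by (auto simp: agree_def value_of_def)
  then show ?case by (simp only: sat.simps)
next
  case (ex \<Gamma> \<Delta> \<phi>)
  have "agree (\<Delta> + \<Gamma>) (copair \<Delta> \<sigma> \<rho>) (copair \<Delta> \<sigma> \<rho>')" for \<sigma>
    using ex.prems by (auto simp: agree_def copair_left copair_right elim!: vars_add_cases)
  then have "sat \<phi> M (copair \<Delta> \<sigma> \<rho>) \<longleftrightarrow> sat \<phi> M (copair \<Delta> \<sigma> \<rho>')" for \<sigma>
    using ex.IH by blast
  then show ?case by simp
next
  case (conj \<Gamma> F)
  then show ?case by auto
next
  case (disj \<Gamma> I \<phi>)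
  then show ?case by (metis sat.simps(4))
qed (auto simp: agree_def)

text \<open>In the case of \<open>Exists\<close> it matters that substitutions map variables to variables: an index \<open>0\<close>
would be shifted into the block of quantified variables.\<close>

lemma sat_subst:
  "formula \<Sigma> \<Gamma> \<phi> \<Longrightarrow> substitution \<Gamma> \<Delta> f \<Longrightarrow> sat (subst \<phi> f) M \<rho> \<longleftrightarrow> sat \<phi> M (\<rho> \<odot> f)"
proof (induction arbitrary: \<Delta> f \<rho> rule: formula.induct)
  case (rel \<Gamma> R xs)
  have "map (value_of \<rho>) (map (subst_var f) xs) = map (value_of (\<rho> \<odot> f)) xs"
    by (auto simp: value_of_def subst_var_def)
  then show ?case by (simp only: sat.simps subst.simps)
next
  case (conj \<Gamma> F)
  then show ?case by auto
next
  case (disj \<Gamma> I \<phi>)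
  then show ?case by auto
next
  case (ex \<Gamma> \<Xi> \<phi>)
  let ?lift = "copair \<Xi> same (shift \<Xi> \<odot> f)"
  have "sat (subst \<phi> ?lift) M (copair \<Xi> \<sigma> \<rho>) \<longleftrightarrow> sat \<phi> M (copair \<Xi> \<sigma> (\<rho> \<odot> f))" for \<sigma>
  proof -
    have "sat (subst \<phi> ?lift) M (copair \<Xi> \<sigma> \<rho>) \<longleftrightarrow> sat \<phi> M (copair \<Xi> \<sigma> \<rho> \<odot> ?lift)"
      by (rule ex.IH[OF substitution_lift[OF ex.prems]])
    also have "\<dots> \<longleftrightarrow> sat \<phi> M (copair \<Xi> \<sigma> (\<rho> \<odot> f))"
      by (intro sat_cong[OF ex.hyps(3)])
        (auto simp: agree_def shift_def same_def copair_left copair_right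
            copair_right[OF substitutionD[OF ex.prems]] elim!: vars_add_cases)
    finally show ?thesis .
  qed
  then show ?case by simp
qed auto

lemma sat_shift:
  assumes "formula \<Sigma> \<Gamma> \<phi>"
  shows "sat (subst \<phi> (shift \<Delta>)) M (copair \<Delta> \<sigma> \<rho>) \<longleftrightarrow> sat \<phi> M \<rho>"
  using sat_subst[OF assms substitution_shift] sat_cong[OF assms agree_copair_right] by metis

definition entails :: "'s ctx \<Rightarrow> ('s, 'r, 'i) form \<Rightarrow> ('s, 'r, 'i) form \<Rightarrow> bool" where
  "entails \<Gamma> \<phi> \<psi> \<longleftrightarrow>
    (\<forall>(M :: ('s, 'r) model) \<rho>. env M \<Gamma> \<rho> \<longrightarrow> sat \<phi> M \<rho> \<longrightarrow> sat \<psi> M \<rho>)"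

lemma entailsD:
  "entails \<Gamma> \<phi> \<psi> \<Longrightarrow> env M \<Gamma> \<rho> \<Longrightarrow> sat \<phi> M \<rho> \<Longrightarrow> sat \<psi> M \<rho>"
  by (simp add: entails_def)

lemma substitution_replace:
  "(A, j) \<in> vars \<Gamma> \<Longrightarrow> substitution \<Gamma> \<Gamma> (\<lambda>B k. if B = A \<and> k = i then j else k)"
  by (simp add: substitution_iff)

lemma provable_formulas:
  "provable \<Sigma> T \<Gamma> \<phi> \<psi> \<Longrightarrow> formula \<Sigma> \<Gamma> \<phi> \<and> formula \<Sigma> \<Gamma> \<psi>"
proof (induction rule: provable.induct)
  case (substitute \<Gamma> \<phi> \<psi> \<Delta> f)
  then show ?case by (blast intro: formula_subst)
next
  case (equal_subst A i \<Gamma> j \<phi>)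
  then have "context_over \<Sigma> \<Gamma>" by (blast dest: formula_context)
  with equal_subst show ?case
    by (auto simp: formula_Conj_iff intro!: formula.equal
        formula_subst[OF _ substitution_replace])
next
  case (ex_right \<Delta> \<Gamma> \<phi> \<psi>)
  then have "context_over \<Sigma> (\<Delta> + \<Gamma>)" by (blast dest: formula_context)
  with ex_right show ?case by (blast intro: formula_subst[OF _ substitution_shift])
next
  case (frobenius \<Gamma> \<phi> \<Delta> \<psi>)
  then have "formula \<Sigma> (\<Delta> + \<Gamma>) \<psi>" by (simp add: formula_Exists_iff)
  moreover from this have "context_over \<Sigma> (\<Delta> + \<Gamma>)" by (rule formula_context)
  moreover from this frobenius have "formula \<Sigma> (\<Delta> + \<Gamma>) (subst \<phi> (shift \<Delta>))"
    by (blast intro: formula_subst[OF _ substitution_shift])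
  ultimately show ?case using frobenius by (simp add: formula_Conj_iff formula_Exists_iff)
next
  case (equal_refl \<Gamma> A i)
  then show ?case by (auto intro: formula.equal simp: formula_Conj_iff)
next
  case (conj_right \<Gamma> \<phi> F)
  then show ?case using formula_context[OF conj_right.hyps(1)] by (simp add: formula_Conj_iff)
next
  case (disj_left \<Gamma> \<psi> I \<phi>)
  then show ?case using formula_context[OF disj_left.hyps(1)] by (simp add: formula_Disj_iff)
next
  case (distributivity \<Gamma> \<phi> I \<psi>)
  then show ?case using formula_context[OF distributivity(1)]
    by (auto simp: formula_Disj_iff formula_Conj_iff)
next
  case (conj_left \<Gamma> F \<phi>)
  then show ?case by (blast elim: formula_ConjE)
next
  case (disj_right \<Gamma> I \<phi> i)
  then show ?case by (blast elim: formula_DisjE)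
next
  case (ex_left \<Delta> \<Gamma> \<psi> \<phi>)
  then show ?case by (blast intro: formula_Exists_iff[THEN iffD2])
qed blast+

lemma soundness:
  fixes \<phi> \<psi> :: "('s, 'r, 'i) form"
  assumes "provable \<Sigma> {} \<Gamma> \<phi> \<psi>"
  shows "entails \<Gamma> \<phi> \<psi>"
  unfolding entails_def
proof (intro allI impI)
  fix M :: "('s, 'r) model" and \<rho>
  assume "env M \<Gamma> \<rho>" "sat \<phi> M \<rho>"
  with assms show "sat \<psi> M \<rho>"
  proof (induction arbitrary: \<rho> rule: provable.induct)
    case (substitute \<Gamma> \<phi> \<psi> \<Delta> f)
    have *: "formula \<Sigma> \<Gamma> \<phi>" "formula \<Sigma> \<Gamma> \<psi>"
      using provable_formulas[OF substitute.hyps(1)] by auto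
    have "sat \<psi> M (\<rho> \<odot> f)"
      using substitute.prems substitute.hyps(3)
      by (intro substitute.IH) (auto simp: sat_subst[OF *(1)] intro: env_substitution)
    then show ?case by (simp add: sat_subst[OF *(2) substitute.hyps(3)])
  next
    case (equal_subst A i \<Gamma> j \<phi>)
    let ?f = "\<lambda>B k. if B = A \<and> k = i then j else k"
    have "agree \<Gamma> (\<rho> \<odot> ?f) \<rho>"
      using equal_subst.prems(2) by (auto simp: agree_def)
    then have "sat \<phi> M (\<rho> \<odot> ?f)"
      using equal_subst.prems(2) sat_cong[OF equal_subst.hyps(3)] by auto
    then show ?case
      by (simp only: sat_subst[OF equal_subst.hyps(3) substitution_replace[OF equal_subst.hyps(2)]])
  next
    case (ex_left \<Delta> \<Gamma> \<psi> \<phi>)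
    then obtain \<sigma> where "env M \<Delta> \<sigma>" "sat \<phi> M (copair \<Delta> \<sigma> \<rho>)" by auto
    then have "sat (subst \<psi> (shift \<Delta>)) M (copair \<Delta> \<sigma> \<rho>)"
      using ex_left.prems by (intro ex_left.IH) simp_all
    then show ?case by (simp only: sat_shift[OF ex_left.hyps(2)])
  next
    case (ex_right \<Delta> \<Gamma> \<phi> \<psi>)
    have "agree (\<Delta> + \<Gamma>) (copair \<Delta> \<rho> (\<rho> \<odot> shift \<Delta>)) \<rho>"
      by (simp add: agree_copair_iff)
    then have "sat \<phi> M (copair \<Delta> \<rho> (\<rho> \<odot> shift \<Delta>))"
      using ex_right.prems(2) sat_cong[OF ex_right.hyps(1)] by blast
    then have "sat \<psi> M (\<rho> \<odot> shift \<Delta>)"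
      using ex_right.prems(1) by (intro ex_right.IH) (auto simp: env_add_iff)
    then show ?case by (simp only: sat_subst[OF ex_right.hyps(2) substitution_shift])
  next
    case (frobenius \<Gamma> \<phi> \<Delta> \<psi>)
    then show ?case by (auto simp: sat_shift[OF frobenius.hyps(1)])
  qed auto
qed

section \<open>Derivations\<close>

lemma provable_context: "provable \<Sigma> T \<Gamma> \<phi> \<psi> \<Longrightarrow> context_over \<Sigma> \<Gamma>"
  using provable_formulas formula_context by blast

lemma provable_And:
  assumes "provable \<Sigma> T \<Gamma> \<chi> \<phi>" "provable \<Sigma> T \<Gamma> \<chi> \<psi>"
  shows "provable \<Sigma> T \<Gamma> \<chi> (And \<phi> \<psi>)"
  using assms provable_formulas[OF assms(1)] by (auto intro: provable.conj_right)

lemma provable_And_left: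
  assumes "formula \<Sigma> \<Gamma> \<phi>" "formula \<Sigma> \<Gamma> \<psi>"
  shows "provable \<Sigma> T \<Gamma> (And \<phi> \<psi>) \<phi>" "provable \<Sigma> T \<Gamma> (And \<phi> \<psi>) \<psi>"
  using assms by (auto intro!: provable.conj_left formula.conj dest: formula_context)

lemma provable_Equal_refl:
  assumes "formula \<Sigma> \<Gamma> \<chi>" "(A, i) \<in> vars \<Gamma>"
  shows "provable \<Sigma> T \<Gamma> \<chi> (Equal (A, i) (A, i))"
proof (rule provable.cut)
  show "provable \<Sigma> T \<Gamma> \<chi> (Conj {||})"
    using assms(1) by (auto intro: provable.conj_right)
  show "provable \<Sigma> T \<Gamma> (Conj {||}) (Equal (A, i) (A, i))"
    using assms by (auto intro: provable.equal_refl formula_context)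
qed

text \<open>The rule for equality replaces all occurrences of a variable.  To replace only some of them, these
are marked by a new variable of sort \<open>A\<close>; the rule is applied to the new variable, which is then
instantiated by \<open>i\<close>.\<close>

lemma provable_replace:
  assumes \<phi>: "regular \<Sigma> (\<Gamma> + {#A#}) \<phi>"
    and eq: "provable \<Sigma> T \<Gamma> \<chi> (Equal (A, i) (A, j))"
    and prem: "provable \<Sigma> T \<Gamma> \<chi> (subst \<phi> (copair \<Gamma> same (\<lambda>_ _. i)))"
  shows "provable \<Sigma> T \<Gamma> \<chi> (subst \<phi> (copair \<Gamma> same (\<lambda>_ _. j)))"
proof -
  \<comment> \<open>The index of the new variable, which comes after all those of sort \<open>A\<close> in \<open>\<Gamma>\<close>.\<close>
  define n where "n = count \<Gamma> A + 1"
  let ?r = "\<lambda>B k. if B = A \<and> k = n then j else k"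
  let ?c = "\<lambda>i. copair \<Gamma> same (\<lambda>_ _. i) "
  have ij: "(A, i) \<in> vars \<Gamma>" "(A, j) \<in> vars \<Gamma>"
    using provable_formulas[OF eq] by (auto simp: formula_Equal_iff)
  have single: "(B, k) \<in> vars {#A#} \<longleftrightarrow> B = A \<and> k = 1" for B k
    by (auto simp: vars_iff)
  have n: "(A, n) \<in> vars (\<Gamma> + {#A#})"
    by (simp add: n_def vars_iff)
  have j: "(A, j) \<in> vars (\<Gamma> + {#A#})"
    by (rule vars_left[OF ij(2)])
  have c: "substitution (\<Gamma> + {#A#}) \<Gamma> (?c i)"
    using ij by (intro substitution_copair) (auto simp: substitution_iff single same_def)
  have "provable \<Sigma> T (\<Gamma> + {#A#}) (And (Equal (A, n) (A, j)) \<phi>) (subst \<phi> ?r)"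
    by (rule provable.equal_subst[OF n j regular_formula[OF \<phi>]])
  then have "provable \<Sigma> T \<Gamma> (subst (And (Equal (A, n) (A, j)) \<phi>) (?c i))
      (subst (subst \<phi> ?r) (?c i))"
    using c provable_context[OF eq] by (blast intro: provable.substitute)
  moreover have "subst (subst \<phi> ?r) (?c i) = subst \<phi> (?c j)"
  proof -
    have "agree (\<Gamma> + {#A#}) (?c i \<odot> ?r) (?c j)"
      using ij(2)
      by (auto simp: agree_def copair_def same_def n_def vars_iff single elim!: vars_add_cases)
    then show ?thesis
      by (rule trans[OF subst_subst[OF \<phi> substitution_replace[OF j]] subst_cong[OF \<phi>]])
  qed
  moreover have "?c i A n = i" "?c i A j = j"
    using ij(2) by (auto simp: n_def copair_def same_def vars_iff)
  ultimately have "provable \<Sigma> T \<Gamma> (And (Equal (A, i) (A, j)) (subst \<phi> (?c i))) (subst \<phi> (?c j))"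
    by simp
  then show ?thesis by (rule provable.cut[OF provable_And[OF eq prem]])
qed

lemma copair_fresh [simp]: "copair \<Gamma> f g A (Suc (count \<Gamma> A)) = g A 1"
  by (simp add: copair_def)

lemma fresh_var: "(A, Suc (count \<Gamma> A)) \<in> vars (\<Gamma> + {#A#})"
  by (simp add: vars_iff)

lemma provable_Equal_sym:
  assumes "provable \<Sigma> T \<Gamma> \<chi> (Equal (A, i) (A, j))"
  shows "provable \<Sigma> T \<Gamma> \<chi> (Equal (A, j) (A, i))"
proof -
  have ij: "formula \<Sigma> \<Gamma> \<chi>" "(A, i) \<in> vars \<Gamma>" "context_over \<Sigma> (\<Gamma> + {#A#})"
    using provable_formulas[OF assms] provable_context[OF assms]
    by (auto simp: formula_Equal_iff context_over_def dest: vars_sort)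
  have "regular \<Sigma> (\<Gamma> + {#A#}) (Equal (A, Suc (count \<Gamma> A)) (A, i))"
    using ij by (intro regular.equal fresh_var vars_left)
  from provable_replace[OF this assms] show ?thesis
    using ij provable_Equal_refl[OF ij(1,2)] by (simp add: copair_left same_def)
qed

lemma provable_Equal_trans:
  assumes "provable \<Sigma> T \<Gamma> \<chi> (Equal (A, i) (A, j))" "provable \<Sigma> T \<Gamma> \<chi> (Equal (A, j) (A, k))"
  shows "provable \<Sigma> T \<Gamma> \<chi> (Equal (A, i) (A, k))"
proof -
  have ij: "(A, i) \<in> vars \<Gamma>" "context_over \<Sigma> (\<Gamma> + {#A#})"
    using provable_formulas[OF assms(1)] provable_context[OF assms(1)]
    by (auto simp: formula_Equal_iff context_over_def dest: vars_sort)
  have "regular \<Sigma> (\<Gamma> + {#A#}) (Equal (A, i) (A, Suc (count \<Gamma> A)))"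
    using ij by (intro regular.equal fresh_var vars_left)
  from provable_replace[OF this assms(2)] show ?thesis
    using ij assms(1) by (simp add: copair_left same_def)
qed

text \<open>The arguments are replaced one at a time; \<open>ws\<close> collects those that have been dealt with.\<close>

lemma provable_Rel_cong:
  assumes "list_all2 (\<lambda>x y. fst x = fst y \<and> provable \<Sigma> T \<Gamma> \<chi> (Equal x y)) xs ys"
    and "provable \<Sigma> T \<Gamma> \<chi> (Rel R (ws @ xs))"
  shows "provable \<Sigma> T \<Gamma> \<chi> (Rel R (ws @ ys))"
  using assms
proof (induction arbitrary: ws rule: list_all2_induct)
  case (Cons x xs y ys)
  obtain A i j where xy: "x = (A, i)" "y = (A, j)"
    using Cons.hyps(1) by (metis prod.collapse)
  let ?z = "(A, Suc (count \<Gamma> A))"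
  have f: "R \<in> rels \<Sigma>" "set (ws @ x # xs) \<subseteq> vars \<Gamma>" "map fst (ws @ x # xs) = arity \<Sigma> R"
    "context_over \<Sigma> \<Gamma>"
    using provable_formulas[OF Cons.prems] by (auto simp: formula_Rel_iff)
  then have "A \<in> sorts \<Sigma>"
    by (auto simp: xy context_over_def dest: vars_sort)
  then have "regular \<Sigma> (\<Gamma> + {#A#}) (Rel R (ws @ ?z # xs))"
    using f vars_left[of _ _ \<Gamma> "{#A#}"] fresh_var[of A \<Gamma>]
    by (intro regular.rel) (auto simp: xy context_over_def simp del: add_mset_add_single)
  moreover have "map (subst_var (copair \<Gamma> same g)) zs = zs" if "set zs \<subseteq> vars \<Gamma>" for zs g
    using that by (intro map_idI) (auto simp: subst_var_def same_def intro!: copair_left[THEN trans])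
  ultimately have "provable \<Sigma> T \<Gamma> \<chi> (Rel R (ws @ y # xs))"
    using provable_replace[of \<Sigma> \<Gamma> A "Rel R (ws @ ?z # xs)" T \<chi> i j] f(2) Cons.hyps(1) Cons.prems
    by (simp add: xy)
  then show ?case using Cons.IH[of "ws @ [y]"] by simp
qed simp

lemma exists_unit:
  assumes "formula \<Sigma> (\<Delta> + \<Gamma>) \<phi>"
  shows "provable \<Sigma> T (\<Delta> + \<Gamma>) \<phi> (subst (Exists \<Delta> \<phi>) (shift \<Delta>))"
proof -
  have "formula \<Sigma> \<Gamma> (Exists \<Delta> \<phi>)" using assms by (simp add: formula_Exists_iff)
  then show ?thesis by (intro provable.ex_right[OF assms] provable.identity)
qed

lemma exists_intro:
  assumes \<psi>: "regular \<Sigma> (\<Delta> + \<Gamma>) \<psi>" and v: "substitution \<Delta> \<Gamma> v"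
    and "provable \<Sigma> T \<Gamma> \<chi> (subst \<psi> (copair \<Delta> v same))"
  shows "provable \<Sigma> T \<Gamma> \<chi> (Exists \<Delta> \<psi>)"
proof -
  let ?f = "copair \<Delta> v same"
  have ex: "regular \<Sigma> \<Gamma> (Exists \<Delta> \<psi>)" using \<psi> by (simp add: regular_Exists_iff)
  have "provable \<Sigma> T \<Gamma> (subst \<psi> ?f) (subst (subst (Exists \<Delta> \<psi>) (shift \<Delta>)) ?f)"
    by (rule provable.substitute[OF exists_unit[OF regular_formula[OF \<psi>]] regular_context[OF ex]
          substitution_copair[OF v substitution_same]])
  also have "subst (subst (Exists \<Delta> \<psi>) (shift \<Delta>)) ?f = Exists \<Delta> \<psi>"
    by (rule subst_shift_copair[OF ex agree_refl])
  finally show ?thesis by (rule provable.cut[OF assms(3)])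
qed

lemma exists_elim:
  assumes "provable \<Sigma> T \<Gamma> \<chi> (Exists \<Delta> \<theta>)"
    and "provable \<Sigma> T (\<Delta> + \<Gamma>) (And (subst \<chi> (shift \<Delta>)) \<theta>) (subst \<psi> (shift \<Delta>))"
    and \<psi>: "formula \<Sigma> \<Gamma> \<psi>"
  shows "provable \<Sigma> T \<Gamma> \<chi> \<psi>"
proof -
  have f: "formula \<Sigma> \<Gamma> \<chi>" "formula \<Sigma> \<Gamma> (Exists \<Delta> \<theta>)"
    using provable_formulas[OF assms(1)] by auto
  have \<Delta>: "context_over \<Sigma> \<Delta>"
    using f(2) by (blast elim: formula_ExistsE)
  have "provable \<Sigma> T \<Gamma> \<chi> (And \<chi> (Exists \<Delta> \<theta>))"
    by (rule provable_And[OF provable.identity[OF f(1)] assms(1)])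
  also have "provable \<Sigma> T \<Gamma> (And \<chi> (Exists \<Delta> \<theta>)) (Exists \<Delta> (And (subst \<chi> (shift \<Delta>)) \<theta>))"
    by (rule provable.frobenius[OF f])
  finally (provable.cut) show ?thesis
    by (rule provable.cut[OF _ provable.ex_left[OF \<Delta> \<psi> assms(2)]])
qed

section \<open>The canonical model of a Horn formula\<close>

definition model_of :: "('s, 'r) comb_data \<Rightarrow> ('s, 'r) model" where
  "model_of D = \<lparr>elements = (\<lambda>A. {i. (A, i) \<in> vars (comb_context D)}), holds = relset D\<rparr>"

lemma model_of_simps [simp]:
  "i \<in> elements (model_of D) A \<longleftrightarrow> (A, i) \<in> vars (comb_context D)"
  "holds (model_of D) = relset D"
  by (simp_all add: model_of_def)

lemma count_comb_context:
  assumes "finite (support D)"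
  shows "count (comb_context D) A = (if A \<in> support D then mult D A else 0)"
  using assms by (auto simp: comb_context_def count_sum count_replicate_mset)

lemma vars_comb_context:
  "D \<in> comb_data_over \<Sigma> \<Longrightarrow>
    (A, i) \<in> vars (comb_context D) \<longleftrightarrow> A \<in> support D \<and> i \<in> {1..mult D A}"
  by (auto simp: vars_iff count_comb_context comb_data_over_def)

lemma context_over_comb_context: "D \<in> comb_data_over \<Sigma> \<Longrightarrow> context_over \<Sigma> (comb_context D)"
  by (auto simp: context_over_def comb_context_def comb_data_over_def split: if_splits
      simp flip: count_greater_zero_iff simp: count_sum)

text \<open>The elements of a finite quotient are numbered from \<open>1\<close>, as combinatorial data require.\<close>

lemma enumerate_kernel:
  fixes c :: "nat \<Rightarrow> 'a"
  shows "\<exists>m q. q ` {1..n} = {1..m::nat} \<and> (\<forall>i\<in>{1..n}. \<forall>j\<in>{1..n}. q i = q j \<longleftrightarrow> c i = c j)"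
proof -
  obtain h where h: "bij_betw h {1..card (c ` {1..n})} (c ` {1..n})"
    using ex_bij_betw_nat_finite_1[of "c ` {1..n}"] by auto
  let ?b = "inv_into {1..card (c ` {1..n})} h"
  have b: "bij_betw ?b (c ` {1..n}) {1..card (c ` {1..n})}"
    by (rule bij_betw_inv_into[OF h])
  have "(?b \<circ> c) ` {1..n} = {1..card (c ` {1..n})}"
    using bij_betw_imp_surj_on[OF b] by (simp add: image_comp)
  moreover have "(?b \<circ> c) i = (?b \<circ> c) j \<longleftrightarrow> c i = c j" if "i \<in> {1..n}" "j \<in> {1..n}" for i j
    using bij_betw_imp_inj_on[OF b] that by (auto simp: inj_on_def)
  ultimately show ?thesis by blast
qed

text \<open>The elements of \<open>D\<close> are named by the variables of \<open>\<Gamma>\<close>.\<close>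

definition cover :: "'s ctx \<Rightarrow> ('s, 'r) comb_data \<Rightarrow> 's subst \<Rightarrow> bool" where
  "cover \<Gamma> D q \<longleftrightarrow> substitution \<Gamma> (comb_context D) q \<and>
    (\<forall>A j. (A, j) \<in> vars (comb_context D) \<longrightarrow> (\<exists>i. (A, i) \<in> vars \<Gamma> \<and> q A i = j))"

lemma cover_section:
  assumes "cover \<Gamma> D q"
  obtains s where "substitution (comb_context D) \<Gamma> s"
    "\<And>A j. (A, j) \<in> vars (comb_context D) \<Longrightarrow> q A (s A j) = j"
proof -
  let ?s = "\<lambda>A j. SOME i. (A, i) \<in> vars \<Gamma> \<and> q A i = j"
  have "(A, ?s A j) \<in> vars \<Gamma> \<and> q A (?s A j) = j" if "(A, j) \<in> vars (comb_context D)" for A j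
  proof -
    have "\<exists>i. (A, i) \<in> vars \<Gamma> \<and> q A i = j"
      using assms that unfolding cover_def by blast
    then show ?thesis by (rule someI_ex)
  qed
  then show thesis by (intro that[of ?s]) (auto simp: substitution_iff)
qed

text \<open>\<open>D\<close> is the structure presented by \<open>\<phi>\<close>, and \<open>q\<close> sends each variable to the element that it names:
\<open>q\<close> solves \<open>\<phi>\<close> in \<open>D\<close>, and nothing more is equated or related in \<open>D\<close> than \<open>\<phi>\<close> proves.\<close>

definition canonical ::
  "('s, 'r) signature \<Rightarrow> ('s, 'r, 'i) thy \<Rightarrow> 's ctx \<Rightarrow> ('s, 'r, 'i) form
    \<Rightarrow> ('s, 'r) comb_data \<Rightarrow> 's subst \<Rightarrow> bool" where
  "canonical \<Sigma> T \<Gamma> \<phi> D q \<longleftrightarrow> D \<in> comb_data_over \<Sigma> \<and> cover \<Gamma> D q \<and> sat \<phi> (model_of D) q \<and>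
    (\<forall>A i j. (A, i) \<in> vars \<Gamma> \<longrightarrow> (A, j) \<in> vars \<Gamma> \<longrightarrow> q A i = q A j
      \<longrightarrow> provable \<Sigma> T \<Gamma> \<phi> (Equal (A, i) (A, j))) \<and>
    (\<forall>R \<alpha>. (R, \<alpha>) \<in> relset D
      \<longrightarrow> (\<exists>xs. \<alpha> = map (value_of q) xs \<and> provable \<Sigma> T \<Gamma> \<phi> (Rel R xs)))"

text \<open>The elements are the classes of provably equal variables.  As relations it suffices to take the atoms
that occur in \<open>\<phi>\<close>, which makes their finiteness evident; the other provable ones follow by
congruence (\<open>provable_Rel_cong\<close>).\<close>

lemma canonical_exists:
  fixes \<phi> :: "('s, 'r, 'i) form"
  assumes "horn \<Sigma> \<Gamma> \<phi>"
  shows "\<exists>D q. canonical \<Sigma> T \<Gamma> \<phi> D q"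
proof -
  obtain F where F: "\<phi> = Conj F" "\<And>\<psi>. \<psi> |\<in>| F \<Longrightarrow> atomic \<psi>" and \<phi>: "formula \<Sigma> \<Gamma> \<phi>"
    using assms unfolding horn_def by auto
  have atom: "provable \<Sigma> T \<Gamma> \<phi> \<psi>" if "\<psi> |\<in>| F" for \<psi>
    using \<phi> that F by (auto intro: provable.conj_left)
  let ?c = "\<lambda>A i. {j. provable \<Sigma> T \<Gamma> \<phi> (Equal (A, i) (A, j))}"
  have "\<forall>A. \<exists>m q. q ` {1..count \<Gamma> A} = {1..m::nat} \<and>
      (\<forall>i\<in>{1..count \<Gamma> A}. \<forall>j\<in>{1..count \<Gamma> A}. q i = q j \<longleftrightarrow> ?c A i = ?c A j)"
    using enumerate_kernel[of _ "?c _"] by (intro allI)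
  then obtain m q where mq: "\<forall>A. q A ` {1..count \<Gamma> A} = {1..m A::nat} \<and>
      (\<forall>i\<in>{1..count \<Gamma> A}. \<forall>j\<in>{1..count \<Gamma> A}. q A i = q A j \<longleftrightarrow> ?c A i = ?c A j)"
    unfolding choice_iff by blast
  then have q: "q A ` {1..count \<Gamma> A} = {1..m A}" for A by blast
  have ker: "q A i = q A j \<longleftrightarrow> ?c A i = ?c A j"
    if "(A, i) \<in> vars \<Gamma>" "(A, j) \<in> vars \<Gamma>" for A i j
    using mq that by (simp add: vars_iff)
  have eq: "q A i = q A j \<longleftrightarrow> provable \<Sigma> T \<Gamma> \<phi> (Equal (A, i) (A, j))"
    if "(A, i) \<in> vars \<Gamma>" "(A, j) \<in> vars \<Gamma>" for A i j
    unfolding ker[OF that]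
    using provable_Equal_refl[OF \<phi> that(2)] by (auto intro: provable_Equal_sym provable_Equal_trans)
  let ?rels = "(\<lambda>(R, xs). (R, map (value_of q) xs)) ` ((\<lambda>(R, xs). Rel R xs) -` fset F)"
  define D where
    "D = \<lparr>support = set_mset \<Gamma>, mult = restrict m (set_mset \<Gamma>), relset = ?rels\<rparr>"
  have q_in: "q A i \<in> {1..m A}" if "(A, i) \<in> vars \<Gamma>" for A i
    using that q[of A] by (auto simp: vars_iff)
  have fin: "finite ?rels"
    by (intro finite_imageI finite_vimageI) (auto simp: inj_on_def)
  have rel: "R \<in> rels \<Sigma> \<and> set xs \<subseteq> vars \<Gamma> \<and> map fst xs = arity \<Sigma> R \<and> context_over \<Sigma> \<Gamma>"
    if "Rel R xs |\<in>| F" for R xs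
    using provable_formulas[OF atom[OF that]] by (auto simp: formula_Rel_iff)
  have m1: "m A \<ge> 1" if "A \<in> set_mset \<Gamma>" for A
  proof -
    have "(A, 1) \<in> vars \<Gamma>" using that by (simp add: vars_iff Suc_le_eq)
    then show ?thesis using q_in[of A 1] by auto
  qed
  have D: "D \<in> comb_data_over \<Sigma>"
  proof -
    define bounded where "bounded R \<alpha> \<longleftrightarrow>
        R \<in> rels \<Sigma> \<and> set (arity \<Sigma> R) \<subseteq> set_mset \<Gamma> \<and> length \<alpha> = length (arity \<Sigma> R) \<and>
        (\<forall>k < length \<alpha>. 1 \<le> \<alpha> ! k \<and> \<alpha> ! k \<le> restrict m (set_mset \<Gamma>) (arity \<Sigma> R ! k))" for R \<alpha>
    have "bounded R (map (value_of q) xs)" if "Rel R xs |\<in>| F" for R xs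
      unfolding bounded_def
    proof (intro conjI allI impI)
      have xs: "set xs \<subseteq> vars \<Gamma>" "map fst xs = arity \<Sigma> R" "R \<in> rels \<Sigma>"
        using rel[OF that] by auto
      show "R \<in> rels \<Sigma>" by fact
      show "length (map (value_of q) xs) = length (arity \<Sigma> R)" using xs(2) by (metis length_map)
      have "set (arity \<Sigma> R) = fst ` set xs" using xs(2) by (metis list.set_map)
      then show "set (arity \<Sigma> R) \<subseteq> set_mset \<Gamma>"
        using xs(1) by (auto dest!: subsetD[of _ "vars \<Gamma>"] vars_sort)
      fix k assume "k < length (map (value_of q) xs)"
      then have k: "k < length xs" by simp
      obtain A i where Ai: "xs ! k = (A, i)" by (cases "xs ! k")
      have "(A, i) \<in> vars \<Gamma>" using xs(1) k Ai by (metis nth_mem subsetD)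
      moreover have "arity \<Sigma> R ! k = A" using xs(2) k Ai by (metis fst_conv nth_map)
      ultimately show "1 \<le> map (value_of q) xs ! k"
        "map (value_of q) xs ! k \<le> restrict m (set_mset \<Gamma>) (arity \<Sigma> R ! k)"
        using q_in[of A i] vars_sort[of A i \<Gamma>] Ai k by simp_all
    qed
    then have "\<forall>(R, \<alpha>)\<in>?rels. bounded R \<alpha>" by auto
    moreover have "set_mset \<Gamma> \<subseteq> sorts \<Sigma>"
      using formula_context[OF \<phi>] by (simp add: context_over_def)
    ultimately show ?thesis using fin m1
      by (simp add: comb_data_over_def D_def bounded_def)
  qed
  have vars_D: "(A, j) \<in> vars (comb_context D) \<longleftrightarrow> A \<in> set_mset \<Gamma> \<and> j \<in> {1..m A}" for A j
    unfolding vars_comb_context[OF D] by (simp add: D_def)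
  have "cover \<Gamma> D q"
    unfolding cover_def
  proof (intro conjI allI impI)
    show "substitution \<Gamma> (comb_context D) q"
      using q_in vars_sort by (auto simp: substitution_iff vars_D)
  next
    fix A j assume "(A, j) \<in> vars (comb_context D)"
    then have "j \<in> q A ` {1..count \<Gamma> A}" unfolding vars_D q by blast
    then show "\<exists>i. (A, i) \<in> vars \<Gamma> \<and> q A i = j" by (auto simp: vars_iff)
  qed
  moreover have "sat \<phi> (model_of D) q"
  proof -
    have "sat \<psi> (model_of D) q" if \<psi>: "\<psi> |\<in>| F" for \<psi>
      using F(2)[OF \<psi>] unfolding atomic_def
    proof (elim disjE exE)
      fix x y assume xy: "\<psi> = Equal x y"
      have "formula \<Sigma> \<Gamma> \<psi>" using provable_formulas[OF atom[OF \<psi>]] by simp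
      then show ?thesis using atom[OF \<psi>]
        by (cases x, cases y) (auto simp: xy eq formula_Equal_iff)
    next
      fix R xs assume "\<psi> = Rel R xs"
      then show ?thesis using \<psi> by (force simp: D_def)
    qed
    then show ?thesis by (simp add: F(1))
  qed
  moreover have "\<exists>xs. \<alpha> = map (value_of q) xs \<and> provable \<Sigma> T \<Gamma> \<phi> (Rel R xs)"
    if "(R, \<alpha>) \<in> relset D" for R \<alpha>
    using that atom by (auto simp: D_def)
  ultimately have "canonical \<Sigma> T \<Gamma> \<phi> D q"
    using D eq by (simp add: canonical_def)
  then show ?thesis by blast
qed

text \<open>The heart of completeness.  An existential formula that holds in \<open>D\<close> has a witness there, and
since \<open>q\<close> is onto, the witness is named by variables; substituting these variables proves the
formula.\<close>

lemma canonical_truth: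
  assumes can: "canonical \<Sigma> T \<Gamma> \<phi> D q" and \<phi>: "formula \<Sigma> \<Gamma> \<phi>"
  shows "regular \<Sigma> \<Xi> \<psi> \<Longrightarrow> substitution \<Xi> \<Gamma> u \<Longrightarrow> sat \<psi> (model_of D) (q \<odot> u)
    \<Longrightarrow> provable \<Sigma> T \<Gamma> \<phi> (subst \<psi> u)"
proof (induction arbitrary: u rule: regular.induct)
  case (equal \<Xi> A i j)
  then show ?case using can by (simp add: canonical_def substitution_iff)
next
  case (rel \<Xi> R xs)
  then have "(R, map (value_of (q \<odot> u)) xs) \<in> relset D" by simp
  then obtain ys where ys: "map (value_of (q \<odot> u)) xs = map (value_of q) ys"
    and prov: "provable \<Sigma> T \<Gamma> \<phi> (Rel R ys)"
    using can unfolding canonical_def by blast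
  have sorts: "map fst ys = map fst xs" and ys_vars: "set ys \<subseteq> vars \<Gamma>"
    using provable_formulas[OF prov] rel.hyps(4) by (auto simp: formula_Rel_iff)
  have len: "length ys = length xs" using ys by (metis length_map)
  have "list_all2 (\<lambda>x y. fst x = fst y \<and> provable \<Sigma> T \<Gamma> \<phi> (Equal x y)) ys (map (subst_var u) xs)"
  proof (rule list_all2_all_nthI)
    show "length ys = length (map (subst_var u) xs)" using len by simp
    fix k assume k: "k < length ys"
    obtain A i where x: "xs ! k = (A, i)" by (cases "xs ! k")
    obtain B j where y: "ys ! k = (B, j)" by (cases "ys ! k")
    have "B = A" using sorts k len x y by (metis fst_conv nth_map)
    moreover have "q A (u A i) = q B j"
      using arg_cong[OF ys, of "\<lambda>zs. zs ! k"] k len x y by simp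
    moreover have "(A, u A i) \<in> vars \<Gamma>"
      using rel.hyps(3) rel.prems(1) k len x by (metis nth_mem subsetD substitution_iff)
    moreover have "(B, j) \<in> vars \<Gamma>" using ys_vars k y by (metis nth_mem subsetD)
    ultimately show "fst (ys ! k) = fst (map (subst_var u) xs ! k) \<and>
        provable \<Sigma> T \<Gamma> \<phi> (Equal (ys ! k) (map (subst_var u) xs ! k))"
      using can k len x y unfolding canonical_def by simp
  qed
  then show ?case using provable_Rel_cong[of \<Sigma> T \<Gamma> \<phi> ys _ R "[]"] prov by simp
next
  case (conj \<Xi> F)
  then show ?case by (auto intro!: provable.conj_right[OF \<phi>])
next
  case (ex \<Xi> \<Delta> \<psi>)
  let ?lift = "copair \<Delta> same (shift \<Delta> \<odot> u)"
  obtain \<sigma> where \<sigma>: "env (model_of D) \<Delta> \<sigma>" "sat \<psi> (model_of D) (copair \<Delta> \<sigma> (q \<odot> u))"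
    using ex.prems by auto
  have cov: "cover \<Gamma> D q" using can by (simp add: canonical_def)
  obtain s where s: "substitution (comb_context D) \<Gamma> s"
    "\<And>A j. (A, j) \<in> vars (comb_context D) \<Longrightarrow> q A (s A j) = j"
    by (rule cover_section[OF cov]) blast
  define v where "v = s \<odot> \<sigma>"
  have v: "substitution \<Delta> \<Gamma> v" "agree \<Delta> \<sigma> (q \<odot> v)"
    using s \<sigma>(1) by (auto simp: v_def substitution_iff env_def agree_def)
  have vu: "substitution (\<Delta> + \<Xi>) \<Gamma> (copair \<Delta> v u)"
    by (rule substitution_copair[OF v(1) ex.prems(1)])
  have "agree (\<Delta> + \<Xi>) (copair \<Delta> \<sigma> (q \<odot> u)) (q \<odot> copair \<Delta> v u)"
    using v(2) by (auto simp: agree_copair_iff) (auto simp: agree_def copair_left copair_right shift_def)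
  then have "sat \<psi> (model_of D) (q \<odot> copair \<Delta> v u)"
    using \<sigma>(2) sat_cong[OF regular_formula[OF ex.hyps(3)]] by blast
  then have "provable \<Sigma> T \<Gamma> \<phi> (subst \<psi> (copair \<Delta> v u))" by (rule ex.IH[OF vu])
  also have "subst \<psi> (copair \<Delta> v u) = subst (subst \<psi> ?lift) (copair \<Delta> v same)"
  proof -
    have "agree (\<Delta> + \<Xi>) (copair \<Delta> v u) (copair \<Delta> v same \<odot> ?lift)"
      by (auto simp: agree_def shift_def same_def copair_left copair_right
          copair_right[OF substitutionD[OF ex.prems(1)]] elim!: vars_add_cases)
    then have "subst \<psi> (copair \<Delta> v u) = subst \<psi> (copair \<Delta> v same \<odot> ?lift)"
      by (rule subst_cong[OF ex.hyps(3)])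
    also have "\<dots> = subst (subst \<psi> ?lift) (copair \<Delta> v same)"
      by (rule subst_subst[OF ex.hyps(3) substitution_lift[OF ex.prems(1)], symmetric])
    finally show ?thesis .
  qed
  finally have "provable \<Sigma> T \<Gamma> \<phi> (Exists \<Delta> (subst \<psi> ?lift))"
    using formula_context[OF \<phi>] ex.hyps(2)
    by (intro exists_intro[OF _ v(1)] regular_subst[OF ex.hyps(3)] substitution_lift[OF ex.prems(1)])
      simp_all
  then show ?case by simp
qed

section \<open>Completeness for regular formulas\<close>

lemma horn_regular:
  assumes "horn \<Sigma> \<Gamma> \<phi>"
  shows "regular \<Sigma> \<Gamma> \<phi>"
proof -
  obtain F where F: "\<phi> = Conj F" "\<And>\<psi>. \<psi> |\<in>| F \<Longrightarrow> atomic \<psi> \<and> formula \<Sigma> \<Gamma> \<psi>" "context_over \<Sigma> \<Gamma>"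
    using assms unfolding horn_def by (auto simp: formula_Conj_iff)
  have "regular \<Sigma> \<Gamma> \<psi>" if "\<psi> |\<in>| F" for \<psi>
    using F(2)[OF that] unfolding atomic_def
    by (auto simp: formula_Equal_iff formula_Rel_iff intro: regular.intros)
  then show ?thesis using F by (auto intro: regular.conj)
qed

lemma atomic_subst: "atomic \<phi> \<Longrightarrow> atomic (subst \<phi> f)"
  by (auto simp: atomic_def)

lemma horn_subst:
  assumes "horn \<Sigma> \<Gamma> \<phi>" "substitution \<Gamma> \<Delta> f" "context_over \<Sigma> \<Delta>"
  shows "horn \<Sigma> \<Delta> (subst \<phi> f)"
  using assms unfolding horn_def by (auto intro!: atomic_subst intro: formula_subst)

lemma horn_Conj: "horn \<Sigma> \<Gamma> \<phi> \<Longrightarrow> \<exists>F. \<phi> = Conj F"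
  by (auto simp: horn_def)

lemma horn_union:
  assumes "horn \<Sigma> \<Gamma> (Conj F)" "horn \<Sigma> \<Gamma> (Conj G)"
  shows "horn \<Sigma> \<Gamma> (Conj (F |\<union>| G))"
  using assms unfolding horn_def by (auto simp: formula_Conj_iff)

text \<open>\<open>\<psi>\<close> is tested at the generic solution \<open>q\<close> of \<open>H\<close> in the structure that \<open>H\<close> presents.\<close>

lemma completeness_horn:
  fixes \<psi> :: "('s, 'r, 'i) form"
  assumes H: "horn \<Sigma> (\<Delta> + \<Gamma>) H" and \<psi>: "regular \<Sigma> \<Gamma> \<psi>" and "entails \<Gamma> (Exists \<Delta> H) \<psi>"
  shows "provable \<Sigma> T \<Gamma> (Exists \<Delta> H) \<psi>"
proof -
  have f: "formula \<Sigma> (\<Delta> + \<Gamma>) H" using H by (simp add: horn_def)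
  obtain D q where can: "canonical \<Sigma> T (\<Delta> + \<Gamma>) H D q"
    using canonical_exists[OF H] by blast
  have q: "env (model_of D) (\<Delta> + \<Gamma>) q"
    using can by (simp add: canonical_def cover_def substitution_iff env_def)
  have "agree (\<Delta> + \<Gamma>) (copair \<Delta> q (q \<odot> shift \<Delta>)) q" by (simp add: agree_copair_iff)
  then have "sat H (model_of D) (copair \<Delta> q (q \<odot> shift \<Delta>))"
    using can sat_cong[OF f] unfolding canonical_def by blast
  then have "sat \<psi> (model_of D) (q \<odot> shift \<Delta>)"
    using assms(3) q unfolding entails_def by (auto simp: env_add_iff)
  then have "provable \<Sigma> T (\<Delta> + \<Gamma>) H (subst \<psi> (shift \<Delta>))"
    by (rule canonical_truth[OF can f \<psi> substitution_shift])
  then show ?thesis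
    using formula_context[OF f] by (intro provable.ex_left regular_formula[OF \<psi>]) simp_all
qed

text \<open>Only one implication between \<open>\<phi>\<close> and its prenex form is asked to be provable.  The other one need
only hold semantically, since \<open>completeness_horn\<close> applies to the prenex form.\<close>

definition has_normal_form ::
  "('s, 'r) signature \<Rightarrow> ('s, 'r, 'i) thy \<Rightarrow> 's ctx \<Rightarrow> ('s, 'r, 'i) form \<Rightarrow> bool" where
  "has_normal_form \<Sigma> T \<Gamma> \<phi> \<longleftrightarrow> (\<exists>\<Delta> H. horn \<Sigma> (\<Delta> + \<Gamma>) H \<and>
     provable \<Sigma> T \<Gamma> \<phi> (Exists \<Delta> H) \<and> entails \<Gamma> (Exists \<Delta> H) \<phi>)"

text \<open>The quantified blocks of the two normal forms are concatenated, which requires moving the first Horn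
formula past the block \<open>\<Delta>2\<close> and the free variables of the second one past the block \<open>\<Delta>1\<close>.\<close>

lemma normal_form_conj:
  fixes \<chi> :: "('s, 'r, 'i) form"
  assumes "has_normal_form \<Sigma> T \<Gamma> \<phi>" "has_normal_form \<Sigma> T \<Gamma> \<psi>"
    and \<chi>: "provable \<Sigma> T \<Gamma> \<chi> \<phi>" "provable \<Sigma> T \<Gamma> \<chi> \<psi>" "entails \<Gamma> (And \<phi> \<psi>) \<chi>"
  shows "has_normal_form \<Sigma> T \<Gamma> \<chi>"
proof -
  obtain \<Delta>1 H1 where 1: "horn \<Sigma> (\<Delta>1 + \<Gamma>) H1" "provable \<Sigma> T \<Gamma> \<phi> (Exists \<Delta>1 H1)"
    "entails \<Gamma> (Exists \<Delta>1 H1) \<phi>"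
    using assms(1) unfolding has_normal_form_def by blast
  obtain \<Delta>2 H2 where 2: "horn \<Sigma> (\<Delta>2 + \<Gamma>) H2" "provable \<Sigma> T \<Gamma> \<psi> (Exists \<Delta>2 H2)"
    "entails \<Gamma> (Exists \<Delta>2 H2) \<psi>"
    using assms(2) unfolding has_normal_form_def by blast
  let ?\<Theta> = "\<Delta>2 + \<Delta>1"
  let ?lift = "copair \<Delta>2 same (shift \<Delta>2 \<odot> shift \<Delta>1)"
  have ctx: "context_over \<Sigma> (?\<Theta> + \<Gamma>)"
    using horn_regular[OF 1(1)] horn_regular[OF 2(1)] by (auto dest: regular_context)
  have s1: "substitution (\<Delta>1 + \<Gamma>) (?\<Theta> + \<Gamma>) (shift \<Delta>2)"
    using substitution_shift[of "\<Delta>1 + \<Gamma>" \<Delta>2] by (simp add: ac_simps)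
  have s2: "substitution (\<Delta>2 + \<Gamma>) (?\<Theta> + \<Gamma>) ?lift"
    using substitution_lift[OF substitution_shift[of \<Gamma> \<Delta>1], of \<Delta>2] by (simp add: ac_simps)
  obtain F1 where F1: "subst H1 (shift \<Delta>2) = Conj F1" "horn \<Sigma> (?\<Theta> + \<Gamma>) (Conj F1)"
    using horn_subst[OF 1(1) s1 ctx] horn_Conj by metis
  obtain F2 where F2: "subst H2 ?lift = Conj F2" "horn \<Sigma> (?\<Theta> + \<Gamma>) (Conj F2)"
    using horn_subst[OF 2(1) s2 ctx] horn_Conj by metis
  define K where "K = Conj (F1 |\<union>| F2)"
  have K: "horn \<Sigma> (?\<Theta> + \<Gamma>) K" unfolding K_def by (rule horn_union[OF F1(2) F2(2)])
  define G where "G = Exists ?\<Theta> K"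
  have G: "regular \<Sigma> \<Gamma> G" using horn_regular[OF K] by (simp add: G_def regular_Exists_iff)
  have "provable \<Sigma> T \<Gamma> \<chi> G"
  proof (rule exists_elim[OF provable.cut[OF \<chi>(1) 1(2)] _ regular_formula[OF G]])
    let ?\<chi>1 = "And (subst \<chi> (shift \<Delta>1)) H1"
    have f1: "formula \<Sigma> (\<Delta>1 + \<Gamma>) (subst \<chi> (shift \<Delta>1))" "formula \<Sigma> (\<Delta>1 + \<Gamma>) H1"
      using provable_formulas[OF \<chi>(1)] 1(1) ctx
      by (auto simp: horn_def intro!: formula_subst[OF _ substitution_shift])
    have "provable \<Sigma> T (\<Delta>1 + \<Gamma>) (subst \<chi> (shift \<Delta>1)) (subst (Exists \<Delta>2 H2) (shift \<Delta>1))"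
      using ctx by (intro provable.substitute[OF provable.cut[OF \<chi>(2) 2(2)]]) simp_all
    then have ex2: "provable \<Sigma> T (\<Delta>1 + \<Gamma>) ?\<chi>1 (Exists \<Delta>2 (Conj F2))"
      unfolding F2(1)[symmetric] subst.simps by (rule provable.cut[OF provable_And_left(1)[OF f1]])
    show "provable \<Sigma> T (\<Delta>1 + \<Gamma>) ?\<chi>1 (subst G (shift \<Delta>1))"
    proof (rule exists_elim[OF ex2])
      show "formula \<Sigma> (\<Delta>1 + \<Gamma>) (subst G (shift \<Delta>1))"
        using ctx by (intro formula_subst[OF regular_formula[OF G]]) simp_all
      let ?\<chi>2 = "And (subst ?\<chi>1 (shift \<Delta>2)) (Conj F2)"
      have f2: "formula \<Sigma> (\<Delta>2 + (\<Delta>1 + \<Gamma>)) (subst ?\<chi>1 (shift \<Delta>2))"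
        "formula \<Sigma> (\<Delta>2 + (\<Delta>1 + \<Gamma>)) (Conj F2)"
        and f3: "formula \<Sigma> (\<Delta>2 + (\<Delta>1 + \<Gamma>)) (subst (subst \<chi> (shift \<Delta>1)) (shift \<Delta>2))"
        "formula \<Sigma> (\<Delta>2 + (\<Delta>1 + \<Gamma>)) (Conj F1)"
        using formula_subst[OF _ substitution_shift] provable_formulas[OF ex2] f1(1) ctx F1(2) F2(2)
        unfolding horn_def add.assoc by (blast intro: context_over_add[THEN iffD2])+
      have p1: "provable \<Sigma> T (\<Delta>2 + (\<Delta>1 + \<Gamma>)) ?\<chi>2 (Conj F1)"
        using provable.cut[OF provable_And_left(1)[OF f2]] provable_And_left(2)[OF f3]
        by (simp only: subst_And F1(1))
      have p2: "provable \<Sigma> T (\<Delta>2 + (\<Delta>1 + \<Gamma>)) ?\<chi>2 (Conj F2)"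
        by (rule provable_And_left(2)[OF f2])
      have "provable \<Sigma> T (\<Delta>2 + (\<Delta>1 + \<Gamma>)) ?\<chi>2 K"
        unfolding K_def
      proof (rule provable.conj_right)
        show "formula \<Sigma> (\<Delta>2 + (\<Delta>1 + \<Gamma>)) ?\<chi>2" using provable_formulas[OF p2] by blast
        fix \<theta> assume "\<theta> |\<in>| F1 |\<union>| F2"
        then show "provable \<Sigma> T (\<Delta>2 + (\<Delta>1 + \<Gamma>)) ?\<chi>2 \<theta>"
          using provable.cut[OF p1 provable.conj_left[OF f3(2)]]
            provable.cut[OF p2 provable.conj_left[OF f2(2)]] by auto
      qed
      moreover have "provable \<Sigma> T (\<Delta>2 + (\<Delta>1 + \<Gamma>)) K (subst G (shift ?\<Theta>))"
        using exists_unit[of \<Sigma> ?\<Theta> \<Gamma> K T] K unfolding G_def horn_def by (simp only: ac_simps)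
      moreover have "subst (subst G (shift \<Delta>1)) (shift \<Delta>2) = subst G (shift ?\<Theta>)"
        by (rule subst_shift_shift[OF G])
      ultimately show "provable \<Sigma> T (\<Delta>2 + (\<Delta>1 + \<Gamma>)) ?\<chi>2 (subst (subst G (shift \<Delta>1)) (shift \<Delta>2))"
        by (simp only: provable.cut)
    qed
  qed
  moreover have "entails \<Gamma> G \<chi>"
    unfolding entails_def
  proof (intro allI impI)
    fix M :: "('s, 'r) model" and \<rho>
    assume \<rho>: "env M \<Gamma> \<rho>" and "sat G M \<rho>"
    then obtain \<sigma> where \<sigma>: "env M ?\<Theta> \<sigma>" "sat K M (copair ?\<Theta> \<sigma> \<rho>)" by (auto simp: G_def)
    let ?\<tau> = "copair ?\<Theta> \<sigma> \<rho>"
    have sat: "sat (subst H1 (shift \<Delta>2)) M ?\<tau>" "sat (subst H2 ?lift) M ?\<tau>"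
      using \<sigma>(2) unfolding F1(1) F2(1) K_def by auto
    have f: "formula \<Sigma> (\<Delta>1 + \<Gamma>) H1" "formula \<Sigma> (\<Delta>2 + \<Gamma>) H2"
      using 1(1) 2(1) by (auto simp: horn_def)
    have "agree (\<Delta>1 + \<Gamma>) (copair \<Delta>1 (\<sigma> \<odot> shift \<Delta>2) \<rho>) (?\<tau> \<odot> shift \<Delta>2)"
      by (auto simp: agree_def copair_def shift_def vars_iff)
    then have "sat H1 M (copair \<Delta>1 (\<sigma> \<odot> shift \<Delta>2) \<rho>)"
      using sat(1) sat_subst[OF f(1) s1] sat_cong[OF f(1)] by blast
    moreover have "agree (\<Delta>2 + \<Gamma>) (copair \<Delta>2 \<sigma> \<rho>) (?\<tau> \<odot> ?lift)"
      by (auto simp: agree_def copair_def shift_def same_def vars_iff)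
    then have "sat H2 M (copair \<Delta>2 \<sigma> \<rho>)"
      using sat(2) sat_subst[OF f(2) s2] sat_cong[OF f(2)] by blast
    moreover have "env M \<Delta>2 \<sigma>" "env M \<Delta>1 (\<sigma> \<odot> shift \<Delta>2)"
      using \<sigma>(1) by (simp_all add: env_add_iff)
    ultimately have "sat (Exists \<Delta>1 H1) M \<rho>" "sat (Exists \<Delta>2 H2) M \<rho>" by auto
    then have "sat \<phi> M \<rho>" "sat \<psi> M \<rho>"
      using \<rho> 1(3) 2(3) unfolding entails_def by blast+
    then show "sat \<chi> M \<rho>" using \<rho> \<chi>(3) unfolding entails_def by auto
  qed
  ultimately show ?thesis unfolding has_normal_form_def G_def using K by blast
qed

lemma normal_form_horn:
  fixes \<phi> :: "('s, 'r, 'i) form"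
  assumes H: "horn \<Sigma> \<Gamma> H" "provable \<Sigma> T \<Gamma> \<phi> H" "entails \<Gamma> H \<phi>"
  shows "has_normal_form \<Sigma> T \<Gamma> \<phi>"
  unfolding has_normal_form_def
proof (intro exI conjI)
  have r: "regular \<Sigma> \<Gamma> H" by (rule horn_regular[OF H(1)])
  have e: "agree \<Gamma> (copair {#} \<sigma> \<rho>) \<rho>" for \<sigma> \<rho> :: "'s subst"
    by (simp add: agree_def copair_def vars_iff)
  show "horn \<Sigma> ({#} + \<Gamma>) H" using H(1) by simp
  have "provable \<Sigma> T \<Gamma> \<phi> (subst H (copair {#} same same))"
    using H(2) subst_ident[OF r e] by simp
  then show "provable \<Sigma> T \<Gamma> \<phi> (Exists {#} H)"
    using r by (intro exists_intro[where v = same]) (auto simp: substitution_iff vars_iff)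
  show "entails \<Gamma> (Exists {#} H) \<phi>"
    using H(3) sat_cong[OF regular_formula[OF r] e] unfolding entails_def by simp
qed

lemma normal_form:
  fixes \<phi> :: "('s, 'r, 'i) form"
  shows "regular \<Sigma> \<Gamma> \<phi> \<Longrightarrow> has_normal_form \<Sigma> T \<Gamma> \<phi>"
proof (induction rule: regular.induct)
  case (equal \<Gamma> A i j)
  let ?\<phi> = "Equal (A, i) (A, j) :: ('s, 'r, 'i) form"
  have f: "formula \<Sigma> \<Gamma> ?\<phi>" using equal by (rule formula.equal)
  show ?case
  proof (rule normal_form_horn)
    show "horn \<Sigma> \<Gamma> (Conj {|?\<phi>|})"
      using f equal.hyps(1) by (auto simp: horn_def formula_Conj_iff atomic_def)
    show "provable \<Sigma> T \<Gamma> ?\<phi> (Conj {|?\<phi>|})"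
      using f by (auto intro: provable.conj_right provable.identity)
  qed (simp add: entails_def)
next
  case (rel \<Gamma> R xs)
  let ?\<phi> = "Rel R xs :: ('s, 'r, 'i) form"
  have f: "formula \<Sigma> \<Gamma> ?\<phi>" using rel by (rule formula.rel)
  show ?case
  proof (rule normal_form_horn)
    show "horn \<Sigma> \<Gamma> (Conj {|?\<phi>|})"
      using f rel.hyps(1) by (auto simp: horn_def formula_Conj_iff atomic_def)
    show "provable \<Sigma> T \<Gamma> ?\<phi> (Conj {|?\<phi>|})"
      using f by (auto intro: provable.conj_right provable.identity)
  qed (simp add: entails_def)
next
  case (conj \<Gamma> F)
  have "(\<forall>\<phi>. \<phi> |\<in>| F \<longrightarrow> regular \<Sigma> \<Gamma> \<phi> \<and> has_normal_form \<Sigma> T \<Gamma> \<phi>)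
      \<Longrightarrow> has_normal_form \<Sigma> T \<Gamma> (Conj F)"
  proof (induction F)
    case empty
    have h: "horn \<Sigma> \<Gamma> (Conj {||} :: ('s, 'r, 'i) form)"
      using conj.hyps(1) by (simp add: horn_def formula_Conj_iff)
    then show ?case
      by (intro normal_form_horn[OF h]) (auto simp: entails_def horn_def intro: provable.identity)
  next
    case (insert \<phi> F)
    have f: "formula \<Sigma> \<Gamma> (Conj (finsert \<phi> F))"
      using insert.prems conj.hyps(1) by (auto simp: formula_Conj_iff intro: regular_formula)
    have "provable \<Sigma> T \<Gamma> (Conj (finsert \<phi> F)) (Conj F)"
      by (rule provable.conj_right[OF f]) (auto intro: provable.conj_left[OF f])
    moreover have "provable \<Sigma> T \<Gamma> (Conj (finsert \<phi> F)) \<phi>"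
      by (rule provable.conj_left[OF f]) simp
    moreover have "entails \<Gamma> (And \<phi> (Conj F)) (Conj (finsert \<phi> F))"
      by (simp add: entails_def)
    ultimately show ?case
      using insert.IH insert.prems normal_form_conj[of \<Sigma> T \<Gamma> \<phi> "Conj F"] by blast
  qed
  then show ?case using conj by blast
next
  case (ex \<Gamma> \<Xi> \<phi>)
  obtain \<Delta> H where H: "horn \<Sigma> (\<Delta> + (\<Xi> + \<Gamma>)) H" "provable \<Sigma> T (\<Xi> + \<Gamma>) \<phi> (Exists \<Delta> H)"
    "entails (\<Xi> + \<Gamma>) (Exists \<Delta> H) \<phi>"
    using ex.IH unfolding has_normal_form_def by blast
  have H': "horn \<Sigma> ((\<Delta> + \<Xi>) + \<Gamma>) H" using H(1) unfolding add.assoc .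
  define G where "G = Exists (\<Delta> + \<Xi>) H"
  have G: "regular \<Sigma> \<Gamma> G"
    using horn_regular[OF H'] by (simp add: G_def regular_Exists_iff)
  have ctx: "context_over \<Sigma> ((\<Delta> + \<Xi>) + \<Gamma>)" by (rule regular_context[OF horn_regular[OF H']])
  have "provable \<Sigma> T (\<Delta> + (\<Xi> + \<Gamma>)) H (subst (subst G (shift \<Xi>)) (shift \<Delta>))"
    using exists_unit[OF regular_formula[OF horn_regular[OF H']], of T]
    unfolding subst_shift_shift[OF G] by (simp only: G_def add.assoc)
  then have "provable \<Sigma> T (\<Xi> + \<Gamma>) (Exists \<Delta> H) (subst G (shift \<Xi>))"
    using ctx by (intro provable.ex_left formula_subst[OF regular_formula[OF G]]) simp_all
  then have "provable \<Sigma> T \<Gamma> (Exists \<Xi> \<phi>) G"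
    using ctx by (intro provable.ex_left[OF _ regular_formula[OF G] provable.cut[OF H(2)]]) simp_all
  moreover have "entails \<Gamma> G (Exists \<Xi> \<phi>)"
    unfolding entails_def
  proof (intro allI impI)
    fix M :: "('s, 'r) model" and \<rho>
    assume \<rho>: "env M \<Gamma> \<rho>" and "sat G M \<rho>"
    then obtain \<sigma> where \<sigma>: "env M (\<Delta> + \<Xi>) \<sigma>" "sat H M (copair (\<Delta> + \<Xi>) \<sigma> \<rho>)"
      by (auto simp: G_def)
    let ?\<xi> = "\<sigma> \<odot> shift \<Delta>"
    have "agree (\<Delta> + (\<Xi> + \<Gamma>)) (copair \<Delta> \<sigma> (copair \<Xi> ?\<xi> \<rho>)) (copair (\<Delta> + \<Xi>) \<sigma> \<rho>)"
      by (auto simp: agree_def copair_def shift_def vars_iff)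
    then have "sat H M (copair \<Delta> \<sigma> (copair \<Xi> ?\<xi> \<rho>))"
      using \<sigma>(2) H(1) sat_cong unfolding horn_def by blast
    moreover have env: "env M \<Delta> \<sigma>" "env M \<Xi> ?\<xi>"
      using \<sigma>(1) by (simp_all add: env_add_iff)
    ultimately have "sat (Exists \<Delta> H) M (copair \<Xi> ?\<xi> \<rho>)" by auto
    moreover have "env M (\<Xi> + \<Gamma>) (copair \<Xi> ?\<xi> \<rho>)" using env(2) \<rho> by simp
    ultimately have "sat \<phi> M (copair \<Xi> ?\<xi> \<rho>)" using H(3) unfolding entails_def by blast
    then show "sat (Exists \<Xi> \<phi>) M \<rho>" using env(2) by auto
  qed
  ultimately show ?case unfolding has_normal_form_def G_def using H' by blast
qed

theorem completeness:
  assumes \<phi>: "regular \<Sigma> \<Gamma> \<phi>" and \<psi>: "regular \<Sigma> \<Gamma> \<psi>" and "entails \<Gamma> \<phi> \<psi>"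
  shows "provable \<Sigma> T \<Gamma> \<phi> \<psi>"
proof -
  obtain \<Delta> H where H: "horn \<Sigma> (\<Delta> + \<Gamma>) H" "provable \<Sigma> T \<Gamma> \<phi> (Exists \<Delta> H)"
    "entails \<Gamma> (Exists \<Delta> H) \<phi>"
    using normal_form[OF \<phi>] unfolding has_normal_form_def by blast
  then have "entails \<Gamma> (Exists \<Delta> H) \<psi>" using assms(3) by (simp add: entails_def)
  then show ?thesis by (rule provable.cut[OF H(2) completeness_horn[OF H(1) \<psi>]])
qed

corollary provable_iff_entails:
  "regular \<Sigma> \<Gamma> \<phi> \<Longrightarrow> regular \<Sigma> \<Gamma> \<psi> \<Longrightarrow> provable \<Sigma> {} \<Gamma> \<phi> \<psi> \<longleftrightarrow> entails \<Gamma> \<phi> \<psi>"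
  using soundness completeness by blast

section \<open>Presentations of formulas by combinatorial data\<close>

definition hom ::
  "('s, 'r) signature \<Rightarrow> ('s, 'r) model \<Rightarrow> ('s, 'r) model \<Rightarrow> 's subst \<Rightarrow> bool" where
  "hom \<Sigma> N M h \<longleftrightarrow> (\<forall>A. \<forall>j \<in> elements N A. h A j \<in> elements M A) \<and>
     (\<forall>(R, \<alpha>) \<in> holds N. (R, map2 h (arity \<Sigma> R) \<alpha>) \<in> holds M)"

lemma homD:
  "hom \<Sigma> N M h \<Longrightarrow> j \<in> elements N A \<Longrightarrow> h A j \<in> elements M A"
  "hom \<Sigma> N M h \<Longrightarrow> (R, \<alpha>) \<in> holds N \<Longrightarrow> (R, map2 h (arity \<Sigma> R) \<alpha>) \<in> holds M"
  by (auto simp: hom_def)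

lemma hom_env: "hom \<Sigma> N M h \<Longrightarrow> env N \<Gamma> \<rho> \<Longrightarrow> env M \<Gamma> (h \<odot> \<rho>)"
  by (simp add: env_def homD(1))

lemma map2_value_of: "map2 h (map fst xs) (map (value_of \<rho>) xs) = map (value_of (h \<odot> \<rho>)) xs"
  by (induction xs) (auto simp: value_of_def)

text \<open>Homomorphisms need not reflect relations or be injective, but regular formulas contain no negations.\<close>

lemma hom_sat:
  assumes h: "hom \<Sigma> N M h"
  shows "regular \<Sigma> \<Gamma> \<phi> \<Longrightarrow> env N \<Gamma> \<rho> \<Longrightarrow> sat \<phi> N \<rho> \<Longrightarrow> sat \<phi> M (h \<odot> \<rho>)"
proof (induction arbitrary: \<rho> rule: regular.induct)
  case (rel \<Gamma> R xs)
  then show ?case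
    using homD(2)[OF h, of R "map (value_of \<rho>) xs"] by (simp add: map2_value_of flip: rel.hyps(4))
next
  case (conj \<Gamma> F)
  then show ?case by simp
next
  case (ex \<Gamma> \<Delta> \<phi>)
  then obtain \<sigma> where \<sigma>: "env N \<Delta> \<sigma>" "sat \<phi> N (copair \<Delta> \<sigma> \<rho>)" by auto
  have "sat \<phi> M (h \<odot> copair \<Delta> \<sigma> \<rho>)"
    using \<sigma> ex.prems(1) by (intro ex.IH) simp_all
  also have "h \<odot> copair \<Delta> \<sigma> \<rho> = copair \<Delta> (h \<odot> \<sigma>) (h \<odot> \<rho>)" by (rule comp_copair)
  finally show ?case using hom_env[OF h \<sigma>(1)] by auto
qed simp

lemma hom_comp:
  assumes "hom \<Sigma> L N f" "hom \<Sigma> N M g"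
  shows "hom \<Sigma> L M (g \<odot> f)"
proof -
  have "map2 g As (map2 f As \<alpha>) = map2 (g \<odot> f) As \<alpha>" for As \<alpha>
    by (induction As \<alpha> rule: list_induct2') auto
  then show ?thesis
    using assms homD(2)[OF assms(2)] unfolding hom_def by fastforce
qed

lemma comb_data_relset:
  assumes "D \<in> comb_data_over \<Sigma>" "(R, \<alpha>) \<in> relset D"
  shows "R \<in> rels \<Sigma>" "length \<alpha> = length (arity \<Sigma> R)"
    "set (zip (arity \<Sigma> R) \<alpha>) \<subseteq> vars (comb_context D)"
proof -
  have *: "R \<in> rels \<Sigma>" "length \<alpha> = length (arity \<Sigma> R)" "set (arity \<Sigma> R) \<subseteq> support D"
    "\<And>k. k < length \<alpha> \<Longrightarrow> 1 \<le> \<alpha> ! k \<and> \<alpha> ! k \<le> mult D (arity \<Sigma> R ! k)"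
    using assms unfolding comb_data_over_def by fastforce+
  then show "R \<in> rels \<Sigma>" "length \<alpha> = length (arity \<Sigma> R)" by auto
  show "set (zip (arity \<Sigma> R) \<alpha>) \<subseteq> vars (comb_context D)"
    using * by (force simp: set_zip vars_comb_context[OF assms(1)] dest: nth_mem)
qed

lemma finite_relset: "D \<in> comb_data_over \<Sigma> \<Longrightarrow> finite (relset D)"
  by (simp add: comb_data_over_def)

lemma fset_conj_of: "finite S \<Longrightarrow> \<phi> |\<in>| Abs_fset S \<longleftrightarrow> \<phi> \<in> S"
  by (simp add: Abs_fset_inverse)

lemma sat_conj_of: "finite S \<Longrightarrow> sat (conj_of S) M \<rho> \<longleftrightarrow> (\<forall>\<phi>\<in>S. sat \<phi> M \<rho>)"
  by (auto simp: conj_of_def fset_conj_of)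

lemma horn_conj_of:
  assumes "finite S" "context_over \<Sigma> \<Gamma>" "\<And>\<phi>. \<phi> \<in> S \<Longrightarrow> atomic \<phi> \<and> formula \<Sigma> \<Gamma> \<phi>"
  shows "horn \<Sigma> \<Gamma> (conj_of S)"
  using assms by (auto simp: conj_of_def horn_def formula_Conj_iff fset_conj_of)

lemma sat_equal_families:
  "sat (equal_families \<Delta> u v) M \<rho> \<longleftrightarrow> agree \<Delta> (\<rho> \<odot> u) (\<rho> \<odot> v)"
  by (auto simp: equal_families_def sat_conj_of finite_vars agree_def)

lemma horn_equal_families:
  assumes "context_over \<Sigma> \<Gamma>" "substitution \<Delta> \<Gamma> u" "substitution \<Delta> \<Gamma> v"
  shows "horn \<Sigma> \<Gamma> (equal_families \<Delta> u v)"
  unfolding equal_families_def using assms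
  by (intro horn_conj_of)
    (auto simp: finite_vars atomic_def formula_Equal_iff substitution_iff)

lemma horn_relation_atoms:
  assumes "D \<in> comb_data_over \<Sigma>"
  shows "horn \<Sigma> (comb_context D) (conj_of (relation_atoms \<Sigma> D))"
proof (rule horn_conj_of)
  fix \<phi> :: "('a, 'b, 'c) form" assume "\<phi> \<in> relation_atoms \<Sigma> D"
  then show "atomic \<phi> \<and> formula \<Sigma> (comb_context D) \<phi>"
    using comb_data_relset[OF assms] context_over_comb_context[OF assms]
    by (fastforce simp: relation_atoms_def atomic_def formula_Rel_iff)
qed (use assms finite_relset context_over_comb_context in \<open>auto simp: relation_atoms_def\<close>)

lemma sat_relation_atoms:
  assumes "D \<in> comb_data_over \<Sigma>"
  shows "sat (conj_of (relation_atoms \<Sigma> D)) M h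
    \<longleftrightarrow> (\<forall>(R, \<alpha>) \<in> relset D. (R, map2 h (arity \<Sigma> R) \<alpha>) \<in> holds M)"
proof -
  have "value_of h = (\<lambda>(A, i). h A i)" by (auto simp: value_of_def)
  then show ?thesis
    using finite_relset[OF assms] by (auto simp: relation_atoms_def sat_conj_of)
qed

lemma hom_model_of_iff:
  fixes D :: "('s, 'r) comb_data"
  assumes "D \<in> comb_data_over \<Sigma>"
  shows "hom \<Sigma> (model_of D) M h
    \<longleftrightarrow> env M (comb_context D) h \<and> sat (conj_of (relation_atoms \<Sigma> D) :: ('s, 'r, 'i) form) M h"
  unfolding sat_relation_atoms[OF assms] by (auto simp: hom_def env_def)

text \<open>The solutions of \<open>\<phi>\<close> in \<open>M\<close> correspond naturally to the homomorphisms \<open>D \<rightarrow> M\<close>.  The correspondence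
is one to one because \<open>q\<close> is onto.\<close>

definition presents ::
  "('s, 'r) signature \<Rightarrow> 's ctx \<Rightarrow> ('s, 'r, 'i) form \<Rightarrow> ('s, 'r) comb_data \<Rightarrow> 's subst \<Rightarrow> bool" where
  "presents \<Sigma> \<Gamma> \<phi> D q \<longleftrightarrow> D \<in> comb_data_over \<Sigma> \<and> cover \<Gamma> D q \<and>
     (\<forall>M \<rho>. env M \<Gamma> \<rho> \<longrightarrow> sat \<phi> M \<rho> \<longleftrightarrow> (\<exists>h. hom \<Sigma> (model_of D) M h \<and> agree \<Gamma> \<rho> (h \<odot> q)))"

lemma presentsD:
  assumes "presents \<Sigma> \<Gamma> \<phi> D q"
  shows "D \<in> comb_data_over \<Sigma>" "cover \<Gamma> D q"
    "env M \<Gamma> \<rho> \<Longrightarrow> sat \<phi> M \<rho> \<longleftrightarrow> (\<exists>h. hom \<Sigma> (model_of D) M h \<and> agree \<Gamma> \<rho> (h \<odot> q))"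
  using assms by (auto simp: presents_def)

lemma cover_env: "cover \<Gamma> D q \<Longrightarrow> env (model_of D) \<Gamma> q"
  by (simp add: cover_def env_def substitution_iff)

lemma cover_agree:
  assumes "cover \<Gamma> D q" "agree \<Gamma> (f \<odot> q) (g \<odot> q)"
  shows "agree (comb_context D) f g"
proof (rule agreeI)
  fix A j assume "(A, j) \<in> vars (comb_context D)"
  then obtain i where "(A, i) \<in> vars \<Gamma>" "q A i = j"
    using assms(1) by (auto simp: cover_def)
  then show "f A j = g A j" using agreeD[OF assms(2)] by auto
qed

lemma hom_cong:
  fixes D :: "('s, 'r) comb_data"
  assumes "D \<in> comb_data_over \<Sigma>" "agree (comb_context D) h h'"
  shows "hom \<Sigma> (model_of D) M h \<longleftrightarrow> hom \<Sigma> (model_of D) M h'"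
proof -
  have "formula \<Sigma> (comb_context D) (conj_of (relation_atoms \<Sigma> D) :: ('s, 'r, unit) form)"
    using horn_relation_atoms[OF assms(1)] unfolding horn_def by blast
  from sat_cong[OF this assms(2)] show ?thesis
    by (simp add: hom_model_of_iff[OF assms(1), where ?'i = unit] env_cong[OF assms(2)])
qed

lemma hom_same:
  fixes D :: "('s, 'r) comb_data"
  assumes D: "D \<in> comb_data_over \<Sigma>"
  shows "hom \<Sigma> (model_of D) (model_of D) same"
proof -
  have "map2 same As \<alpha> = \<alpha>" if "length As = length \<alpha>" for As :: "'s list" and \<alpha> :: "nat list"
    using that by (induction As \<alpha> rule: list_induct2) (auto simp: same_def)
  then show ?thesis
    using comb_data_relset(2)[OF D] by (auto simp: hom_def) (simp add: same_def)
qed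

lemma presents_cong:
  assumes "presents \<Sigma> \<Gamma> \<phi> D q" "agree \<Gamma> q q'"
  shows "presents \<Sigma> \<Gamma> \<phi> D q'"
proof -
  have "agree \<Gamma> \<rho> (h \<odot> q) \<longleftrightarrow> agree \<Gamma> \<rho> (h \<odot> q')" for \<rho> h
    using assms(2) by (simp add: agree_def)
  moreover have "cover \<Gamma> D q'"
    using assms unfolding presents_def cover_def substitution_iff agree_def by metis
  ultimately show ?thesis using assms(1) by (simp add: presents_def)
qed

text \<open>Soundness applied to the equations and relations of \<open>D\<close>, all of which are provable from \<open>\<phi>\<close>, shows
that a solution of \<open>\<phi>\<close> factors through \<open>q\<close>.\<close>

lemma canonical_presents:
  fixes \<phi> :: "('s, 'r, 'i) form"
  assumes can: "canonical \<Sigma> {} \<Gamma> \<phi> D q" and \<phi>: "horn \<Sigma> \<Gamma> \<phi>"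
  shows "presents \<Sigma> \<Gamma> \<phi> D q"
proof -
  have D: "D \<in> comb_data_over \<Sigma>" and cov: "cover \<Gamma> D q" and sat: "sat \<phi> (model_of D) q"
    using can by (auto simp: canonical_def)
  have "sat \<phi> M \<rho> \<longleftrightarrow> (\<exists>h. hom \<Sigma> (model_of D) M h \<and> agree \<Gamma> \<rho> (h \<odot> q))"
    if \<rho>: "env M \<Gamma> \<rho>" for M \<rho>
  proof
    assume \<phi>\<rho>: "sat \<phi> M \<rho>"
    have holds: "sat \<psi> M \<rho>" if "provable \<Sigma> {} \<Gamma> \<phi> \<psi>" for \<psi>
      using soundness[OF that] \<rho> \<phi>\<rho> by (simp add: entails_def)
    obtain s where s: "substitution (comb_context D) \<Gamma> s"
      "\<And>A j. (A, j) \<in> vars (comb_context D) \<Longrightarrow> q A (s A j) = j"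
      by (rule cover_section[OF cov]) blast
    have ker: "\<rho> A i = \<rho> A j" if "(A, i) \<in> vars \<Gamma>" "(A, j) \<in> vars \<Gamma>" "q A i = q A j" for A i j
      using holds[of "Equal (A, i) (A, j)"] can that unfolding canonical_def by simp
    have \<rho>_eq: "\<rho> A (s A (q A i)) = \<rho> A i" if "(A, i) \<in> vars \<Gamma>" for A i
    proof -
      have "(A, q A i) \<in> vars (comb_context D)"
        using cov that by (simp add: cover_def substitution_iff)
      then show ?thesis using s that by (intro ker) (auto simp: substitution_iff)
    qed
    have "hom \<Sigma> (model_of D) M (\<rho> \<odot> s)"
      unfolding hom_def
    proof (intro conjI ballI allI)
      fix A j assume "j \<in> elements (model_of D) A"
      then show "\<rho> A (s A j) \<in> elements M A"
        using env_substitution[OF \<rho> s(1)] by (simp add: env_def)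
    next
      fix x assume "x \<in> holds (model_of D)"
      then obtain R \<alpha> where x: "x = (R, \<alpha>)" "(R, \<alpha>) \<in> relset D" by (cases x) auto
      then obtain xs where xs: "\<alpha> = map (value_of q) xs" "provable \<Sigma> {} \<Gamma> \<phi> (Rel R xs)"
        using can unfolding canonical_def by blast
      then have f: "map fst xs = arity \<Sigma> R" "set xs \<subseteq> vars \<Gamma>"
        using provable_formulas[OF xs(2)] by (auto simp: formula_Rel_iff)
      have "map2 (\<rho> \<odot> s) (arity \<Sigma> R) \<alpha> = map (value_of ((\<rho> \<odot> s) \<odot> q)) xs"
        unfolding xs(1) f(1)[symmetric] by (rule map2_value_of)
      also have "\<dots> = map (value_of \<rho>) xs"
        using f(2) \<rho>_eq by (auto simp: value_of_def)
      finally show "case x of (R, \<alpha>) \<Rightarrow> (R, map2 (\<rho> \<odot> s) (arity \<Sigma> R) \<alpha>) \<in> holds M"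
        using holds[OF xs(2)] x(1) by simp
    qed
    then show "\<exists>h. hom \<Sigma> (model_of D) M h \<and> agree \<Gamma> \<rho> (h \<odot> q)"
      using \<rho>_eq by (intro exI[of _ "\<rho> \<odot> s"]) (simp add: agree_def)
  next
    assume "\<exists>h. hom \<Sigma> (model_of D) M h \<and> agree \<Gamma> \<rho> (h \<odot> q)"
    then obtain h where h: "hom \<Sigma> (model_of D) M h" "agree \<Gamma> \<rho> (h \<odot> q)" by blast
    have "sat \<phi> M (h \<odot> q)" by (rule hom_sat[OF h(1) horn_regular[OF \<phi>] cover_env[OF cov] sat])
    then show "sat \<phi> M \<rho>" using sat_cong[OF regular_formula[OF horn_regular[OF \<phi>]] h(2)] by blast
  qed
  then show ?thesis using D cov by (simp add: presents_def)
qed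

lemma horn_presents: "horn \<Sigma> \<Gamma> \<phi> \<Longrightarrow> \<exists>D q. presents \<Sigma> \<Gamma> \<phi> D q"
  using canonical_exists canonical_presents by blast

lemma cartesian_regular: "cartesian \<Sigma> T \<Gamma> \<phi> \<Longrightarrow> regular \<Sigma> \<Gamma> \<phi>"
  by (auto simp: cartesian_def regular_Exists_iff horn_regular)

lemma sat_at2:
  assumes "formula \<Sigma> (\<Gamma> + \<Delta>) \<theta>" "substitution \<Gamma> \<Xi> u" "substitution \<Delta> \<Xi> v"
  shows "sat (at2 \<Gamma> \<theta> u v) M \<rho> \<longleftrightarrow> sat \<theta> M (copair \<Gamma> (\<rho> \<odot> u) (\<rho> \<odot> v))"
  unfolding at2_def sat_subst[OF assms(1) substitution_copair[OF assms(2,3)]] comp_copair ..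

text \<open>In the structure with all natural numbers as elements and all relations true, every map is a
homomorphism.  The constant map and the indicator of the set of elements named by \<open>\<Gamma>\<close> agree on \<open>\<Gamma>\<close>,
hence by uniqueness also on \<open>\<Delta>\<close>; so the elements named by \<open>\<Delta>\<close> are among those named by \<open>\<Gamma>\<close>.
This is the place where the absence of axioms enters.\<close>

lemma unique_witness_covered:
  fixes H :: "('s, 'r, 'i) form"
  assumes H: "presents \<Sigma> (\<Delta> + \<Gamma>) H D q" "regular \<Sigma> (\<Delta> + \<Gamma>) H"
    and unique: "entails (\<Delta> + \<Delta> + \<Gamma>)
      (And (at2 \<Delta> H same (shift (\<Delta> + \<Delta>))) (at2 \<Delta> H (shift \<Delta>) (shift (\<Delta> + \<Delta>))))
      (equal_families \<Delta> same (shift \<Delta>))"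
    and y: "(A, j) \<in> vars \<Delta>"
  shows "\<exists>i. (A, i) \<in> vars \<Gamma> \<and> q A (count \<Delta> A + i) = q A j"
proof -
  \<comment> \<open>\<open>?k\<close> and \<open>?h\<close> are used on the two copies of \<open>\<Delta>\<close> in the uniqueness sequent; both are \<open>1\<close> on \<open>\<Gamma>\<close>.\<close>
  let ?M = "\<lparr>elements = \<lambda>_. UNIV, holds = UNIV\<rparr> :: ('s, 'r) model"
  let ?h = "\<lambda>A j. if \<exists>i. (A, i) \<in> vars \<Gamma> \<and> q A (count \<Delta> A + i) = j then 1 else 0 :: nat"
  let ?k = "\<lambda>A j. 1 :: nat"
  have env: "env ?M \<Xi> \<rho>" for \<Xi> \<rho> by (simp add: env_def)
  have sat: "sat H ?M \<rho>" if "agree (\<Delta> + \<Gamma>) \<rho> (h \<odot> q)" for \<rho> h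
    using presentsD(3)[OF H(1) env, of \<rho>] that by (auto simp: hom_def)
  let ?\<tau> = "copair (\<Delta> + \<Delta>) (copair \<Delta> (?k \<odot> q) (?h \<odot> q)) ?k"
  have "sat (at2 \<Delta> H same (shift (\<Delta> + \<Delta>))) ?M ?\<tau>"
  proof -
    have "agree (\<Delta> + \<Gamma>) (copair \<Delta> (?\<tau> \<odot> same) (?\<tau> \<odot> shift (\<Delta> + \<Delta>))) (?k \<odot> q)"
      by (auto simp: agree_def copair_def same_def shift_def vars_iff)
    from sat[OF this] show ?thesis
      by (subst sat_at2[OF regular_formula[OF H(2)], where \<Xi> = "\<Delta> + \<Delta> + \<Gamma>"])
        (auto simp: substitution_iff same_def shift_def vars_iff)
  qed
  moreover have "sat (at2 \<Delta> H (shift \<Delta>) (shift (\<Delta> + \<Delta>))) ?M ?\<tau>"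
  proof -
    have "agree (\<Delta> + \<Gamma>) (copair \<Delta> (?\<tau> \<odot> shift \<Delta>) (?\<tau> \<odot> shift (\<Delta> + \<Delta>))) (?h \<odot> q)"
      unfolding agree_copair_iff
      by (auto simp: agree_def copair_def shift_def vars_iff)
    from sat[OF this] show ?thesis
      by (subst sat_at2[OF regular_formula[OF H(2)], where \<Xi> = "\<Delta> + \<Delta> + \<Gamma>"])
        (auto simp: substitution_iff shift_def vars_iff)
  qed
  ultimately have "sat (And (at2 \<Delta> H same (shift (\<Delta> + \<Delta>)))
      (at2 \<Delta> H (shift \<Delta>) (shift (\<Delta> + \<Delta>)))) ?M ?\<tau>"
    by simp
  then have "sat (equal_families \<Delta> same (shift \<Delta>) :: ('s, 'r, 'i) form) ?M ?\<tau>"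
    by (rule entailsD[OF unique env])
  then have "?\<tau> A (same A j) = ?\<tau> A (shift \<Delta> A j)"
    using y by (simp add: sat_equal_families agree_def)
  then have "?h A (q A j) = 1"
    using y by (auto simp: copair_def same_def shift_def vars_iff split: if_splits)
  then show ?thesis by (auto split: if_splits)
qed

text \<open>The bound variables can be dropped from the presentation of the matrix, as they name no
further elements.\<close>

lemma cartesian_presents:
  fixes \<phi> :: "('s, 'r, 'i) form"
  assumes "cartesian \<Sigma> {} \<Gamma> \<phi>"
  shows "\<exists>D q. presents \<Sigma> \<Gamma> \<phi> D q"
proof (cases "horn \<Sigma> \<Gamma> \<phi>")
  case True
  then show ?thesis by (rule horn_presents)
next
  case False
  then obtain \<Delta> H where \<phi>: "\<phi> = Exists \<Delta> H" and H: "horn \<Sigma> (\<Delta> + \<Gamma>) H"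
    and unique: "entails (\<Delta> + \<Delta> + \<Gamma>)
      (And (at2 \<Delta> H same (shift (\<Delta> + \<Delta>))) (at2 \<Delta> H (shift \<Delta>) (shift (\<Delta> + \<Delta>))))
      (equal_families \<Delta> same (shift \<Delta>))"
    using assms soundness unfolding cartesian_def by blast
  obtain D q where q: "presents \<Sigma> (\<Delta> + \<Gamma>) H D q" using horn_presents[OF H] by blast
  have "cover \<Gamma> D (q \<odot> shift \<Delta>)"
    unfolding cover_def
  proof (intro conjI allI impI)
    show "substitution \<Gamma> (comb_context D) (q \<odot> shift \<Delta>)"
      using presentsD(2)[OF q] unfolding cover_def
      by (blast intro: substitution_comp[OF substitution_shift])
    fix A j assume "(A, j) \<in> vars (comb_context D)"
    then obtain k where k: "(A, k) \<in> vars (\<Delta> + \<Gamma>)" "q A k = j"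
      using presentsD(2)[OF q] by (auto simp: cover_def)
    then show "\<exists>i. (A, i) \<in> vars \<Gamma> \<and> q A (shift \<Delta> A i) = j"
      using unique_witness_covered[OF q horn_regular[OF H] unique]
      by (cases rule: vars_add_cases[OF k(1)]) (auto simp: shift_def)
  qed
  moreover have "sat \<phi> M \<rho> \<longleftrightarrow> (\<exists>h. hom \<Sigma> (model_of D) M h \<and> agree \<Gamma> \<rho> (h \<odot> q \<odot> shift \<Delta>))"
    if \<rho>: "env M \<Gamma> \<rho>" for M \<rho>
  proof -
    have sat_H: "sat H M (copair \<Delta> \<sigma> \<rho>) \<longleftrightarrow> (\<exists>h. hom \<Sigma> (model_of D) M h \<and>
        agree \<Delta> \<sigma> (h \<odot> q) \<and> agree \<Gamma> \<rho> (h \<odot> q \<odot> shift \<Delta>))" if "env M \<Delta> \<sigma>" for \<sigma>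
      using \<rho> that presentsD(3)[OF q, of M "copair \<Delta> \<sigma> \<rho>"] by (simp add: agree_copair_iff)
    have "env M \<Delta> (h \<odot> q)" if "hom \<Sigma> (model_of D) M h" for h
      using hom_env[OF that cover_env[OF presentsD(2)[OF q]]] by (simp add: env_add_iff)
    then show ?thesis
      unfolding \<phi> sat.simps using sat_H agree_refl by blast
  qed
  ultimately show ?thesis using presentsD(1)[OF q] unfolding presents_def by blast
qed

section \<open>Morphisms of the syntactic category\<close>

lemma presents_equivalent:
  fixes \<phi> \<chi> :: "('s, 'r, 'i) form"
  assumes "regular \<Sigma> \<Gamma> \<phi>" "regular \<Sigma> \<Gamma> \<chi>" and \<phi>: "presents \<Sigma> \<Gamma> \<phi> D q"
  shows "equivalent \<Sigma> {} \<Gamma> \<phi> \<chi> \<longleftrightarrow> presents \<Sigma> \<Gamma> \<chi> D q"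
proof -
  have "equivalent \<Sigma> {} \<Gamma> \<phi> \<chi> \<longleftrightarrow> (\<forall>(M :: ('s, 'r) model) \<rho>. env M \<Gamma> \<rho> \<longrightarrow> sat \<chi> M \<rho> \<longleftrightarrow> sat \<phi> M \<rho>)"
    unfolding equivalent_def provable_iff_entails[OF assms(1,2)] provable_iff_entails[OF assms(2,1)]
    by (auto simp: entails_def)
  also have "\<dots> \<longleftrightarrow> presents \<Sigma> \<Gamma> \<chi> D q"
    using presentsD[OF \<phi>] by (simp add: presents_def)
  finally show ?thesis .
qed

text \<open>All formulas presented by the same \<open>D\<close> and \<open>q\<close> are provably equivalent.  The morphisms of the
syntactic category turn out to be these classes.\<close>

definition presented_class ::
  "('s, 'r) signature \<Rightarrow> 's ctx \<Rightarrow> ('s, 'r) comb_data \<Rightarrow> 's subst \<Rightarrow> ('s, 'r, 'i) form set" where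
  "presented_class \<Sigma> \<Gamma> D q = {\<chi>. cartesian \<Sigma> {} \<Gamma> \<chi> \<and> presents \<Sigma> \<Gamma> \<chi> D q}"

lemma formula_class_eq:
  assumes "regular \<Sigma> \<Gamma> \<phi>" "presents \<Sigma> \<Gamma> \<phi> D q"
  shows "formula_class \<Sigma> {} \<Gamma> \<phi> = presented_class \<Sigma> \<Gamma> D q"
  using presents_equivalent[OF assms(1) cartesian_regular assms(2)]
  by (auto simp: formula_class_def presented_class_def)

lemma presented_class_cong:
  "agree \<Gamma> q q' \<Longrightarrow> presented_class \<Sigma> \<Gamma> D q = presented_class \<Sigma> \<Gamma> D q'"
  using presents_cong agree_sym unfolding presented_class_def by blast

text \<open>With \<open>s\<close> choosing a name \<open>s j\<close> for each element \<open>j\<close> of \<open>D\<close>, the formula states the relations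
of \<open>D\<close> between the chosen names and equates each variable \<open>x\<close> with \<open>s (q x)\<close>.  In particular every
presented formula is equivalent to a Horn formula, hence to a cartesian one.\<close>

lemma horn_presentation:
  fixes D :: "('s, 'r) comb_data"
  assumes D: "D \<in> comb_data_over \<Sigma>" and cov: "cover \<Gamma> D q" and ctx: "context_over \<Sigma> \<Gamma>"
  shows "\<exists>\<chi> :: ('s, 'r, 'i) form. horn \<Sigma> \<Gamma> \<chi> \<and> presents \<Sigma> \<Gamma> \<chi> D q"
proof -
  obtain s where s: "substitution (comb_context D) \<Gamma> s"
    "\<And>A j. (A, j) \<in> vars (comb_context D) \<Longrightarrow> q A (s A j) = j"
    by (rule cover_section[OF cov]) blast
  have q: "substitution \<Gamma> (comb_context D) q" using cov by (simp add: cover_def)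
  let ?atoms = "conj_of (relation_atoms \<Sigma> D) :: ('s, 'r, 'i) form"
  have horn1: "horn \<Sigma> \<Gamma> (subst ?atoms s)"
    by (rule horn_subst[OF horn_relation_atoms[OF D] s(1) ctx])
  then obtain F where F: "subst ?atoms s = Conj F" using horn_Conj by blast
  have horn2: "horn \<Sigma> \<Gamma> (equal_families \<Gamma> same (s \<odot> q) :: ('s, 'r, 'i) form)"
    by (intro horn_equal_families[OF ctx] substitution_comp[OF q s(1)] substitution_same)
  then obtain G where G: "equal_families \<Gamma> same (s \<odot> q) = (Conj G :: ('s, 'r, 'i) form)"
    using horn_Conj by blast
  have "sat (Conj (F |\<union>| G)) M \<rho> \<longleftrightarrow> (\<exists>h. hom \<Sigma> (model_of D) M h \<and> agree \<Gamma> \<rho> (h \<odot> q))"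
    if \<rho>: "env M \<Gamma> \<rho>" for M \<rho>
  proof -
    have "sat (Conj (F |\<union>| G)) M \<rho> \<longleftrightarrow> sat (Conj F) M \<rho> \<and> sat (Conj G) M \<rho>" by auto
    also have "sat (Conj F) M \<rho> \<longleftrightarrow> hom \<Sigma> (model_of D) M (\<rho> \<odot> s)"
      unfolding F[symmetric] hom_model_of_iff[OF D, where ?'i = 'i]
        sat_subst[OF regular_formula[OF horn_regular[OF horn_relation_atoms[OF D]]] s(1)]
      using env_substitution[OF \<rho> s(1)] by simp
    also have "sat (Conj G) M \<rho> \<longleftrightarrow> agree \<Gamma> \<rho> ((\<rho> \<odot> s) \<odot> q)"
      unfolding G[symmetric] sat_equal_families by (simp add: same_def)
    also have "hom \<Sigma> (model_of D) M (\<rho> \<odot> s) \<and> agree \<Gamma> \<rho> ((\<rho> \<odot> s) \<odot> q)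
        \<longleftrightarrow> (\<exists>h. hom \<Sigma> (model_of D) M h \<and> agree \<Gamma> \<rho> (h \<odot> q))"
    proof
      assume "\<exists>h. hom \<Sigma> (model_of D) M h \<and> agree \<Gamma> \<rho> (h \<odot> q)"
      then obtain h where h: "hom \<Sigma> (model_of D) M h" "agree \<Gamma> \<rho> (h \<odot> q)" by blast
      have "agree (comb_context D) h (\<rho> \<odot> s)"
        using agreeD[OF h(2) substitutionD[OF s(1)]] s(2) by (simp add: agree_def)
      then have "hom \<Sigma> (model_of D) M (\<rho> \<odot> s)" and "agree \<Gamma> (h \<odot> q) ((\<rho> \<odot> s) \<odot> q)"
        using h(1) hom_cong[OF D] substitutionD[OF q] by (blast, simp add: agree_def)
      then show "hom \<Sigma> (model_of D) M (\<rho> \<odot> s) \<and> agree \<Gamma> \<rho> ((\<rho> \<odot> s) \<odot> q)"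
        using h(2) by (simp add: agree_def)
    qed blast
    finally show ?thesis .
  qed
  then have "presents \<Sigma> \<Gamma> (Conj (F |\<union>| G)) D q"
    using D cov by (simp add: presents_def)
  moreover have "horn \<Sigma> \<Gamma> (Conj (F |\<union>| G))"
    using horn1 horn2 unfolding F G by (rule horn_union)
  ultimately show ?thesis by blast
qed

lemma horn_cartesian: "horn \<Sigma> \<Gamma> \<phi> \<Longrightarrow> cartesian \<Sigma> T \<Gamma> \<phi>"
  by (simp add: cartesian_def)

lemma presented_class_nonempty:
  "D \<in> comb_data_over \<Sigma> \<Longrightarrow> cover \<Gamma> D q \<Longrightarrow> context_over \<Sigma> \<Gamma> \<Longrightarrow> presented_class \<Sigma> \<Gamma> D q \<noteq> {}"
  using horn_presentation horn_cartesian unfolding presented_class_def by blast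

lemma sat_split:
  "formula \<Sigma> (\<Gamma> + \<Delta>) \<theta> \<Longrightarrow> sat \<theta> M \<tau> \<longleftrightarrow> sat \<theta> M (copair \<Gamma> \<tau> (\<tau> \<odot> shift \<Gamma>))"
  by (erule sat_cong) (rule agree_sym, simp add: agree_copair_iff)

lemma cover_copair:
  assumes "cover \<Gamma> D q" "substitution \<Delta> (comb_context D) k"
  shows "cover (\<Gamma> + \<Delta>) D (copair \<Gamma> q k)"
  unfolding cover_def
proof (intro conjI allI impI)
  show "substitution (\<Gamma> + \<Delta>) (comb_context D) (copair \<Gamma> q k)"
    using assms by (simp add: cover_def substitution_copair)
  fix A j assume "(A, j) \<in> vars (comb_context D)"
  then obtain i where "(A, i) \<in> vars \<Gamma>" "q A i = j" using assms(1) by (auto simp: cover_def)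
  then show "\<exists>i. (A, i) \<in> vars (\<Gamma> + \<Delta>) \<and> copair \<Gamma> q k A i = j"
    using vars_left copair_left by metis
qed

lemma hom_substitution:
  "hom \<Sigma> (model_of E) (model_of D) g \<Longrightarrow> substitution (comb_context E) (comb_context D) g"
  by (simp add: hom_def substitution_iff)

lemma cover_substitution:
  "cover \<Delta> E p \<Longrightarrow> hom \<Sigma> (model_of E) (model_of D) g \<Longrightarrow> substitution \<Delta> (comb_context D) (g \<odot> p)"
  using hom_substitution unfolding cover_def by (blast intro: substitution_comp)

lemma presents_copairD:
  assumes "presents \<Sigma> (\<Gamma> + \<Delta>) \<theta> D (copair \<Gamma> q k)" "env M \<Gamma> \<rho>" "env M \<Delta> \<sigma>"
  shows "sat \<theta> M (copair \<Gamma> \<rho> \<sigma>)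
    \<longleftrightarrow> (\<exists>h. hom \<Sigma> (model_of D) M h \<and> agree \<Gamma> \<rho> (h \<odot> q) \<and> agree \<Delta> \<sigma> (h \<odot> k))"
  using presentsD(3)[OF assms(1), of M "copair \<Gamma> \<rho> \<sigma>"] assms(2,3)
  by (simp add: comp_copair agree_copair_copair)

lemma presents_copairI:
  fixes \<theta> :: "('s, 'r, 'i) form"
  assumes "formula \<Sigma> (\<Gamma> + \<Delta>) \<theta>" "D \<in> comb_data_over \<Sigma>" "cover (\<Gamma> + \<Delta>) D (copair \<Gamma> q k)"
    and sat: "\<And>M \<rho> \<sigma>. env M \<Gamma> \<rho> \<Longrightarrow> env M \<Delta> \<sigma> \<Longrightarrow> sat \<theta> M (copair \<Gamma> \<rho> \<sigma>)
      \<longleftrightarrow> (\<exists>h. hom \<Sigma> (model_of D) M h \<and> agree \<Gamma> \<rho> (h \<odot> q) \<and> agree \<Delta> \<sigma> (h \<odot> k))"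
  shows "presents \<Sigma> (\<Gamma> + \<Delta>) \<theta> D (copair \<Gamma> q k)"
  unfolding presents_def
proof (intro conjI allI impI)
  fix M :: "('s, 'r) model" and \<tau>
  assume "env M (\<Gamma> + \<Delta>) \<tau>"
  then have env: "env M \<Gamma> \<tau>" "env M \<Delta> (\<tau> \<odot> shift \<Gamma>)" by (auto simp: env_add_iff)
  have "agree (\<Gamma> + \<Delta>) \<tau> (h \<odot> copair \<Gamma> q k)
      \<longleftrightarrow> agree \<Gamma> \<tau> (h \<odot> q) \<and> agree \<Delta> (\<tau> \<odot> shift \<Gamma>) (h \<odot> k)" for h
    by (simp only: comp_copair agree_copair_iff')
  then show "sat \<theta> M \<tau> \<longleftrightarrow> (\<exists>h. hom \<Sigma> (model_of D) M h \<and> agree (\<Gamma> + \<Delta>) \<tau> (h \<odot> copair \<Gamma> q k))"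
    using sat[OF env] sat_split[OF assms(1), of M \<tau>] by simp
qed (use assms in auto)

lemma regular_weaken:
  assumes "regular \<Sigma> \<Gamma> \<phi>" "context_over \<Sigma> \<Delta>"
  shows "regular \<Sigma> (\<Gamma> + \<Delta>) \<phi>"
proof -
  have "regular \<Sigma> (\<Gamma> + \<Delta>) (subst \<phi> same)"
    using assms regular_context[OF assms(1)] by (intro regular_subst[OF assms(1)]) auto
  then show ?thesis using subst_ident[OF assms(1) agree_refl] by simp
qed

lemma regular_And: "regular \<Sigma> \<Gamma> \<phi> \<Longrightarrow> regular \<Sigma> \<Gamma> \<psi> \<Longrightarrow> regular \<Sigma> \<Gamma> (And \<phi> \<psi>)"
  by (auto simp: regular_Conj_iff regular_context)

lemma regular_at2:
  "regular \<Sigma> (\<Gamma> + \<Delta>) \<theta> \<Longrightarrow> substitution \<Gamma> \<Xi> u \<Longrightarrow> substitution \<Delta> \<Xi> v \<Longrightarrow> context_over \<Sigma> \<Xi>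
    \<Longrightarrow> regular \<Sigma> \<Xi> (at2 \<Gamma> \<theta> u v)"
  unfolding at2_def by (blast intro: regular_subst substitution_copair)

lemma functional_iff:
  fixes \<theta> :: "('s, 'r, 'i) form"
  assumes \<phi>: "regular \<Sigma> \<Gamma> \<phi>" and \<psi>: "regular \<Sigma> \<Delta> \<psi>" and \<theta>: "regular \<Sigma> (\<Gamma> + \<Delta>) \<theta>"
  shows "functional \<Sigma> {} (\<Gamma>, \<phi>) (\<Delta>, \<psi>) \<theta> \<longleftrightarrow>
    (\<forall>(M :: ('s, 'r) model) \<rho> \<sigma>. env M \<Gamma> \<rho> \<longrightarrow> env M \<Delta> \<sigma> \<longrightarrow> sat \<theta> M (copair \<Gamma> \<rho> \<sigma>)
       \<longrightarrow> sat \<phi> M \<rho> \<and> sat \<psi> M \<sigma>) \<and>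
    (\<forall>(M :: ('s, 'r) model) \<rho>. env M \<Gamma> \<rho> \<longrightarrow> sat \<phi> M \<rho>
       \<longrightarrow> (\<exists>\<sigma>. env M \<Delta> \<sigma> \<and> sat \<theta> M (copair \<Gamma> \<rho> \<sigma>))) \<and>
    (\<forall>(M :: ('s, 'r) model) \<rho> \<sigma> \<sigma>'. env M \<Gamma> \<rho> \<longrightarrow> env M \<Delta> \<sigma> \<longrightarrow> env M \<Delta> \<sigma>'
       \<longrightarrow> sat \<theta> M (copair \<Gamma> \<rho> \<sigma>) \<longrightarrow> sat \<theta> M (copair \<Gamma> \<rho> \<sigma>') \<longrightarrow> agree \<Delta> \<sigma> \<sigma>')"
    (is "_ \<longleftrightarrow> ?typed \<and> ?total \<and> ?unique")
proof -
  have ctx: "context_over \<Sigma> \<Gamma>" "context_over \<Sigma> \<Delta>"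
    using regular_context[OF \<phi>] regular_context[OF \<psi>] by auto
  have f: "formula \<Sigma> (\<Gamma> + \<Delta>) \<theta>" "formula \<Sigma> \<Gamma> \<phi>" "formula \<Sigma> \<Delta> \<psi>"
    using \<phi> \<psi> \<theta> by (auto intro: regular_formula)
  let ?cod = "And \<phi> (subst \<psi> (shift \<Gamma>))"
  let ?ex = "Exists \<Delta> (at2 \<Gamma> \<theta> (shift \<Delta>) same)"
  let ?two = "And (at2 \<Gamma> \<theta> same (shift \<Gamma>)) (at2 \<Gamma> \<theta> same (shift (\<Gamma> + \<Delta>)))"
  let ?eq = "equal_families \<Delta> (shift \<Gamma>) (shift (\<Gamma> + \<Delta>)) :: ('s, 'r, 'i) form"
  have cod: "regular \<Sigma> (\<Gamma> + \<Delta>) ?cod"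
    using ctx by (intro regular_And regular_weaken[OF \<phi>] regular_subst[OF \<psi>]) auto
  have ex: "regular \<Sigma> \<Gamma> ?ex"
    unfolding regular_Exists_iff using ctx by (intro regular_at2[OF \<theta>]) auto
  have s: "substitution \<Gamma> (\<Gamma> + \<Delta> + \<Delta>) same" "substitution \<Delta> (\<Gamma> + \<Delta> + \<Delta>) (shift \<Gamma>)"
    "substitution \<Delta> (\<Gamma> + \<Delta> + \<Delta>) (shift (\<Gamma> + \<Delta>))"
    by (auto simp: substitution_iff same_def shift_def vars_iff)
  have two: "regular \<Sigma> (\<Gamma> + \<Delta> + \<Delta>) ?two"
    using ctx s by (intro regular_And regular_at2[OF \<theta>]) auto
  have eq: "regular \<Sigma> (\<Gamma> + \<Delta> + \<Delta>) ?eq"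
    using ctx s by (intro horn_regular horn_equal_families) auto
  have sat_cod: "sat ?cod M (copair \<Gamma> \<rho> \<sigma>) \<longleftrightarrow> sat \<phi> M \<rho> \<and> sat \<psi> M \<sigma>" for M \<rho> \<sigma>
    using sat_cong[OF f(2) agree_copair_left] sat_shift[OF f(3)]
    unfolding sat_And by blast
  have "entails (\<Gamma> + \<Delta>) \<theta> ?cod \<longleftrightarrow> ?typed"
  proof
    assume e: "entails (\<Gamma> + \<Delta>) \<theta> ?cod"
    show ?typed
    proof (intro allI impI)
      fix M :: "('s, 'r) model" and \<rho> \<sigma>
      assume "env M \<Gamma> \<rho>" "env M \<Delta> \<sigma>" "sat \<theta> M (copair \<Gamma> \<rho> \<sigma>)"
      then have "sat ?cod M (copair \<Gamma> \<rho> \<sigma>)" by (intro entailsD[OF e]) simp_all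
      then show "sat \<phi> M \<rho> \<and> sat \<psi> M \<sigma>" unfolding sat_cod .
    qed
  next
    assume t: ?typed
    show "entails (\<Gamma> + \<Delta>) \<theta> ?cod"
      unfolding entails_def
    proof (intro allI impI)
      fix M :: "('s, 'r) model" and \<tau>
      assume "env M (\<Gamma> + \<Delta>) \<tau>" "sat \<theta> M \<tau>"
      then have "env M \<Gamma> \<tau>" "env M \<Delta> (\<tau> \<odot> shift \<Gamma>)" "sat \<theta> M (copair \<Gamma> \<tau> (\<tau> \<odot> shift \<Gamma>))"
        using sat_split[OF f(1), of M \<tau>] by (simp_all add: env_add_iff)
      then have "sat ?cod M (copair \<Gamma> \<tau> (\<tau> \<odot> shift \<Gamma>))"
        unfolding sat_cod using t by blast
      then show "sat ?cod M \<tau>"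
        using sat_split[OF regular_formula[OF cod], of M \<tau>] by blast
    qed
  qed
  moreover have "entails \<Gamma> \<phi> ?ex \<longleftrightarrow> ?total"
  proof -
    have "sat (at2 \<Gamma> \<theta> (shift \<Delta>) same) M (copair \<Delta> \<sigma> \<rho>) \<longleftrightarrow> sat \<theta> M (copair \<Gamma> \<rho> \<sigma>)"
      for M \<rho> \<sigma>
    proof -
      have "agree (\<Gamma> + \<Delta>) (copair \<Gamma> (copair \<Delta> \<sigma> \<rho> \<odot> shift \<Delta>) (copair \<Delta> \<sigma> \<rho> \<odot> same))
          (copair \<Gamma> \<rho> \<sigma>)"
        unfolding agree_copair_copair
        by (auto simp: agree_def copair_left copair_right shift_def same_def)
      from sat_cong[OF f(1) this] show ?thesis
        by (subst sat_at2[OF f(1) substitution_shift substitution_same_left])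
    qed
    then show ?thesis unfolding entails_def by simp
  qed
  moreover have "entails (\<Gamma> + \<Delta> + \<Delta>) ?two ?eq \<longleftrightarrow> ?unique"
  proof -
    have sat_two: "sat ?two M \<tau> \<longleftrightarrow> sat \<theta> M (copair \<Gamma> \<tau> (\<tau> \<odot> shift \<Gamma>)) \<and>
        sat \<theta> M (copair \<Gamma> \<tau> (\<tau> \<odot> shift (\<Gamma> + \<Delta>)))" for M \<tau>
      using sat_at2[OF f(1) s(1,2)] sat_at2[OF f(1) s(1,3)] by (auto simp: same_def)
    show ?thesis
    proof
      assume e: "entails (\<Gamma> + \<Delta> + \<Delta>) ?two ?eq"
      show ?unique
      proof (intro allI impI)
        fix M :: "('s, 'r) model" and \<rho> \<sigma> \<sigma>'
        assume env: "env M \<Gamma> \<rho>" "env M \<Delta> \<sigma>" "env M \<Delta> \<sigma>'"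
          and sat: "sat \<theta> M (copair \<Gamma> \<rho> \<sigma>)" "sat \<theta> M (copair \<Gamma> \<rho> \<sigma>')"
        let ?\<tau> = "copair (\<Gamma> + \<Delta>) (copair \<Gamma> \<rho> \<sigma>) \<sigma>'"
        have a: "agree \<Gamma> ?\<tau> \<rho>" "agree \<Delta> (?\<tau> \<odot> shift \<Gamma>) \<sigma>" "agree \<Delta> (?\<tau> \<odot> shift (\<Gamma> + \<Delta>)) \<sigma>'"
          by (auto simp: agree_def copair_def shift_def vars_iff)
        then have "sat \<theta> M (copair \<Gamma> ?\<tau> (?\<tau> \<odot> shift \<Gamma>))"
          "sat \<theta> M (copair \<Gamma> ?\<tau> (?\<tau> \<odot> shift (\<Gamma> + \<Delta>)))"
          using sat sat_cong[OF f(1)] agree_copair_copair by blast+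
        then have "sat ?two M ?\<tau>" unfolding sat_two by blast
        then have "sat ?eq M ?\<tau>" using env by (intro entailsD[OF e]) simp_all
        then show "agree \<Delta> \<sigma> \<sigma>'"
          using a unfolding sat_equal_families by (simp add: agree_def)
      qed
    next
      assume u: ?unique
      show "entails (\<Gamma> + \<Delta> + \<Delta>) ?two ?eq"
        unfolding entails_def sat_two sat_equal_families
      proof (intro allI impI)
        fix M :: "('s, 'r) model" and \<tau>
        assume "env M (\<Gamma> + \<Delta> + \<Delta>) \<tau>"
          and sat: "sat \<theta> M (copair \<Gamma> \<tau> (\<tau> \<odot> shift \<Gamma>)) \<and>
            sat \<theta> M (copair \<Gamma> \<tau> (\<tau> \<odot> shift (\<Gamma> + \<Delta>)))"
        then have "env M \<Gamma> \<tau>" "env M \<Delta> (\<tau> \<odot> shift \<Gamma>)" "env M \<Delta> (\<tau> \<odot> shift (\<Gamma> + \<Delta>))"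
          by (simp_all add: env_add_iff)
        then show "agree \<Delta> (\<tau> \<odot> shift \<Gamma>) (\<tau> \<odot> shift (\<Gamma> + \<Delta>))"
          using u sat by blast
      qed
    qed
  qed
  ultimately show ?thesis
    by (simp add: functional_def provable_iff_entails[OF \<theta> cod] provable_iff_entails[OF \<phi> ex]
        provable_iff_entails[OF two eq])
qed

text \<open>The Yoneda argument: \<open>g\<close> is read off from the value of the functional relation \<open>\<theta>\<close> at the generic
solution \<open>q\<close> of \<open>\<phi>\<close> in \<open>D\<close>.  Every other solution is an image of \<open>q\<close> under a homomorphism, which
preserves \<open>\<theta>\<close>; by uniqueness the value of \<open>\<theta>\<close> there is the image of the generic value.\<close>

lemma functional_presents:
  fixes \<theta> :: "('s, 'r, 'i) form"
  assumes \<phi>: "regular \<Sigma> \<Gamma> \<phi>" "presents \<Sigma> \<Gamma> \<phi> D q"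
    and \<psi>: "regular \<Sigma> \<Delta> \<psi>" "presents \<Sigma> \<Delta> \<psi> E p"
    and \<theta>: "regular \<Sigma> (\<Gamma> + \<Delta>) \<theta>"
  shows "functional \<Sigma> {} (\<Gamma>, \<phi>) (\<Delta>, \<psi>) \<theta> \<longleftrightarrow>
    (\<exists>g. hom \<Sigma> (model_of E) (model_of D) g \<and> presents \<Sigma> (\<Gamma> + \<Delta>) \<theta> D (copair \<Gamma> q (g \<odot> p)))"
proof
  assume "functional \<Sigma> {} (\<Gamma>, \<phi>) (\<Delta>, \<psi>) \<theta>"
  then have typed: "\<And>(M :: ('s, 'r) model) \<rho> \<sigma>. env M \<Gamma> \<rho> \<Longrightarrow> env M \<Delta> \<sigma> \<Longrightarrow>
        sat \<theta> M (copair \<Gamma> \<rho> \<sigma>) \<Longrightarrow> sat \<phi> M \<rho> \<and> sat \<psi> M \<sigma>"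
    and total: "\<And>(M :: ('s, 'r) model) \<rho>. env M \<Gamma> \<rho> \<Longrightarrow> sat \<phi> M \<rho> \<Longrightarrow>
        \<exists>\<sigma>. env M \<Delta> \<sigma> \<and> sat \<theta> M (copair \<Gamma> \<rho> \<sigma>)"
    and unique: "\<And>(M :: ('s, 'r) model) \<rho> \<sigma> \<sigma>'. env M \<Gamma> \<rho> \<Longrightarrow> env M \<Delta> \<sigma> \<Longrightarrow> env M \<Delta> \<sigma>' \<Longrightarrow>
        sat \<theta> M (copair \<Gamma> \<rho> \<sigma>) \<Longrightarrow> sat \<theta> M (copair \<Gamma> \<rho> \<sigma>') \<Longrightarrow> agree \<Delta> \<sigma> \<sigma>'"
    unfolding functional_iff[OF \<phi>(1) \<psi>(1) \<theta>] by blast+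
  have D: "D \<in> comb_data_over \<Sigma>" and cov: "cover \<Gamma> D q" "cover \<Delta> E p"
    using presentsD[OF \<phi>(2)] presentsD[OF \<psi>(2)] by auto
  have q: "env (model_of D) \<Gamma> q" by (rule cover_env[OF cov(1)])
  have "agree \<Gamma> q (same \<odot> q)" by (simp add: same_def)
  then have "sat \<phi> (model_of D) q"
    using presentsD(3)[OF \<phi>(2) q] hom_same[OF D] by blast
  then obtain \<sigma> where \<sigma>: "env (model_of D) \<Delta> \<sigma>" "sat \<theta> (model_of D) (copair \<Gamma> q \<sigma>)"
    using total[OF q] by blast
  then obtain g where g: "hom \<Sigma> (model_of E) (model_of D) g" "agree \<Delta> \<sigma> (g \<odot> p)"
    using typed[OF q \<sigma>] presentsD(3)[OF \<psi>(2) \<sigma>(1)] by blast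
  have gp: "substitution \<Delta> (comb_context D) (g \<odot> p)" by (rule cover_substitution[OF cov(2) g(1)])
  have "agree (\<Gamma> + \<Delta>) (copair \<Gamma> q \<sigma>) (copair \<Gamma> q (g \<odot> p))"
    using g(2) by (simp add: agree_copair_copair)
  then have generic: "sat \<theta> (model_of D) (copair \<Gamma> q (g \<odot> p))"
    using \<sigma>(2) sat_cong[OF regular_formula[OF \<theta>]] by blast
  have copy: "sat \<theta> M (copair \<Gamma> (h \<odot> q) (h \<odot> g \<odot> p))"
    if "hom \<Sigma> (model_of D) M h" for M h
    using hom_sat[OF that \<theta> cover_env[OF cover_copair[OF cov(1) gp]] generic]
    by (simp only: comp_copair)
  have "presents \<Sigma> (\<Gamma> + \<Delta>) \<theta> D (copair \<Gamma> q (g \<odot> p))"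
  proof (rule presents_copairI[OF regular_formula[OF \<theta>] D cover_copair[OF cov(1) gp]])
    fix M :: "('s, 'r) model" and \<rho> \<sigma>
    assume env: "env M \<Gamma> \<rho>" "env M \<Delta> \<sigma>"
    show "sat \<theta> M (copair \<Gamma> \<rho> \<sigma>) \<longleftrightarrow>
        (\<exists>h. hom \<Sigma> (model_of D) M h \<and> agree \<Gamma> \<rho> (h \<odot> q) \<and> agree \<Delta> \<sigma> (h \<odot> g \<odot> p))"
    proof
      assume s: "sat \<theta> M (copair \<Gamma> \<rho> \<sigma>)"
      then obtain h where h: "hom \<Sigma> (model_of D) M h" "agree \<Gamma> \<rho> (h \<odot> q)"
        using typed[OF env s] presentsD(3)[OF \<phi>(2) env(1)] by blast
      have "agree (\<Gamma> + \<Delta>) (copair \<Gamma> (h \<odot> q) (h \<odot> g \<odot> p)) (copair \<Gamma> \<rho> (h \<odot> g \<odot> p))"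
        using agree_sym[OF h(2)] by (simp add: agree_copair_copair)
      then have "sat \<theta> M (copair \<Gamma> \<rho> (h \<odot> g \<odot> p))"
        using copy[OF h(1)] sat_cong[OF regular_formula[OF \<theta>]] by blast
      moreover have "env M \<Delta> (h \<odot> g \<odot> p)"
        using hom_env[OF h(1), of \<Delta> "g \<odot> p"] gp by (simp add: env_def substitution_iff)
      ultimately have "agree \<Delta> \<sigma> (h \<odot> g \<odot> p)" using unique[OF env] s by blast
      then show "\<exists>h. hom \<Sigma> (model_of D) M h \<and> agree \<Gamma> \<rho> (h \<odot> q) \<and> agree \<Delta> \<sigma> (h \<odot> g \<odot> p)"
        using h by blast
    next
      assume "\<exists>h. hom \<Sigma> (model_of D) M h \<and> agree \<Gamma> \<rho> (h \<odot> q) \<and> agree \<Delta> \<sigma> (h \<odot> g \<odot> p)"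
      then obtain h where h: "hom \<Sigma> (model_of D) M h"
        "agree (\<Gamma> + \<Delta>) (copair \<Gamma> \<rho> \<sigma>) (copair \<Gamma> (h \<odot> q) (h \<odot> g \<odot> p))"
        unfolding agree_copair_copair by blast
      then show "sat \<theta> M (copair \<Gamma> \<rho> \<sigma>)"
        using copy[OF h(1)] sat_cong[OF regular_formula[OF \<theta>]] by blast
    qed
  qed
  then show "\<exists>g. hom \<Sigma> (model_of E) (model_of D) g \<and>
      presents \<Sigma> (\<Gamma> + \<Delta>) \<theta> D (copair \<Gamma> q (g \<odot> p))"
    using g(1) by blast
next
  assume "\<exists>g. hom \<Sigma> (model_of E) (model_of D) g \<and>
      presents \<Sigma> (\<Gamma> + \<Delta>) \<theta> D (copair \<Gamma> q (g \<odot> p))"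
  then obtain g where g: "hom \<Sigma> (model_of E) (model_of D) g"
    and pres: "presents \<Sigma> (\<Gamma> + \<Delta>) \<theta> D (copair \<Gamma> q (g \<odot> p))" by blast
  have cov: "cover \<Gamma> D q" "cover \<Delta> E p"
    using presentsD[OF \<phi>(2)] presentsD[OF \<psi>(2)] by auto
  have gp: "substitution \<Delta> (comb_context D) (g \<odot> p)" by (rule cover_substitution[OF cov(2) g])
  note sat_\<theta> = presents_copairD[OF pres]
  show "functional \<Sigma> {} (\<Gamma>, \<phi>) (\<Delta>, \<psi>) \<theta>"
    unfolding functional_iff[OF \<phi>(1) \<psi>(1) \<theta>]
  proof (intro conjI allI impI)
    fix M :: "('s, 'r) model" and \<rho> \<sigma>
    assume env: "env M \<Gamma> \<rho>" "env M \<Delta> \<sigma>" and "sat \<theta> M (copair \<Gamma> \<rho> \<sigma>)"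
    then obtain h where h: "hom \<Sigma> (model_of D) M h" "agree \<Gamma> \<rho> (h \<odot> q)" "agree \<Delta> \<sigma> (h \<odot> g \<odot> p)"
      using sat_\<theta> by blast
    show "sat \<phi> M \<rho>" using presentsD(3)[OF \<phi>(2) env(1)] h by blast
    show "sat \<psi> M \<sigma>" using presentsD(3)[OF \<psi>(2) env(2)] hom_comp[OF g h(1)] h(3) by blast
  next
    fix M :: "('s, 'r) model" and \<rho>
    assume env: "env M \<Gamma> \<rho>" and "sat \<phi> M \<rho>"
    then obtain h where h: "hom \<Sigma> (model_of D) M h" "agree \<Gamma> \<rho> (h \<odot> q)"
      using presentsD(3)[OF \<phi>(2) env] by blast
    have "env M \<Delta> (h \<odot> g \<odot> p)"
      using hom_env[OF h(1), of \<Delta> "g \<odot> p"] gp by (simp add: env_def substitution_iff)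
    then show "\<exists>\<sigma>. env M \<Delta> \<sigma> \<and> sat \<theta> M (copair \<Gamma> \<rho> \<sigma>)"
      using sat_\<theta>[OF env] h agree_refl by blast
  next
    fix M :: "('s, 'r) model" and \<rho> \<sigma> \<sigma>'
    assume env: "env M \<Gamma> \<rho>" "env M \<Delta> \<sigma>" "env M \<Delta> \<sigma>'"
      and "sat \<theta> M (copair \<Gamma> \<rho> \<sigma>)" "sat \<theta> M (copair \<Gamma> \<rho> \<sigma>')"
    then obtain h h' where h: "agree \<Gamma> \<rho> (h \<odot> q)" "agree \<Delta> \<sigma> (h \<odot> g \<odot> p)"
      "agree \<Gamma> \<rho> (h' \<odot> q)" "agree \<Delta> \<sigma>' (h' \<odot> g \<odot> p)"
      using sat_\<theta>[OF env(1,2)] sat_\<theta>[OF env(1,3)] by blast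
    have "agree \<Gamma> (h \<odot> q) (h' \<odot> q)" using h(1,3) by (simp add: agree_def)
    then have "agree (comb_context D) h h'" by (rule cover_agree[OF cov(1)])
    then show "agree \<Delta> \<sigma> \<sigma>'"
      using h(2,4) gp by (simp add: agree_def substitution_iff)
  qed
qed

lemma syntactic_category_simps:
  "Ob (syntactic_category \<Sigma> T) = {(\<Gamma>, \<phi>). cartesian \<Sigma> T \<Gamma> \<phi>}"
  "Hom (syntactic_category \<Sigma> T) (\<Gamma>, \<phi>) (\<Delta>, \<psi>) = {formula_class \<Sigma> T (\<Gamma> + \<Delta>) \<theta> | \<theta>.
     cartesian \<Sigma> T (\<Gamma> + \<Delta>) \<theta> \<and> functional \<Sigma> T (\<Gamma>, \<phi>) (\<Delta>, \<psi>) \<theta>}"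
  "Ident (syntactic_category \<Sigma> T) (\<Gamma>, \<phi>) =
     formula_class \<Sigma> T (\<Gamma> + \<Gamma>) (And \<phi> (equal_families \<Gamma> same (shift \<Gamma>)))"
  "Comp (syntactic_category \<Sigma> T) (\<Gamma>, \<phi>) (\<Delta>, \<psi>) (\<Xi>, \<chi>) K L =
     (\<Union>\<theta> \<in> K. \<Union>\<theta>' \<in> L. formula_class \<Sigma> T (\<Gamma> + \<Xi>) (compose_formula \<Gamma> \<Delta> \<theta> \<theta>'))"
  by (simp_all add: syntactic_category_def)

lemma Hom_syntactic:
  fixes \<phi> \<psi> :: "('s, 'r, 'i) form"
  assumes \<phi>: "regular \<Sigma> \<Gamma> \<phi>" "presents \<Sigma> \<Gamma> \<phi> D q"
    and \<psi>: "regular \<Sigma> \<Delta> \<psi>" "presents \<Sigma> \<Delta> \<psi> E p"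
  shows "Hom (syntactic_category \<Sigma> {}) (\<Gamma>, \<phi>) (\<Delta>, \<psi>) =
    {presented_class \<Sigma> (\<Gamma> + \<Delta>) D (copair \<Gamma> q (g \<odot> p)) | g. hom \<Sigma> (model_of E) (model_of D) g}"
    (is "_ = {?C g | g. ?hom g}")
proof (intro equalityI subsetI)
  fix K assume "K \<in> Hom (syntactic_category \<Sigma> {}) (\<Gamma>, \<phi>) (\<Delta>, \<psi>)"
  then obtain \<theta> where \<theta>: "regular \<Sigma> (\<Gamma> + \<Delta>) \<theta>" "functional \<Sigma> {} (\<Gamma>, \<phi>) (\<Delta>, \<psi>) \<theta>"
    "K = formula_class \<Sigma> {} (\<Gamma> + \<Delta>) \<theta>"
    using cartesian_regular unfolding syntactic_category_simps by blast
  then obtain g where "?hom g" "presents \<Sigma> (\<Gamma> + \<Delta>) \<theta> D (copair \<Gamma> q (g \<odot> p))"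
    using functional_presents[OF \<phi> \<psi> \<theta>(1)] by blast
  then show "K \<in> {?C g | g. ?hom g}" using formula_class_eq[OF \<theta>(1)] \<theta>(3) by blast
next
  fix K assume "K \<in> {?C g | g. ?hom g}"
  then obtain g where g: "?hom g" "K = ?C g" by blast
  have cov: "cover (\<Gamma> + \<Delta>) D (copair \<Gamma> q (g \<odot> p))"
    by (rule cover_copair[OF presentsD(2)[OF \<phi>(2)] cover_substitution[OF presentsD(2)[OF \<psi>(2)] g(1)]])
  have "context_over \<Sigma> (\<Gamma> + \<Delta>)"
    using regular_context[OF \<phi>(1)] regular_context[OF \<psi>(1)] by simp
  from horn_presentation[OF presentsD(1)[OF \<phi>(2)] cov this]
  obtain \<theta> :: "('s, 'r, 'i) form" where \<theta>: "horn \<Sigma> (\<Gamma> + \<Delta>) \<theta>"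
    "presents \<Sigma> (\<Gamma> + \<Delta>) \<theta> D (copair \<Gamma> q (g \<odot> p))" by blast
  have "functional \<Sigma> {} (\<Gamma>, \<phi>) (\<Delta>, \<psi>) \<theta>"
    using functional_presents[OF \<phi> \<psi> horn_regular[OF \<theta>(1)]] g(1) \<theta>(2) by blast
  moreover have "K = formula_class \<Sigma> {} (\<Gamma> + \<Delta>) \<theta>"
    using formula_class_eq[OF horn_regular[OF \<theta>(1)] \<theta>(2)] g(2) by simp
  ultimately show "K \<in> Hom (syntactic_category \<Sigma> {}) (\<Gamma>, \<phi>) (\<Delta>, \<psi>)"
    using horn_cartesian[OF \<theta>(1)] unfolding syntactic_category_simps by blast
qed

lemma regular_compose:
  assumes \<theta>: "regular \<Sigma> (\<Gamma> + \<Delta>) \<theta>" and \<theta>': "regular \<Sigma> (\<Delta> + \<Xi>) \<theta>'"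
  shows "regular \<Sigma> (\<Gamma> + \<Xi>) (compose_formula \<Gamma> \<Delta> \<theta> \<theta>')"
  unfolding compose_formula_def regular_Exists_iff
  using regular_context[OF \<theta>] regular_context[OF \<theta>']
  by (intro regular_And regular_at2[OF \<theta>] regular_at2[OF \<theta>'])
    (auto simp: substitution_iff same_def shift_def vars_iff)

lemma sat_compose:
  assumes \<theta>: "formula \<Sigma> (\<Gamma> + \<Delta>) \<theta>" and \<theta>': "formula \<Sigma> (\<Delta> + \<Xi>) \<theta>'"
  shows "sat (compose_formula \<Gamma> \<Delta> \<theta> \<theta>') M (copair \<Gamma> \<rho> \<tau>)
    \<longleftrightarrow> (\<exists>\<sigma>. env M \<Delta> \<sigma> \<and> sat \<theta> M (copair \<Gamma> \<rho> \<sigma>) \<and> sat \<theta>' M (copair \<Delta> \<sigma> \<tau>))"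
proof -
  let ?\<upsilon> = "\<lambda>\<sigma>. copair \<Delta> \<sigma> (copair \<Gamma> \<rho> \<tau>)"
  have s: "substitution \<Gamma> (\<Delta> + (\<Gamma> + \<Xi>)) (shift \<Delta>)" "substitution \<Delta> (\<Delta> + (\<Gamma> + \<Xi>)) same"
    "substitution \<Xi> (\<Delta> + (\<Gamma> + \<Xi>)) (shift (\<Delta> + \<Gamma>))"
    by (auto simp: substitution_iff same_def shift_def vars_iff)
  have a: "agree \<Gamma> (?\<upsilon> \<sigma> \<odot> shift \<Delta>) \<rho>" "agree \<Delta> (?\<upsilon> \<sigma> \<odot> same) \<sigma>"
    "agree \<Xi> (?\<upsilon> \<sigma> \<odot> shift (\<Delta> + \<Gamma>)) \<tau>" for \<sigma>
    by (auto simp: agree_def copair_def same_def shift_def vars_iff)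
  have "sat (at2 \<Gamma> \<theta> (shift \<Delta>) same) M (?\<upsilon> \<sigma>) \<longleftrightarrow> sat \<theta> M (copair \<Gamma> \<rho> \<sigma>)" for \<sigma>
    unfolding sat_at2[OF \<theta> s(1,2)]
    by (rule sat_cong[OF \<theta>]) (simp only: agree_copair_copair a simp_thms)
  moreover have "sat (at2 \<Delta> \<theta>' same (shift (\<Delta> + \<Gamma>))) M (?\<upsilon> \<sigma>) \<longleftrightarrow> sat \<theta>' M (copair \<Delta> \<sigma> \<tau>)" for \<sigma>
    unfolding sat_at2[OF \<theta>' s(2,3)]
    by (rule sat_cong[OF \<theta>']) (simp only: agree_copair_copair a simp_thms)
  ultimately show ?thesis unfolding compose_formula_def sat.simps(5) sat_And by simp
qed

lemma presents_compose:
  fixes \<theta> \<theta>' :: "('s, 'r, 'i) form"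
  assumes \<theta>: "regular \<Sigma> (\<Gamma> + \<Delta>) \<theta>" "presents \<Sigma> (\<Gamma> + \<Delta>) \<theta> D (copair \<Gamma> q (g \<odot> p))"
    and \<theta>': "regular \<Sigma> (\<Delta> + \<Xi>) \<theta>'" "presents \<Sigma> (\<Delta> + \<Xi>) \<theta>' E (copair \<Delta> p (g' \<odot> r))"
    and cov: "cover \<Gamma> D q" "cover \<Delta> E p" "cover \<Xi> F r"
    and g: "hom \<Sigma> (model_of E) (model_of D) g" and g': "hom \<Sigma> (model_of F) (model_of E) g'"
  shows "presents \<Sigma> (\<Gamma> + \<Xi>) (compose_formula \<Gamma> \<Delta> \<theta> \<theta>') D (copair \<Gamma> q ((g \<odot> g') \<odot> r))"
proof (rule presents_copairI)
  show "formula \<Sigma> (\<Gamma> + \<Xi>) (compose_formula \<Gamma> \<Delta> \<theta> \<theta>')"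
    by (rule regular_formula[OF regular_compose[OF \<theta>(1) \<theta>'(1)]])
  show "D \<in> comb_data_over \<Sigma>" by (rule presentsD(1)[OF \<theta>(2)])
  show "cover (\<Gamma> + \<Xi>) D (copair \<Gamma> q ((g \<odot> g') \<odot> r))"
    by (rule cover_copair[OF cov(1) cover_substitution[OF cov(3) hom_comp[OF g' g]]])
  have r: "substitution \<Xi> (comb_context E) (g' \<odot> r)" by (rule cover_substitution[OF cov(3) g'])
  fix M :: "('s, 'r) model" and \<rho> \<tau>
  assume env: "env M \<Gamma> \<rho>" "env M \<Xi> \<tau>"
  show "sat (compose_formula \<Gamma> \<Delta> \<theta> \<theta>') M (copair \<Gamma> \<rho> \<tau>) \<longleftrightarrow>
      (\<exists>h. hom \<Sigma> (model_of D) M h \<and> agree \<Gamma> \<rho> (h \<odot> q) \<and> agree \<Xi> \<tau> (h \<odot> (g \<odot> g') \<odot> r))"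
    unfolding sat_compose[OF regular_formula[OF \<theta>(1)] regular_formula[OF \<theta>'(1)]]
  proof
    assume "\<exists>\<sigma>. env M \<Delta> \<sigma> \<and> sat \<theta> M (copair \<Gamma> \<rho> \<sigma>) \<and> sat \<theta>' M (copair \<Delta> \<sigma> \<tau>)"
    then obtain \<sigma> where \<sigma>: "env M \<Delta> \<sigma>" "sat \<theta> M (copair \<Gamma> \<rho> \<sigma>)" "sat \<theta>' M (copair \<Delta> \<sigma> \<tau>)"
      by blast
    obtain h where h: "hom \<Sigma> (model_of D) M h" "agree \<Gamma> \<rho> (h \<odot> q)" "agree \<Delta> \<sigma> (h \<odot> g \<odot> p)"
      using presents_copairD[OF \<theta>(2) env(1) \<sigma>(1)] \<sigma>(2) by blast
    obtain h' where h': "agree \<Delta> \<sigma> (h' \<odot> p)" "agree \<Xi> \<tau> (h' \<odot> g' \<odot> r)"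
      using presents_copairD[OF \<theta>'(2) \<sigma>(1) env(2)] \<sigma>(3) by blast
    have "agree \<Delta> ((h \<odot> g) \<odot> p) (h' \<odot> p)" using h(3) h'(1) by (simp add: agree_def)
    then have "agree (comb_context E) (h \<odot> g) h'" by (rule cover_agree[OF cov(2)])
    then have "agree \<Xi> \<tau> (h \<odot> (g \<odot> g') \<odot> r)"
      using h'(2) r by (simp add: agree_def substitution_iff)
    then show "\<exists>h. hom \<Sigma> (model_of D) M h \<and> agree \<Gamma> \<rho> (h \<odot> q) \<and> agree \<Xi> \<tau> (h \<odot> (g \<odot> g') \<odot> r)"
      using h(1,2) by blast
  next
    assume "\<exists>h. hom \<Sigma> (model_of D) M h \<and> agree \<Gamma> \<rho> (h \<odot> q) \<and> agree \<Xi> \<tau> (h \<odot> (g \<odot> g') \<odot> r)"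
    then obtain h where h: "hom \<Sigma> (model_of D) M h" "agree \<Gamma> \<rho> (h \<odot> q)"
      "agree \<Xi> \<tau> ((h \<odot> g) \<odot> g' \<odot> r)" by auto
    have hg: "hom \<Sigma> (model_of E) M (h \<odot> g)" by (rule hom_comp[OF g h(1)])
    have \<sigma>: "env M \<Delta> ((h \<odot> g) \<odot> p)" by (rule hom_env[OF hg cover_env[OF cov(2)]])
    have "sat \<theta> M (copair \<Gamma> \<rho> ((h \<odot> g) \<odot> p))"
      using presents_copairD[OF \<theta>(2) env(1) \<sigma>] h(1,2) agree_refl by blast
    moreover have "sat \<theta>' M (copair \<Delta> ((h \<odot> g) \<odot> p) \<tau>)"
      using presents_copairD[OF \<theta>'(2) \<sigma> env(2)] hg h(3) agree_refl by blast
    ultimately show "\<exists>\<sigma>. env M \<Delta> \<sigma> \<and> sat \<theta> M (copair \<Gamma> \<rho> \<sigma>) \<and> sat \<theta>' M (copair \<Delta> \<sigma> \<tau>)"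
      using \<sigma> by blast
  qed
qed

text \<open>The composite is defined as a union over all representatives; each of them contributes the same
class, and there are representatives by \<open>presented_class_nonempty\<close>.\<close>

lemma Comp_syntactic:
  fixes \<phi> \<psi> \<chi> :: "('s, 'r, 'i) form"
  assumes \<phi>: "regular \<Sigma> \<Gamma> \<phi>" "presents \<Sigma> \<Gamma> \<phi> D q"
    and \<psi>: "regular \<Sigma> \<Delta> \<psi>" "presents \<Sigma> \<Delta> \<psi> E p"
    and \<chi>: "regular \<Sigma> \<Xi> \<chi>" "presents \<Sigma> \<Xi> \<chi> F r"
    and g: "hom \<Sigma> (model_of E) (model_of D) g" and g': "hom \<Sigma> (model_of F) (model_of E) g'"
  shows "Comp (syntactic_category \<Sigma> {}) (\<Gamma>, \<phi>) (\<Delta>, \<psi>) (\<Xi>, \<chi>)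
      (presented_class \<Sigma> (\<Gamma> + \<Delta>) D (copair \<Gamma> q (g \<odot> p)))
      (presented_class \<Sigma> (\<Delta> + \<Xi>) E (copair \<Delta> p (g' \<odot> r))) =
    presented_class \<Sigma> (\<Gamma> + \<Xi>) D (copair \<Gamma> q ((g \<odot> g') \<odot> r))"
    (is "Comp _ _ _ _ ?K ?L = ?KL")
proof -
  have ctx: "context_over \<Sigma> (\<Gamma> + \<Delta>)" "context_over \<Sigma> (\<Delta> + \<Xi>)"
    using regular_context[OF \<phi>(1)] regular_context[OF \<psi>(1)] regular_context[OF \<chi>(1)] by auto
  note D = presentsD(1)[OF \<phi>(2)] and E = presentsD(1)[OF \<psi>(2)]
  note cov = presentsD(2)[OF \<phi>(2)] presentsD(2)[OF \<psi>(2)] presentsD(2)[OF \<chi>(2)]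
  have "?K \<noteq> {}" "?L \<noteq> {}"
    using presented_class_nonempty[OF D cover_copair[OF cov(1) cover_substitution[OF cov(2) g]] ctx(1)]
      presented_class_nonempty[OF E cover_copair[OF cov(2) cover_substitution[OF cov(3) g']] ctx(2)]
    by auto
  moreover have "formula_class \<Sigma> {} (\<Gamma> + \<Xi>) (compose_formula \<Gamma> \<Delta> \<theta> \<theta>') = ?KL"
    if "\<theta> \<in> ?K" "\<theta>' \<in> ?L" for \<theta> \<theta>'
  proof -
    have \<theta>: "regular \<Sigma> (\<Gamma> + \<Delta>) \<theta>" "presents \<Sigma> (\<Gamma> + \<Delta>) \<theta> D (copair \<Gamma> q (g \<odot> p))"
      and \<theta>': "regular \<Sigma> (\<Delta> + \<Xi>) \<theta>'" "presents \<Sigma> (\<Delta> + \<Xi>) \<theta>' E (copair \<Delta> p (g' \<odot> r))"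
      using that cartesian_regular unfolding presented_class_def by blast+
    show ?thesis
      by (rule formula_class_eq[OF regular_compose[OF \<theta>(1) \<theta>'(1)]
            presents_compose[OF \<theta> \<theta>' cov g g']])
  qed
  ultimately show ?thesis unfolding syntactic_category_simps by auto
qed

lemma Ident_syntactic:
  fixes \<phi> :: "('s, 'r, 'i) form"
  assumes \<phi>: "regular \<Sigma> \<Gamma> \<phi>" "presents \<Sigma> \<Gamma> \<phi> D q"
  shows "Ident (syntactic_category \<Sigma> {}) (\<Gamma>, \<phi>) =
    presented_class \<Sigma> (\<Gamma> + \<Gamma>) D (copair \<Gamma> q (same \<odot> q))"
  unfolding syntactic_category_simps
proof (rule formula_class_eq)
  let ?eq = "equal_families \<Gamma> same (shift \<Gamma>) :: ('s, 'r, 'i) form"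
  have ctx: "context_over \<Sigma> \<Gamma>" by (rule regular_context[OF \<phi>(1)])
  show reg: "regular \<Sigma> (\<Gamma> + \<Gamma>) (And \<phi> ?eq)"
    using ctx
    by (intro regular_And regular_weaken[OF \<phi>(1)] horn_regular horn_equal_families) auto
  note D = presentsD(1)[OF \<phi>(2)] and cov = presentsD(2)[OF \<phi>(2)]
  show "presents \<Sigma> (\<Gamma> + \<Gamma>) (And \<phi> ?eq) D (copair \<Gamma> q (same \<odot> q))"
  proof (rule presents_copairI[OF regular_formula[OF reg] D])
    show "cover (\<Gamma> + \<Gamma>) D (copair \<Gamma> q (same \<odot> q))"
      by (rule cover_copair[OF cov cover_substitution[OF cov hom_same[OF D]]])
    fix M :: "('s, 'r) model" and \<rho> \<sigma>
    assume env: "env M \<Gamma> \<rho>" "env M \<Gamma> \<sigma>"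
    have "sat (And \<phi> ?eq) M (copair \<Gamma> \<rho> \<sigma>) \<longleftrightarrow> sat \<phi> M \<rho> \<and> agree \<Gamma> \<rho> \<sigma>"
    proof -
      have "agree \<Gamma> (copair \<Gamma> \<rho> \<sigma> \<odot> same) (copair \<Gamma> \<rho> \<sigma> \<odot> shift \<Gamma>) \<longleftrightarrow> agree \<Gamma> \<rho> \<sigma>"
        by (simp add: agree_def copair_left copair_right same_def shift_def)
      then show ?thesis
        unfolding sat_And sat_equal_families
        using sat_cong[OF regular_formula[OF \<phi>(1)] agree_copair_left] by blast
    qed
    also have "\<dots> \<longleftrightarrow> (\<exists>h. hom \<Sigma> (model_of D) M h \<and> agree \<Gamma> \<rho> (h \<odot> q) \<and> agree \<Gamma> \<sigma> (h \<odot> same \<odot> q))"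
      unfolding presentsD(3)[OF \<phi>(2) env(1)] by (auto simp: agree_def same_def)
    finally show "sat (And \<phi> ?eq) M (copair \<Gamma> \<rho> \<sigma>) \<longleftrightarrow>
      (\<exists>h. hom \<Sigma> (model_of D) M h \<and> agree \<Gamma> \<rho> (h \<odot> q) \<and> agree \<Gamma> \<sigma> (h \<odot> same \<odot> q))" .
  qed
qed

lemma presented_class_hom_cong:
  assumes "agree (comb_context E) g g'" "cover \<Delta> E p"
  shows "presented_class \<Sigma> (\<Gamma> + \<Delta>) D (copair \<Gamma> q (g \<odot> p)) =
    presented_class \<Sigma> (\<Gamma> + \<Delta>) D (copair \<Gamma> q (g' \<odot> p))"
proof (rule presented_class_cong)
  have "agree \<Delta> (g \<odot> p) (g' \<odot> p)"
    using assms by (simp add: agree_def cover_def substitution_iff)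
  then show "agree (\<Gamma> + \<Delta>) (copair \<Gamma> q (g \<odot> p)) (copair \<Gamma> q (g' \<odot> p))"
    by (simp add: agree_copair_copair)
qed

text \<open>Again by evaluation at the generic solution \<open>q\<close> in \<open>D\<close>, where the two morphisms take the
values \<open>g \<odot> p\<close> and \<open>g' \<odot> p\<close>.\<close>

lemma presented_class_inj:
  assumes D: "D \<in> comb_data_over \<Sigma>" and cov: "cover \<Gamma> D q" "cover \<Delta> E p"
    and ctx: "context_over \<Sigma> (\<Gamma> + \<Delta>)"
    and g: "hom \<Sigma> (model_of E) (model_of D) g" and g': "hom \<Sigma> (model_of E) (model_of D) g'"
    and eq: "(presented_class \<Sigma> (\<Gamma> + \<Delta>) D (copair \<Gamma> q (g \<odot> p)) :: ('s, 'r, 'i) form set) =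
      presented_class \<Sigma> (\<Gamma> + \<Delta>) D (copair \<Gamma> q (g' \<odot> p))"
  shows "agree (comb_context E) g g'"
proof -
  have gp: "substitution \<Delta> (comb_context D) (g \<odot> p)" by (rule cover_substitution[OF cov(2) g])
  obtain \<theta> :: "('s, 'r, 'i) form"
    where \<theta>: "\<theta> \<in> presented_class \<Sigma> (\<Gamma> + \<Delta>) D (copair \<Gamma> q (g \<odot> p))"
    using presented_class_nonempty[OF D cover_copair[OF cov(1) gp] ctx] by blast
  then have pres: "presents \<Sigma> (\<Gamma> + \<Delta>) \<theta> D (copair \<Gamma> q (g \<odot> p))"
    "presents \<Sigma> (\<Gamma> + \<Delta>) \<theta> D (copair \<Gamma> q (g' \<odot> p))"
    using eq by (auto simp: presented_class_def)
  have env: "env (model_of D) \<Gamma> q" "env (model_of D) \<Delta> (g \<odot> p)"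
    using cover_env[OF cov(1)] gp by (simp_all add: env_def substitution_iff)
  have "agree \<Gamma> q (same \<odot> q)" "agree \<Delta> (g \<odot> p) (same \<odot> g \<odot> p)" by (simp_all add: same_def)
  then have "sat \<theta> (model_of D) (copair \<Gamma> q (g \<odot> p))"
    using presents_copairD[OF pres(1) env] hom_same[OF D] by blast
  then obtain h where h: "agree \<Gamma> q (h \<odot> q)" "agree \<Delta> (g \<odot> p) (h \<odot> g' \<odot> p)"
    using presents_copairD[OF pres(2) env] by blast
  have "agree \<Gamma> (same \<odot> q) (h \<odot> q)" using h(1) by (simp add: same_def)
  then have "agree (comb_context D) same h" by (rule cover_agree[OF cov(1)])
  then have "agree \<Delta> (g \<odot> p) (g' \<odot> p)"
    using h(2) cover_substitution[OF cov(2) g'] by (simp add: agree_def substitution_iff same_def)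
  then show ?thesis by (rule cover_agree[OF cov(2)])
qed

lemma object_presentation:
  fixes X :: "('s, 'r, 'i) obj"
  assumes "X \<in> Ob (syntactic_category \<Sigma> {})"
  obtains \<Gamma> \<phi> D q where "X = (\<Gamma>, \<phi>)" "regular \<Sigma> \<Gamma> \<phi>" "presents \<Sigma> \<Gamma> \<phi> D q"
  using assms cartesian_presents cartesian_regular unfolding syntactic_category_simps by blast

lemma category_syntactic:
  "category (syntactic_category \<Sigma> {} :: (('s, 'r, 'i) obj, ('s, 'r, 'i) form set) cat)"
    (is "category ?C")
proof
  fix X assume "X \<in> Ob ?C"
  then obtain \<Gamma> \<phi> D q where X: "X = (\<Gamma>, \<phi>)" "regular \<Sigma> \<Gamma> \<phi>" "presents \<Sigma> \<Gamma> \<phi> D q"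
    by (rule object_presentation)
  then show "Ident ?C X \<in> Hom ?C X X"
    using hom_same[OF presentsD(1)[OF X(3)]]
    unfolding X(1) Hom_syntactic[OF X(2,3) X(2,3)] Ident_syntactic[OF X(2,3)] by blast
next
  fix X Y Z f g assume "X \<in> Ob ?C" "Y \<in> Ob ?C" "Z \<in> Ob ?C" and fg: "f \<in> Hom ?C X Y" "g \<in> Hom ?C Y Z"
  then obtain \<Gamma> \<phi> D q \<Delta> \<psi> E p \<Xi> \<chi> F r
    where X: "X = (\<Gamma>, \<phi>)" "regular \<Sigma> \<Gamma> \<phi>" "presents \<Sigma> \<Gamma> \<phi> D q"
    and Y: "Y = (\<Delta>, \<psi>)" "regular \<Sigma> \<Delta> \<psi>" "presents \<Sigma> \<Delta> \<psi> E p"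
    and Z: "Z = (\<Xi>, \<chi>)" "regular \<Sigma> \<Xi> \<chi>" "presents \<Sigma> \<Xi> \<chi> F r"
    by (metis object_presentation)
  obtain u where u: "hom \<Sigma> (model_of E) (model_of D) u"
    "f = presented_class \<Sigma> (\<Gamma> + \<Delta>) D (copair \<Gamma> q (u \<odot> p))"
    using fg(1) unfolding X(1) Y(1) Hom_syntactic[OF X(2,3) Y(2,3)] by blast
  obtain v where v: "hom \<Sigma> (model_of F) (model_of E) v"
    "g = presented_class \<Sigma> (\<Delta> + \<Xi>) E (copair \<Delta> p (v \<odot> r))"
    using fg(2) unfolding Y(1) Z(1) Hom_syntactic[OF Y(2,3) Z(2,3)] by blast
  show "Comp ?C X Y Z f g \<in> Hom ?C X Z"
    unfolding X(1) Y(1) Z(1) u(2) v(2) Comp_syntactic[OF X(2,3) Y(2,3) Z(2,3) u(1) v(1)]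
      Hom_syntactic[OF X(2,3) Z(2,3)]
    by (intro CollectI exI[of _ "u \<odot> v"] conjI refl hom_comp[OF v(1) u(1)])
next
  fix X Y f assume "X \<in> Ob ?C" "Y \<in> Ob ?C" and f: "f \<in> Hom ?C X Y"
  then obtain \<Gamma> \<phi> D q \<Delta> \<psi> E p
    where X: "X = (\<Gamma>, \<phi>)" "regular \<Sigma> \<Gamma> \<phi>" "presents \<Sigma> \<Gamma> \<phi> D q"
    and Y: "Y = (\<Delta>, \<psi>)" "regular \<Sigma> \<Delta> \<psi>" "presents \<Sigma> \<Delta> \<psi> E p"
    by (metis object_presentation)
  obtain u where u: "hom \<Sigma> (model_of E) (model_of D) u"
    "f = presented_class \<Sigma> (\<Gamma> + \<Delta>) D (copair \<Gamma> q (u \<odot> p))"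
    using f unfolding X(1) Y(1) Hom_syntactic[OF X(2,3) Y(2,3)] by blast
  have same: "hom \<Sigma> (model_of D) (model_of D) same" "hom \<Sigma> (model_of E) (model_of E) same"
    using hom_same presentsD(1)[OF X(3)] presentsD(1)[OF Y(3)] by auto
  show "Comp ?C X X Y (Ident ?C X) f = f"
    unfolding X(1) Y(1) u(2) Ident_syntactic[OF X(2,3)]
      Comp_syntactic[OF X(2,3) X(2,3) Y(2,3) same(1) u(1)] by (simp add: same_def)
  show "Comp ?C X Y Y f (Ident ?C Y) = f"
    unfolding X(1) Y(1) u(2) Ident_syntactic[OF Y(2,3)]
      Comp_syntactic[OF X(2,3) Y(2,3) Y(2,3) u(1) same(2)] by (simp add: same_def)
next
  fix W X Y Z f g h
  assume "W \<in> Ob ?C" "X \<in> Ob ?C" "Y \<in> Ob ?C" "Z \<in> Ob ?C"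
    and fgh: "f \<in> Hom ?C W X" "g \<in> Hom ?C X Y" "h \<in> Hom ?C Y Z"
  then obtain \<Theta> \<omega> B o' \<Gamma> \<phi> D q \<Delta> \<psi> E p \<Xi> \<chi> F r
    where W: "W = (\<Theta>, \<omega>)" "regular \<Sigma> \<Theta> \<omega>" "presents \<Sigma> \<Theta> \<omega> B o'"
    and X: "X = (\<Gamma>, \<phi>)" "regular \<Sigma> \<Gamma> \<phi>" "presents \<Sigma> \<Gamma> \<phi> D q"
    and Y: "Y = (\<Delta>, \<psi>)" "regular \<Sigma> \<Delta> \<psi>" "presents \<Sigma> \<Delta> \<psi> E p"
    and Z: "Z = (\<Xi>, \<chi>)" "regular \<Sigma> \<Xi> \<chi>" "presents \<Sigma> \<Xi> \<chi> F r"
    by (metis object_presentation)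
  obtain t where t: "hom \<Sigma> (model_of D) (model_of B) t"
    "f = presented_class \<Sigma> (\<Theta> + \<Gamma>) B (copair \<Theta> o' (t \<odot> q))"
    using fgh(1) unfolding W(1) X(1) Hom_syntactic[OF W(2,3) X(2,3)] by blast
  obtain u where u: "hom \<Sigma> (model_of E) (model_of D) u"
    "g = presented_class \<Sigma> (\<Gamma> + \<Delta>) D (copair \<Gamma> q (u \<odot> p))"
    using fgh(2) unfolding X(1) Y(1) Hom_syntactic[OF X(2,3) Y(2,3)] by blast
  obtain v where v: "hom \<Sigma> (model_of F) (model_of E) v"
    "h = presented_class \<Sigma> (\<Delta> + \<Xi>) E (copair \<Delta> p (v \<odot> r))"
    using fgh(3) unfolding Y(1) Z(1) Hom_syntactic[OF Y(2,3) Z(2,3)] by blast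
  show "Comp ?C W Y Z (Comp ?C W X Y f g) h = Comp ?C W X Z f (Comp ?C X Y Z g h)"
    unfolding W(1) X(1) Y(1) Z(1) t(2) u(2) v(2)
      Comp_syntactic[OF W(2,3) X(2,3) Y(2,3) t(1) u(1)]
      Comp_syntactic[OF X(2,3) Y(2,3) Z(2,3) u(1) v(1)]
      Comp_syntactic[OF W(2,3) Y(2,3) Z(2,3) hom_comp[OF u(1) t(1)] v(1)]
      Comp_syntactic[OF W(2,3) X(2,3) Z(2,3) t(1) hom_comp[OF v(1) u(1)]] ..
qed

section \<open>The combinatorial category\<close>

text \<open>Homomorphisms out of \<open>D\<close> matter only on the elements of \<open>D\<close>; this is the extensional representative
that the combinatorial category uses.\<close>

definition restrict_family :: "('s, 'r) comb_data \<Rightarrow> 's subst \<Rightarrow> 's subst" where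
  "restrict_family D g = (\<lambda>A \<in> support D. \<lambda>i \<in> {1..mult D A}. g A i)"

lemma agree_restrict_family:
  "D \<in> comb_data_over \<Sigma> \<Longrightarrow> agree (comb_context D) (restrict_family D g) g"
  by (simp add: agree_def vars_comb_context restrict_family_def)

lemma comb_compose_eq: "comb_compose D'' f g = restrict_family D'' (f \<odot> g)"
  by (simp add: comb_compose_def restrict_family_def compose_def)

lemma families_eqI:
  assumes "D' \<in> comb_data_over \<Sigma>" "f \<in> comb_families \<Sigma> D D'" "g \<in> comb_families \<Sigma> D D'"
    and "agree (comb_context D') f g"
  shows "f = g"
proof (rule PiE_ext)
  show "f \<in> (\<Pi>\<^sub>E A \<in> support D'. {1..mult D' A} \<rightarrow>\<^sub>E {1..mult D A})"
    "g \<in> (\<Pi>\<^sub>E A \<in> support D'. {1..mult D' A} \<rightarrow>\<^sub>E {1..mult D A})"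
    using assms(2,3) by (simp_all add: comb_families_def)
  then have PiE: "f A \<in> {1..mult D' A} \<rightarrow>\<^sub>E {1..mult D A}" "g A \<in> {1..mult D' A} \<rightarrow>\<^sub>E {1..mult D A}"
    if "A \<in> support D'" for A
    using that by blast+
  fix A assume A: "A \<in> support D'"
  show "f A = g A"
    by (rule PiE_ext[OF PiE[OF A]]) (use assms(1,4) A in \<open>simp add: agree_def vars_comb_context\<close>)
qed

lemma families_hom:
  assumes D: "D \<in> comb_data_over \<Sigma>" "D' \<in> comb_data_over \<Sigma>" "support D' \<subseteq> support D"
    and f: "f \<in> comb_families \<Sigma> D D'"
  shows "hom \<Sigma> (model_of D') (model_of D) f"
  unfolding hom_def
proof (intro conjI allI ballI)
  fix A j assume "j \<in> elements (model_of D') A"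
  then have Aj: "A \<in> support D'" "j \<in> {1..mult D' A}" by (auto simp: vars_comb_context[OF D(2)])
  have "f A \<in> {1..mult D' A} \<rightarrow>\<^sub>E {1..mult D A}"
    using f Aj(1) unfolding comb_families_def by blast
  then show "f A j \<in> elements (model_of D) A"
    using Aj D(3) by (auto simp: vars_comb_context[OF D(1)])
next
  fix x assume "x \<in> holds (model_of D')"
  then show "case x of (R, \<alpha>) \<Rightarrow> (R, map2 f (arity \<Sigma> R) \<alpha>) \<in> holds (model_of D)"
    using f by (auto simp: comb_families_def)
qed

text \<open>Multiplicities are positive, so each sort of \<open>D'\<close> has an element, which needs an image in \<open>D\<close>.\<close>

lemma hom_support:
  assumes D: "D \<in> comb_data_over \<Sigma>" "D' \<in> comb_data_over \<Sigma>"
    and g: "hom \<Sigma> (model_of D') (model_of D) g"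
  shows "support D' \<subseteq> support D"
proof
  fix A assume A: "A \<in> support D'"
  then have "1 \<le> mult D' A" using D(2) by (auto simp: comb_data_over_def PiE_iff)
  then have "(A, 1) \<in> vars (comb_context D')" using A by (simp add: vars_comb_context[OF D(2)])
  then have "(A, g A 1) \<in> vars (comb_context D)"
    using hom_substitution[OF g] by (simp add: substitution_iff)
  then show "A \<in> support D" by (simp add: vars_comb_context[OF D(1)])
qed

lemma restrict_family_in_families:
  assumes D: "D \<in> comb_data_over \<Sigma>" "D' \<in> comb_data_over \<Sigma>"
    and g: "hom \<Sigma> (model_of D') (model_of D) g"
  shows "restrict_family D' g \<in> comb_families \<Sigma> D D'"
proof -
  have "hom \<Sigma> (model_of D') (model_of D) (restrict_family D' g)"
    using g hom_cong[OF D(2) agree_restrict_family[OF D(2)]] by blast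
  then have "\<forall>(R, \<beta>) \<in> relset D'. (R, map2 (restrict_family D' g) (arity \<Sigma> R) \<beta>) \<in> relset D"
    by (simp add: hom_def)
  moreover have "g A i \<in> {1..mult D A}" if "A \<in> support D'" "i \<in> {1..mult D' A}" for A i
    using that hom_substitution[OF g]
    by (simp add: substitution_iff vars_comb_context[OF D(1)] vars_comb_context[OF D(2)])
  then have "restrict_family D' g \<in> (\<Pi>\<^sub>E A \<in> support D'. {1..mult D' A} \<rightarrow>\<^sub>E {1..mult D A})"
    unfolding restrict_family_def by (intro restrict_PiE_iff[THEN iffD2] ballI) auto
  ultimately show ?thesis by (simp add: comb_families_def)
qed

lemma restrict_family_eqI:
  assumes D: "D \<in> comb_data_over \<Sigma>" "D' \<in> comb_data_over \<Sigma>" and f: "f \<in> comb_families \<Sigma> D D'"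
    and g: "hom \<Sigma> (model_of D') (model_of D) g" "agree (comb_context D') g f"
  shows "restrict_family D' g = f"
proof (rule families_eqI[OF D(2) restrict_family_in_families[OF D g(1)] f])
  show "agree (comb_context D') (restrict_family D' g) f"
    using agree_restrict_family[OF D(2), of g] g(2) by (simp add: agree_def)
qed

lemma comb_category_simps:
  "Ob (comb_category \<Sigma>) = comb_data_over \<Sigma>"
  "Hom (comb_category \<Sigma>) D D' = (if support D' \<subseteq> support D then comb_families \<Sigma> D D' else {})"
  "Ident (comb_category \<Sigma>) D = restrict_family D same"
  "Comp (comb_category \<Sigma>) D D' D'' f g = restrict_family D'' (f \<odot> g)"
  by (simp_all add: comb_category_def comb_compose_eq) (simp add: restrict_family_def same_def)

lemma Hom_comb_category:
  assumes "D \<in> comb_data_over \<Sigma>" "D' \<in> comb_data_over \<Sigma>"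
  shows "f \<in> Hom (comb_category \<Sigma>) D D' \<longleftrightarrow>
    hom \<Sigma> (model_of D') (model_of D) f \<and> f \<in> comb_families \<Sigma> D D'"
  using families_hom[OF assms] hom_support[OF assms] by (auto simp: comb_category_simps)

lemma category_comb: "category (comb_category \<Sigma> :: (('s, 'r) comb_data, 's \<Rightarrow> nat \<Rightarrow> nat) cat)"
    (is "category ?C")
proof
  fix D assume "D \<in> Ob ?C"
  then have D: "D \<in> comb_data_over \<Sigma>" by (simp add: comb_category_simps)
  show "Ident ?C D \<in> Hom ?C D D"
    using restrict_family_in_families[OF D D hom_same[OF D]] by (simp add: comb_category_simps)
next
  fix D D' D'' f g
  assume "D \<in> Ob ?C" "D' \<in> Ob ?C" "D'' \<in> Ob ?C" and fg: "f \<in> Hom ?C D D'" "g \<in> Hom ?C D' D''"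
  then have D: "D \<in> comb_data_over \<Sigma>" "D' \<in> comb_data_over \<Sigma>" "D'' \<in> comb_data_over \<Sigma>"
    by (simp_all add: comb_category_simps(1))
  have fg: "hom \<Sigma> (model_of D'') (model_of D) (f \<odot> g)"
    using fg D by (auto simp: Hom_comb_category intro: hom_comp)
  show "Comp ?C D D' D'' f g \<in> Hom ?C D D''"
    using restrict_family_in_families[OF D(1,3) fg] hom_support[OF D(1,3) fg]
    by (simp add: comb_category_simps)
next
  fix D D' f
  assume "D \<in> Ob ?C" "D' \<in> Ob ?C" and "f \<in> Hom ?C D D'"
  then have D: "D \<in> comb_data_over \<Sigma>" "D' \<in> comb_data_over \<Sigma>"
    and f: "hom \<Sigma> (model_of D') (model_of D) f" "f \<in> comb_families \<Sigma> D D'"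
    using Hom_comb_category by (auto simp: comb_category_simps(1))
  have "hom \<Sigma> (model_of D') (model_of D) (restrict_family D same \<odot> f)"
    by (rule hom_comp[OF f(1)])
      (use hom_same[OF D(1)] hom_cong[OF D(1) agree_restrict_family[OF D(1)]] in blast)
  moreover have "agree (comb_context D') (restrict_family D same \<odot> f) f"
    using agree_restrict_family[OF D(1), of same] hom_substitution[OF f(1)]
    by (simp add: agree_def substitution_iff same_def)
  ultimately show "Comp ?C D D D' (Ident ?C D) f = f"
    unfolding comb_category_simps by (rule restrict_family_eqI[OF D f(2)])
  have "hom \<Sigma> (model_of D') (model_of D) (f \<odot> restrict_family D' same)"
    by (rule hom_comp[OF _ f(1)])
      (use hom_same[OF D(2)] hom_cong[OF D(2) agree_restrict_family[OF D(2)]] in blast)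
  moreover have "agree (comb_context D') (f \<odot> restrict_family D' same) f"
    using agree_restrict_family[OF D(2), of same]
    by (simp add: agree_def same_def)
  ultimately show "Comp ?C D D' D' f (Ident ?C D') = f"
    unfolding comb_category_simps by (rule restrict_family_eqI[OF D f(2)])
next
  fix D1 D2 D3 D4 f g h
  assume "D1 \<in> Ob ?C" "D2 \<in> Ob ?C" "D3 \<in> Ob ?C" "D4 \<in> Ob ?C"
    and "f \<in> Hom ?C D1 D2" "g \<in> Hom ?C D2 D3" "h \<in> Hom ?C D3 D4"
  then have D: "D3 \<in> comb_data_over \<Sigma>" "D4 \<in> comb_data_over \<Sigma>"
    and h: "substitution (comb_context D4) (comb_context D3) h"
    using Hom_comb_category hom_substitution unfolding comb_category_simps(1) by blast+
  have "restrict_family D3 (f \<odot> g) A (h A i) = f A (g A (h A i))"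
    if "A \<in> support D4" "i \<in> {1..mult D4 A}" for A i
    using agree_restrict_family[OF D(1), of "f \<odot> g"] h that
    by (simp add: agree_def substitution_iff vars_comb_context[OF D(2)])
  then show "Comp ?C D1 D3 D4 (Comp ?C D1 D2 D3 f g) h = Comp ?C D1 D2 D4 f (Comp ?C D2 D3 D4 g h)"
    unfolding comb_category_simps by (auto simp: restrict_family_def intro!: restrict_ext)
qed

section \<open>The equivalence\<close>

lemma cover_same: "cover (comb_context D) D same"
  by (simp add: cover_def) (simp add: same_def)

text \<open>Here the variables are the elements, and the atoms of the formula are the relations of \<open>D\<close>.\<close>

lemma comb_object_presents:
  fixes D :: "('s, 'r) comb_data"
  assumes D: "D \<in> comb_data_over \<Sigma>"
  shows "presents \<Sigma> (comb_context D) (conj_of (relation_atoms \<Sigma> D) :: ('s, 'r, 'i) form) D same"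
  unfolding presents_def
proof (intro conjI allI impI D cover_same)
  fix M :: "('s, 'r) model" and \<rho>
  assume "env M (comb_context D) \<rho>"
  then have "sat (conj_of (relation_atoms \<Sigma> D) :: ('s, 'r, 'i) form) M \<rho> \<longleftrightarrow> hom \<Sigma> (model_of D) M \<rho>"
    by (simp add: hom_model_of_iff[OF D, where ?'i = 'i])
  also have "\<dots> \<longleftrightarrow> (\<exists>h. hom \<Sigma> (model_of D) M h \<and> agree (comb_context D) \<rho> (h \<odot> same))"
    using hom_cong[OF D] agree_refl unfolding same_def by blast
  finally show "sat (conj_of (relation_atoms \<Sigma> D) :: ('s, 'r, 'i) form) M \<rho> \<longleftrightarrow>
    (\<exists>h. hom \<Sigma> (model_of D) M h \<and> agree (comb_context D) \<rho> (h \<odot> same))" .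
qed

text \<open>A solution of the defining formula is a homomorphism \<open>\<rho>\<close> out of \<open>D\<close> together with the values
\<open>\<sigma> = \<rho> \<odot> f\<close> at the variables of the codomain.\<close>

lemma comb_morphism_eq:
  fixes D D' :: "('s, 'r) comb_data"
  assumes D: "D \<in> comb_data_over \<Sigma>" and D': "D' \<in> comb_data_over \<Sigma>"
    and f: "hom \<Sigma> (model_of D') (model_of D) f"
  shows "comb_morphism \<Sigma> {} D D' f =
    (presented_class \<Sigma> (comb_context D + comb_context D') D (copair (comb_context D) same (f \<odot> same))
      :: ('s, 'r, 'i) form set)"
  unfolding comb_morphism_def
proof (rule formula_class_eq)
  let ?\<Gamma> = "comb_context D" and ?\<Delta> = "comb_context D'"
  let ?atoms = "relation_atoms \<Sigma> D :: ('s, 'r, 'i) form set"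
  define S where "S = {Equal (A, mult D A + i) (A, f A i) :: ('s, 'r, 'i) form | A i.
    A \<in> support D' \<and> i \<in> {1..mult D' A}}"
  have sub: "support D' \<subseteq> support D" by (rule hom_support[OF D D' f])
  have count: "count ?\<Gamma> A = mult D A" if "A \<in> support D'" for A
    using that sub D by (auto simp: comb_data_over_def count_comb_context)
  have "S = {Equal (A, count ?\<Gamma> A + i) (A, f A i) | A i. (A, i) \<in> vars ?\<Delta>}"
    unfolding S_def vars_comb_context[OF D'] by (intro Collect_cong) (auto simp: count)
  then have S: "S = (\<lambda>(A, i). Equal (A, count ?\<Gamma> A + i) (A, f A i)) ` vars ?\<Delta>" by auto
  have fin: "finite ?atoms" "finite S"
    using finite_relset[OF D] finite_vars by (auto simp: relation_atoms_def S)
  have fs: "substitution ?\<Delta> ?\<Gamma> f" by (rule hom_substitution[OF f])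
  have ctx: "context_over \<Sigma> (?\<Gamma> + ?\<Delta>)" using context_over_comb_context D D' by auto
  have atoms: "regular \<Sigma> ?\<Gamma> (conj_of ?atoms)" by (rule horn_regular[OF horn_relation_atoms[OF D]])
  have "formula \<Sigma> (?\<Gamma> + ?\<Delta>) \<phi> \<and> atomic \<phi>" if "\<phi> \<in> ?atoms \<union> S" for \<phi>
    using that
  proof
    assume \<phi>: "\<phi> \<in> ?atoms"
    then have "\<phi> |\<in>| Abs_fset ?atoms" using fset_conj_of[OF fin(1)] by blast
    then have "regular \<Sigma> (?\<Gamma> + ?\<Delta>) \<phi>"
      using atoms ctx by (auto simp: conj_of_def regular_Conj_iff intro: regular_weaken)
    then show ?thesis using \<phi> by (auto simp: relation_atoms_def atomic_def regular_formula)
  next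
    assume "\<phi> \<in> S"
    then show ?thesis
      using ctx fs by (auto simp: S atomic_def formula_Equal_iff vars_left vars_right substitution_iff)
  qed
  then have "horn \<Sigma> (?\<Gamma> + ?\<Delta>) (conj_of (?atoms \<union> S))"
    using fin ctx by (intro horn_conj_of) auto
  then show reg: "regular \<Sigma> (?\<Gamma> + ?\<Delta>) (conj_of (?atoms \<union> S))" by (rule horn_regular)
  show "presents \<Sigma> (?\<Gamma> + ?\<Delta>) (conj_of (?atoms \<union> S)) D (copair ?\<Gamma> same (f \<odot> same))"
  proof (rule presents_copairI[OF regular_formula[OF reg] D])
    show "cover (?\<Gamma> + ?\<Delta>) D (copair ?\<Gamma> same (f \<odot> same))"
      by (rule cover_copair[OF cover_same cover_substitution[OF cover_same f]])
    fix M :: "('s, 'r) model" and \<rho> \<sigma>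
    assume env: "env M ?\<Gamma> \<rho>" "env M ?\<Delta> \<sigma>"
    have "sat (conj_of (?atoms \<union> S)) M (copair ?\<Gamma> \<rho> \<sigma>) \<longleftrightarrow>
        sat (conj_of ?atoms) M (copair ?\<Gamma> \<rho> \<sigma>) \<and> (\<forall>\<phi> \<in> S. sat \<phi> M (copair ?\<Gamma> \<rho> \<sigma>))"
      using fin by (auto simp: sat_conj_of)
    also have "sat (conj_of ?atoms) M (copair ?\<Gamma> \<rho> \<sigma>) \<longleftrightarrow> hom \<Sigma> (model_of D) M \<rho>"
      unfolding sat_cong[OF regular_formula[OF atoms] agree_copair_left]
        hom_model_of_iff[OF D, where ?'i = 'i] using env(1) by blast
    also have "(\<forall>\<phi> \<in> S. sat \<phi> M (copair ?\<Gamma> \<rho> \<sigma>)) \<longleftrightarrow> agree ?\<Delta> \<sigma> (\<rho> \<odot> f)"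
      using substitutionD[OF fs]
      by (force simp: S agree_def copair_right copair_left)
    also have "hom \<Sigma> (model_of D) M \<rho> \<and> agree ?\<Delta> \<sigma> (\<rho> \<odot> f) \<longleftrightarrow>
      (\<exists>h. hom \<Sigma> (model_of D) M h \<and> agree ?\<Gamma> \<rho> (h \<odot> same) \<and> agree ?\<Delta> \<sigma> (h \<odot> f \<odot> same))"
    proof -
      have "agree ?\<Delta> \<sigma> (\<rho> \<odot> f) \<longleftrightarrow> agree ?\<Delta> \<sigma> (h \<odot> f)" if "agree ?\<Gamma> \<rho> h" for h
        using that substitutionD[OF fs] by (simp add: agree_def)
      then show ?thesis unfolding same_def using hom_cong[OF D] agree_refl by blast
    qed
    finally show "sat (conj_of (?atoms \<union> S)) M (copair ?\<Gamma> \<rho> \<sigma>) \<longleftrightarrow>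
      (\<exists>h. hom \<Sigma> (model_of D) M h \<and> agree ?\<Gamma> \<rho> (h \<odot> same) \<and> agree ?\<Delta> \<sigma> (h \<odot> f \<odot> same))" .
  qed
qed

lemma Hom_comb_objects:
  fixes D D' :: "('s, 'r) comb_data"
  assumes D: "D \<in> comb_data_over \<Sigma>" and D': "D' \<in> comb_data_over \<Sigma>"
  shows "Hom (syntactic_category \<Sigma> {} :: (('s, 'r, 'i) obj, ('s, 'r, 'i) form set) cat)
      (comb_object \<Sigma> D) (comb_object \<Sigma> D') =
    comb_morphism \<Sigma> {} D D' ` Hom (comb_category \<Sigma>) D D'"
proof -
  let ?C = "\<lambda>g. presented_class \<Sigma> (comb_context D + comb_context D') D
    (copair (comb_context D) same (g \<odot> same)) :: ('s, 'r, 'i) form set"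
  have "Hom (syntactic_category \<Sigma> {}) (comb_object \<Sigma> D) (comb_object \<Sigma> D') =
      ?C ` {g. hom \<Sigma> (model_of D') (model_of D) g}"
    unfolding comb_object_def
      Hom_syntactic[OF horn_regular[OF horn_relation_atoms[OF D]] comb_object_presents[OF D]
        horn_regular[OF horn_relation_atoms[OF D']] comb_object_presents[OF D']] by blast
  also have "\<dots> = comb_morphism \<Sigma> {} D D' ` Hom (comb_category \<Sigma>) D D'"
  proof (intro equalityI subsetI)
    fix K :: "('s, 'r, 'i) form set"
    assume "K \<in> ?C ` {g. hom \<Sigma> (model_of D') (model_of D) g}"
    then obtain g where g: "hom \<Sigma> (model_of D') (model_of D) g" and K: "K = ?C g" by blast
    let ?f = "restrict_family D' g"
    have f: "?f \<in> comb_families \<Sigma> D D'" by (rule restrict_family_in_families[OF D D' g])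
    have hom: "hom \<Sigma> (model_of D') (model_of D) ?f"
      by (rule families_hom[OF D D' hom_support[OF D D' g] f])
    have "K = ?C ?f"
      unfolding K
      by (rule presented_class_hom_cong[OF agree_sym[OF agree_restrict_family[OF D']] cover_same])
    also have "\<dots> = comb_morphism \<Sigma> {} D D' ?f" by (rule comb_morphism_eq[OF D D' hom, symmetric])
    finally show "K \<in> comb_morphism \<Sigma> {} D D' ` Hom (comb_category \<Sigma>) D D'"
      using f hom unfolding Hom_comb_category[OF D D', symmetric]
      by (simp add: Hom_comb_category[OF D D'])
  next
    fix K :: "('s, 'r, 'i) form set"
    assume "K \<in> comb_morphism \<Sigma> {} D D' ` Hom (comb_category \<Sigma>) D D'"
    then obtain f where "hom \<Sigma> (model_of D') (model_of D) f" "K = comb_morphism \<Sigma> {} D D' f"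
      using Hom_comb_category[OF D D'] by blast
    then show "K \<in> ?C ` {g. hom \<Sigma> (model_of D') (model_of D) g}"
      using comb_morphism_eq[OF D D'] by blast
  qed
  finally show ?thesis .
qed

lemma inj_comb_morphism:
  fixes D D' :: "('s, 'r) comb_data"
  assumes D: "D \<in> comb_data_over \<Sigma>" and D': "D' \<in> comb_data_over \<Sigma>"
  shows "inj_on (comb_morphism \<Sigma> {} D D' :: _ \<Rightarrow> ('s, 'r, 'i) form set) (Hom (comb_category \<Sigma>) D D')"
proof (rule inj_onI)
  fix f g
  assume f: "f \<in> Hom (comb_category \<Sigma>) D D'" and g: "g \<in> Hom (comb_category \<Sigma>) D D'"
    and eq: "comb_morphism \<Sigma> {} D D' f = (comb_morphism \<Sigma> {} D D' g :: ('s, 'r, 'i) form set)"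
  have hom: "hom \<Sigma> (model_of D') (model_of D) f" "hom \<Sigma> (model_of D') (model_of D) g"
    using f g Hom_comb_category[OF D D'] by auto
  have ctx: "context_over \<Sigma> (comb_context D + comb_context D')"
    using context_over_comb_context D D' by auto
  have "agree (comb_context D') f g"
    using eq unfolding comb_morphism_eq[OF D D' hom(1)] comb_morphism_eq[OF D D' hom(2)]
    by (rule presented_class_inj[OF D cover_same cover_same ctx hom])
  then show "f = g"
    using f g families_eqI[OF D'] Hom_comb_category[OF D D'] by blast
qed

lemma comb_morphism_compose:
  fixes D D' D'' :: "('s, 'r) comb_data"
  assumes D: "D \<in> comb_data_over \<Sigma>" "D' \<in> comb_data_over \<Sigma>" "D'' \<in> comb_data_over \<Sigma>"
    and f: "f \<in> Hom (comb_category \<Sigma>) D D'" and g: "g \<in> Hom (comb_category \<Sigma>) D' D''"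
  shows "Comp (syntactic_category \<Sigma> {} :: (('s, 'r, 'i) obj, ('s, 'r, 'i) form set) cat)
      (comb_object \<Sigma> D) (comb_object \<Sigma> D') (comb_object \<Sigma> D'')
      (comb_morphism \<Sigma> {} D D' f) (comb_morphism \<Sigma> {} D' D'' g) =
    comb_morphism \<Sigma> {} D D'' (comb_compose D'' f g)"
proof -
  have hom: "hom \<Sigma> (model_of D') (model_of D) f" "hom \<Sigma> (model_of D'') (model_of D') g"
    using f g Hom_comb_category D by auto
  note fg = hom_comp[OF hom(2,1)]
  have agree: "agree (comb_context D'') (f \<odot> g) (comb_compose D'' f g)"
    unfolding comb_compose_eq by (rule agree_sym[OF agree_restrict_family[OF D(3)]])
  then have hom': "hom \<Sigma> (model_of D'') (model_of D) (comb_compose D'' f g)"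
    using fg hom_cong[OF D(3)] by blast
  note obj = horn_regular[OF horn_relation_atoms] comb_object_presents
  show ?thesis
    unfolding comb_object_def comb_morphism_eq[OF D(1,2) hom(1)] comb_morphism_eq[OF D(2,3) hom(2)]
      comb_morphism_eq[OF D(1,3) hom']
      Comp_syntactic[OF obj[OF D(1)] obj[OF D(2)] obj[OF D(3)] hom]
    by (rule presented_class_hom_cong[OF agree cover_same])
qed

lemma comb_morphism_ident:
  fixes D :: "('s, 'r) comb_data"
  assumes D: "D \<in> comb_data_over \<Sigma>"
  shows "comb_morphism \<Sigma> {} D D (Ident (comb_category \<Sigma>) D) =
    Ident (syntactic_category \<Sigma> {} :: (('s, 'r, 'i) obj, ('s, 'r, 'i) form set) cat) (comb_object \<Sigma> D)"
proof -
  note agree = agree_restrict_family[OF D, of same]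
  have hom: "hom \<Sigma> (model_of D) (model_of D) (restrict_family D same)"
    using hom_same[OF D] hom_cong[OF D agree] by blast
  show ?thesis
    unfolding comb_category_simps comb_object_def comb_morphism_eq[OF D D hom]
      Ident_syntactic[OF horn_regular[OF horn_relation_atoms[OF D]] comb_object_presents[OF D]]
    by (rule presented_class_hom_cong[OF agree cover_same])
qed

lemma comb_object_in_Ob:
  "D \<in> comb_data_over \<Sigma> \<Longrightarrow> comb_object \<Sigma> D \<in> Ob (syntactic_category \<Sigma> {})"
  by (simp add: comb_object_def syntactic_category_simps horn_cartesian horn_relation_atoms)

text \<open>Both isomorphisms are given by the identity of \<open>D\<close>.\<close>

lemma isomorphic_presented:
  fixes \<phi> \<psi> :: "('s, 'r, 'i) form"
  assumes \<phi>: "regular \<Sigma> \<Gamma> \<phi>" "presents \<Sigma> \<Gamma> \<phi> D q"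
    and \<psi>: "regular \<Sigma> \<Delta> \<psi>" "presents \<Sigma> \<Delta> \<psi> D p"
  shows "isomorphic_in (syntactic_category \<Sigma> {}) (\<Gamma>, \<phi>) (\<Delta>, \<psi>)"
  unfolding isomorphic_in_def
proof (intro bexI conjI)
  have same: "hom \<Sigma> (model_of D) (model_of D) same" by (rule hom_same[OF presentsD(1)[OF \<phi>(2)]])
  let ?f = "presented_class \<Sigma> (\<Gamma> + \<Delta>) D (copair \<Gamma> q (same \<odot> p)) :: ('s, 'r, 'i) form set"
  let ?g = "presented_class \<Sigma> (\<Delta> + \<Gamma>) D (copair \<Delta> p (same \<odot> q)) :: ('s, 'r, 'i) form set"
  show "?f \<in> Hom (syntactic_category \<Sigma> {}) (\<Gamma>, \<phi>) (\<Delta>, \<psi>)"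
    unfolding Hom_syntactic[OF \<phi> \<psi>] using same by blast
  show "?g \<in> Hom (syntactic_category \<Sigma> {}) (\<Delta>, \<psi>) (\<Gamma>, \<phi>)"
    unfolding Hom_syntactic[OF \<psi> \<phi>] using same by blast
  show "Comp (syntactic_category \<Sigma> {}) (\<Gamma>, \<phi>) (\<Delta>, \<psi>) (\<Gamma>, \<phi>) ?f ?g =
      Ident (syntactic_category \<Sigma> {}) (\<Gamma>, \<phi>)"
    unfolding Comp_syntactic[OF \<phi> \<psi> \<phi> same same] Ident_syntactic[OF \<phi>] by (simp add: same_def)
  show "Comp (syntactic_category \<Sigma> {}) (\<Delta>, \<psi>) (\<Gamma>, \<phi>) (\<Delta>, \<psi>) ?g ?f =
      Ident (syntactic_category \<Sigma> {}) (\<Delta>, \<psi>)"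
    unfolding Comp_syntactic[OF \<psi> \<phi> \<psi> same same] Ident_syntactic[OF \<psi>] by (simp add: same_def)
qed

lemma isomorphic_comb_object:
  fixes X :: "('s, 'r, 'i) obj"
  assumes "X \<in> Ob (syntactic_category \<Sigma> {})"
  shows "\<exists>D \<in> comb_data_over \<Sigma>. isomorphic_in (syntactic_category \<Sigma> {}) X (comb_object \<Sigma> D)"
proof -
  obtain \<Gamma> \<phi> D q where X: "X = (\<Gamma>, \<phi>)" "regular \<Sigma> \<Gamma> \<phi>" "presents \<Sigma> \<Gamma> \<phi> D q"
    using assms by (rule object_presentation)
  have D: "D \<in> comb_data_over \<Sigma>" by (rule presentsD(1)[OF X(3)])
  show ?thesis
    unfolding X(1) comb_object_def
    using isomorphic_presented[OF X(2,3) horn_regular[OF horn_relation_atoms[OF D]]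
        comb_object_presents[OF D]] D by blast
qed

theorem mainTheorem16:
  fixes \<Sigma> :: "('s, 'r) signature"
    and C :: "(('s, 'r, 'i) obj, ('s, 'r, 'i) form set) cat"
  assumes "wf_signature \<Sigma>"
    and "C = syntactic_category \<Sigma> {}"
  shows
    "(\<forall>D \<in> comb_data_over \<Sigma>. comb_object \<Sigma> D \<in> Ob C) \<and>
     (\<forall>X \<in> Ob C. \<exists>D \<in> comb_data_over \<Sigma>. isomorphic_in C X (comb_object \<Sigma> D)) \<and>
     (\<forall>D \<in> comb_data_over \<Sigma>. \<forall>D' \<in> comb_data_over \<Sigma>.
        (Hom C (comb_object \<Sigma> D) (comb_object \<Sigma> D') \<noteq> {} \<longrightarrow> support D' \<subseteq> support D) \<and>
        (support D' \<subseteq> support D \<longrightarrow>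
           bij_betw (comb_morphism \<Sigma> {} D D') (comb_families \<Sigma> D D')
             (Hom C (comb_object \<Sigma> D) (comb_object \<Sigma> D')))) \<and>
     (\<forall>D \<in> comb_data_over \<Sigma>. \<forall>D' \<in> comb_data_over \<Sigma>. \<forall>D'' \<in> comb_data_over \<Sigma>.
        support D' \<subseteq> support D \<longrightarrow> support D'' \<subseteq> support D' \<longrightarrow>
        (\<forall>f \<in> comb_families \<Sigma> D D'. \<forall>g \<in> comb_families \<Sigma> D' D''.
           comb_compose D'' f g \<in> comb_families \<Sigma> D D'' \<and>
           Comp C (comb_object \<Sigma> D) (comb_object \<Sigma> D') (comb_object \<Sigma> D'')
             (comb_morphism \<Sigma> {} D D' f) (comb_morphism \<Sigma> {} D' D'' g)
           = comb_morphism \<Sigma> {} D D'' (comb_compose D'' f g))) \<and>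
     equivalence_of_categories (comb_category \<Sigma>) C (comb_object \<Sigma>) (comb_morphism \<Sigma> {})"
proof -
  let ?K = "comb_category \<Sigma>"
  have objects: "comb_object \<Sigma> D \<in> Ob C" if "D \<in> comb_data_over \<Sigma>" for D
    unfolding assms(2) by (rule comb_object_in_Ob[OF that])
  have essential: "\<exists>D \<in> comb_data_over \<Sigma>. isomorphic_in C X (comb_object \<Sigma> D)" if "X \<in> Ob C" for X
    using isomorphic_comb_object that unfolding assms(2) by blast
  have full: "bij_betw (comb_morphism \<Sigma> {} D D') (Hom ?K D D')
      (Hom C (comb_object \<Sigma> D) (comb_object \<Sigma> D'))"
    if "D \<in> comb_data_over \<Sigma>" "D' \<in> comb_data_over \<Sigma>" for D D'
    using inj_comb_morphism[OF that] Hom_comb_objects[OF that]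
    unfolding assms(2) bij_betw_def by blast
  have compose: "Comp C (comb_object \<Sigma> D) (comb_object \<Sigma> D') (comb_object \<Sigma> D'')
      (comb_morphism \<Sigma> {} D D' f) (comb_morphism \<Sigma> {} D' D'' g) =
      comb_morphism \<Sigma> {} D D'' (comb_compose D'' f g)"
    if "D \<in> comb_data_over \<Sigma>" "D' \<in> comb_data_over \<Sigma>" "D'' \<in> comb_data_over \<Sigma>"
      "f \<in> Hom ?K D D'" "g \<in> Hom ?K D' D''" for D D' D'' f g
    unfolding assms(2) by (rule comb_morphism_compose[OF that])
  interpret K: category ?K by (rule category_comb)
  have families: "comb_compose D'' f g \<in> comb_families \<Sigma> D D''"
    if "D \<in> comb_data_over \<Sigma>" "D' \<in> comb_data_over \<Sigma>" "D'' \<in> comb_data_over \<Sigma>"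
      "f \<in> Hom ?K D D'" "g \<in> Hom ?K D' D''" for D D' D'' f g
    using K.comp_in_hom[OF _ _ _ that(4,5)] Hom_comb_category[OF that(1,3)] that(1-3)
    unfolding comb_category_simps(1) by (simp add: comb_category_simps(4) comb_compose_eq)
  have equivalence: "equivalence_of_categories ?K C (comb_object \<Sigma>) (comb_morphism \<Sigma> {})"
  proof -
    interpret C: category C unfolding assms(2) by (rule category_syntactic)
    show ?thesis
    proof (unfold_locales, unfold comb_category_simps(1))
      show "comb_morphism \<Sigma> {} D D (Ident ?K D) = Ident C (comb_object \<Sigma> D)"
        if "D \<in> comb_data_over \<Sigma>" for D
        unfolding assms(2) by (rule comb_morphism_ident[OF that])
      show "comb_morphism \<Sigma> {} D D'' (Comp ?K D D' D'' f g) =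
          Comp C (comb_object \<Sigma> D) (comb_object \<Sigma> D') (comb_object \<Sigma> D'')
            (comb_morphism \<Sigma> {} D D' f) (comb_morphism \<Sigma> {} D' D'' g)"
        if "D \<in> comb_data_over \<Sigma>" "D' \<in> comb_data_over \<Sigma>" "D'' \<in> comb_data_over \<Sigma>"
          "f \<in> Hom ?K D D'" "g \<in> Hom ?K D' D''" for D D' D'' f g
        using compose[OF that] by (simp add: comb_category_simps(4) comb_compose_eq)
    qed (rule objects full essential; assumption)+
  qed
  have hom_iff: "Hom ?K D D' = (if support D' \<subseteq> support D then comb_families \<Sigma> D D' else {})" for D D'
    by (rule comb_category_simps(2))
  show ?thesis
  proof (intro conjI ballI impI)
    fix D D' assume D: "D \<in> comb_data_over \<Sigma>" "D' \<in> comb_data_over \<Sigma>"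
    show "support D' \<subseteq> support D" if "Hom C (comb_object \<Sigma> D) (comb_object \<Sigma> D') \<noteq> {}"
      using full[OF D] that unfolding hom_iff by (auto simp: bij_betw_def split: if_splits)
    show "bij_betw (comb_morphism \<Sigma> {} D D') (comb_families \<Sigma> D D')
        (Hom C (comb_object \<Sigma> D) (comb_object \<Sigma> D'))" if "support D' \<subseteq> support D"
      using full[OF D] that unfolding hom_iff by simp
  qed (use objects essential equivalence families compose hom_iff in \<open>simp_all\<close>)
qed

end
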